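(* Let $d\ge1$, $2\le p<\infty$, let $\mathcal{O}\subset\mathbb{R}^d$ be a bounded smooth domain, and let $\mathcal{E}(u)=\frac12\int_{\mathcal{O}}|\nabla u(x)|^2dx+\frac1p\int_{\mathcal{O}}|u(x)|^pdx$ for $u\in L^p(\mathcal{O})\cap H_0^1(\mathcal{O})$. Then there exists a ground state $\mathcal{U}$, i.e. $\mathcal{U}$ is a solution to the minimization problem $$\min_{\mathcal{U}\in L^p(\mathcal{O})\cap H_0^1(\mathcal{O})}\big\{\mathcal{E}(\mathcal{U}):\|\mathcal{U}\|_{L^2(\mathcal{O})}=1\big\},$$ which also solves the stationary equation $$\Delta \mathcal{U}-|\mathcal{U}|^{p-2}\mathcal{U}+\|\nabla \mathcal{U}\|_{L^2(\mathcal{O})}^2\,\mathcal{U}+\|\mathcal{U}\|_{L^p(\mathcal{O})}^p\,\mathcal{U}=0\quad\text{in } L^{\frac{p}{p-1}}(\mathcal{O})+H^{-1}(\mathcal{O}).$$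
   Context: All functions are real-valued. $L^p(\mathcal{O})\cap H_0^1(\mathcal{O})$ has norm $\max\{\|u\|_{L^p(\mathcal{O})},\|\nabla u\|_{L^2(\mathcal{O})}\}$, and $L^{\frac{p}{p-1}}(\mathcal{O})+H^{-1}(\mathcal{O})$ is its dual; the equation means that the left-hand side, paired with any $v\in L^p(\mathcal{O})\cap H_0^1(\mathcal{O})$, vanishes (with $\langle\Delta u,v\rangle=-\int_{\mathcal{O}}\nabla u\cdot\nabla v\,dx$). *)

theory Defs
  imports "HOL-Analysis.Analysis"
begin

text \<open>
  Functions on \<open>\<Omega>\<close> are total functions on the ambient Euclidean space. Only their values on \<open>\<Omega>\<close>
  matter in the function spaces below, since all integrals are taken with respect to Lebesgue
  measure on \<open>\<Omega>\<close>; the elements of the spaces are representatives, not almost-everywhere classes.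
\<close>

subsection \<open>Smooth functions and smooth bounded domains\<close>

primrec C_k :: "nat \<Rightarrow> ('a::euclidean_space \<Rightarrow> real) \<Rightarrow> bool" where
  "C_k 0 f \<longleftrightarrow> continuous_on UNIV f"
| "C_k (Suc k) f \<longleftrightarrow> (\<exists>g. (\<forall>x. GDERIV f x :> g x) \<and> (\<forall>b\<in>Basis. C_k k (\<lambda>x. g x \<bullet> b)))"

definition smooth :: "('a::euclidean_space \<Rightarrow> real) \<Rightarrow> bool" where
  "smooth f \<longleftrightarrow> (\<forall>k. C_k k f)"

text \<open>
  Near each boundary point, \<open>\<Omega>\<close> is the part above the graph of a smooth function, in an
  orthonormal frame whose last axis is \<open>e\<close>: \<open>y \<bullet> e\<close> is the last coordinate of \<open>y\<close>, and
  \<open>y - (y \<bullet> e) *\<^sub>R e\<close> collects the other ones. In dimension one the latter is \<open>0\<close>, so \<open>\<Omega>\<close> is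
  locally a half-line. The values of \<open>\<gamma>\<close> off the hyperplane orthogonal to \<open>e\<close> are irrelevant
  (a smooth function on the hyperplane extends by composition with the projection).
\<close>

definition smooth_boundary :: "'a::euclidean_space set \<Rightarrow> bool" where
  "smooth_boundary \<Omega> \<longleftrightarrow>
     (\<forall>x\<in>frontier \<Omega>. \<exists>r>0. \<exists>e \<gamma>. norm e = 1 \<and> smooth \<gamma> \<and>
        \<Omega> \<inter> ball x r = {y \<in> ball x r. \<gamma> (y - (y \<bullet> e) *\<^sub>R e) < y \<bullet> e})"

definition bounded_smooth_domain :: "'a::euclidean_space set \<Rightarrow> bool" where
  "bounded_smooth_domain \<Omega> \<longleftrightarrow>
     open \<Omega> \<and> connected \<Omega> \<and> \<Omega> \<noteq> {} \<and> bounded \<Omega> \<and> smooth_boundary \<Omega>"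

subsection \<open>Lebesgue spaces\<close>

definition Lp :: "real \<Rightarrow> 'a::euclidean_space set \<Rightarrow> ('a \<Rightarrow> 'b::euclidean_space) set" where
  "Lp p \<Omega> = {f. f \<in> borel_measurable (lebesgue_on \<Omega>) \<and>
                integrable (lebesgue_on \<Omega>) (\<lambda>x. norm (f x) powr p)}"

definition Lp_norm :: "real \<Rightarrow> 'a::euclidean_space set \<Rightarrow> ('a \<Rightarrow> 'b::euclidean_space) \<Rightarrow> real" where
  "Lp_norm p \<Omega> f = (LINT x|lebesgue_on \<Omega>. norm (f x) powr p) powr (1 / p)"

subsection \<open>Sobolev spaces\<close>

definition test_functions :: "'a::euclidean_space set \<Rightarrow> ('a \<Rightarrow> real) set" where
  "test_functions \<Omega> =
     {\<phi>. smooth \<phi> \<and> compact (closure {x. \<phi> x \<noteq> 0}) \<and> closure {x. \<phi> x \<noteq> 0} \<subseteq> \<Omega>}"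

definition loc_integrable :: "'a::euclidean_space set \<Rightarrow> ('a \<Rightarrow> 'b::euclidean_space) \<Rightarrow> bool" where
  "loc_integrable \<Omega> f \<longleftrightarrow> (\<forall>K. compact K \<and> K \<subseteq> \<Omega> \<longrightarrow> f absolutely_integrable_on K)"

definition has_weak_gradient ::
    "'a::euclidean_space set \<Rightarrow> ('a \<Rightarrow> real) \<Rightarrow> ('a \<Rightarrow> 'a) \<Rightarrow> bool" where
  "has_weak_gradient \<Omega> u G \<longleftrightarrow> loc_integrable \<Omega> u \<and> loc_integrable \<Omega> G \<and>
     (\<forall>\<phi>\<in>test_functions \<Omega>. \<forall>D\<phi>. (\<forall>x. GDERIV \<phi> x :> D\<phi> x) \<longrightarrow>
        (LINT x|lebesgue_on \<Omega>. u x *\<^sub>R D\<phi> x) = - (LINT x|lebesgue_on \<Omega>. \<phi> x *\<^sub>R G x))"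

text \<open>The weak gradient is unique only almost everywhere on \<open>\<Omega>\<close>; this picks a representative.\<close>

definition weak_gradient :: "'a::euclidean_space set \<Rightarrow> ('a \<Rightarrow> real) \<Rightarrow> 'a \<Rightarrow> 'a" where
  "weak_gradient \<Omega> u = (SOME G. has_weak_gradient \<Omega> u G)"

definition H1 :: "'a::euclidean_space set \<Rightarrow> ('a \<Rightarrow> real) set" where
  "H1 \<Omega> = {u. u \<in> Lp 2 \<Omega> \<and> (\<exists>G. has_weak_gradient \<Omega> u G \<and> G \<in> Lp 2 \<Omega>)}"

definition H1_norm :: "'a::euclidean_space set \<Rightarrow> ('a \<Rightarrow> real) \<Rightarrow> real" where
  "H1_norm \<Omega> u = sqrt ((Lp_norm 2 \<Omega> u)\<^sup>2 + (Lp_norm 2 \<Omega> (weak_gradient \<Omega> u))\<^sup>2)"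

text \<open>The closure of the test functions in \<open>H1 \<Omega>\<close>.\<close>

definition H01 :: "'a::euclidean_space set \<Rightarrow> ('a \<Rightarrow> real) set" where
  "H01 \<Omega> = {u \<in> H1 \<Omega>. \<forall>\<epsilon>>0. \<exists>\<phi>\<in>test_functions \<Omega>. H1_norm \<Omega> (\<lambda>x. u x - \<phi> x) < \<epsilon>}"

subsection \<open>Energy, ground states and the stationary equation\<close>

definition energy :: "real \<Rightarrow> 'a::euclidean_space set \<Rightarrow> ('a \<Rightarrow> real) \<Rightarrow> real" where
  "energy p \<Omega> u = 1/2 * (LINT x|lebesgue_on \<Omega>. (norm (weak_gradient \<Omega> u x))\<^sup>2)
                + 1/p * (LINT x|lebesgue_on \<Omega>. \<bar>u x\<bar> powr p)"

definition ground_state :: "real \<Rightarrow> 'a::euclidean_space set \<Rightarrow> ('a \<Rightarrow> real) \<Rightarrow> bool" where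
  "ground_state p \<Omega> U \<longleftrightarrow>
     is_arg_min (energy p \<Omega>) (\<lambda>u. u \<in> Lp p \<Omega> \<inter> H01 \<Omega> \<and> Lp_norm 2 \<Omega> u = 1) U"

text \<open>
  The dual of \<open>Lp p \<Omega> \<inter> H01 \<Omega>\<close> is \<open>L\<^sup>p\<^sup>' + H\<^sup>-\<^sup>1\<close> with \<open>p' = p / (p - 1)\<close>. Its elements enter through
  their pairing with \<open>v\<close>: a function \<open>f\<close> acts by integration, and the Laplacian of \<open>u\<close> acts as
  minus the Dirichlet form.
\<close>

definition fun_pairing :: "'a::euclidean_space set \<Rightarrow> ('a \<Rightarrow> real) \<Rightarrow> ('a \<Rightarrow> real) \<Rightarrow> real" where
  "fun_pairing \<Omega> f v = (LINT x|lebesgue_on \<Omega>. f x * v x)"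

definition laplacian_pairing :: "'a::euclidean_space set \<Rightarrow> ('a \<Rightarrow> real) \<Rightarrow> ('a \<Rightarrow> real) \<Rightarrow> real" where
  "laplacian_pairing \<Omega> u v =
     - (LINT x|lebesgue_on \<Omega>. weak_gradient \<Omega> u x \<bullet> weak_gradient \<Omega> v x)"

text \<open>
  For \<open>p = 2\<close> the factor \<open>\<bar>u x\<bar> powr (p - 2)\<close> is \<open>0\<close> rather than \<open>1\<close> where \<open>u x = 0\<close>; this does
  not matter, because it is multiplied by \<open>u x\<close>.
\<close>

definition solves_stationary_equation ::
    "real \<Rightarrow> 'a::euclidean_space set \<Rightarrow> ('a \<Rightarrow> real) \<Rightarrow> bool" where
  "solves_stationary_equation p \<Omega> u \<longleftrightarrow>
     (\<forall>v \<in> Lp p \<Omega> \<inter> H01 \<Omega>.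
        laplacian_pairing \<Omega> u v
        - fun_pairing \<Omega> (\<lambda>x. \<bar>u x\<bar> powr (p - 2) * u x) v
        + fun_pairing \<Omega> (\<lambda>x. (Lp_norm 2 \<Omega> (weak_gradient \<Omega> u))\<^sup>2 * u x) v
        + fun_pairing \<Omega> (\<lambda>x. Lp_norm p \<Omega> u powr p * u x) v = 0)"

end

theory Submission
  imports Defs "HOL-Complex_Analysis.Great_Picard"
begin

text \<open>
  The direct method. Since \<open>\<Omega>\<close> is bounded, Rellich's theorem makes a minimizing sequence, after
  passing to a subsequence, Cauchy in \<open>L\<^sup>2\<close>, so that the limit \<open>U\<close> satisfies the constraint. No
  weak convergence is needed for the gradients: the midpoint of two almost minimizers that are close
  in \<open>L\<^sup>2\<close> has norm almost \<open>1\<close>, hence energy not much below the infimum, and the parallelogram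
  identity forces their gradients to be close in \<open>L\<^sup>2\<close> too. Fatou's lemma handles the \<open>L\<^sup>p\<close> term.
  The stationary equation is the vanishing at \<open>t = 0\<close> of the derivative of the energy of
  \<open>(U + t v) / \<parallel>U + t v\<parallel>\<close>.

  For Rellich's theorem, a test function is compared with its averages over balls of radius
  \<open>\<epsilon>\<close>: the translation estimate \<open>\<parallel>\<phi>(\<cdot> + z) - \<phi>\<parallel> \<le> |z| \<parallel>\<nabla>\<phi>\<parallel>\<close> in \<open>L\<^sup>2\<close> bounds both the error and
  the modulus of continuity of the averages.
\<close>

section \<open>Smooth functions and test functions\<close>

text \<open>Two obstacles shape the proof. Beyond the critical exponent there is neither a Sobolev
  embedding into L^p nor compactness there, so the L^p term is handled only through convexity and
  lower semicontinuity, and L^2 compactness of the functions has to carry everything else. Moreover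
  \<open>weak_gradient\<close> is an arbitrary choice among functions that agree almost everywhere,
  and \<open>H01\<close> is defined through it, so that not even linearity is visible. Pairs of a
  function and a gradient are therefore carried explicitly; uniqueness of weak gradients serves to
  translate the given definitions into such pairs. Since the competitors are normalized,
  \<open>v\<close> can be an arbitrary direction and no abstract Lagrange multiplier occurs: the
  factors 1/2 and 1/p of the energy cancel the degrees 2 and p with which its two terms scale, which
  is why both multipliers of the equation have coefficient 1.\<close>

lemma C_k_0_of_Suc:
  assumes "C_k (Suc k) f"
  shows "continuous_on UNIV f"
proof -
  obtain g where "\<And>x. GDERIV f x :> g x" using assms by auto
  then show ?thesis
    unfolding gderiv_def continuous_on_eq_continuous_at[OF open_UNIV]
    using has_derivative_continuous by blast
qed

lemma C_k_Suc_imp: "C_k (Suc k) f \<Longrightarrow> C_k k f"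
proof (induction k arbitrary: f)
  case 0
  then show ?case using C_k_0_of_Suc by (metis C_k.simps(1))
next
  case (Suc k)
  then show ?case by (metis C_k.simps(2))
qed

lemma C_k_const: "C_k k (\<lambda>x::'a::euclidean_space. c)"
proof (induction k arbitrary: c)
  case (Suc k)
  have "\<forall>x::'a. GDERIV (\<lambda>x. c) x :> 0" by (simp add: GDERIV_const)
  moreover have "\<forall>b\<in>Basis. C_k k (\<lambda>x::'a. (0::'a) \<bullet> b)" using Suc[of 0] by simp
  ultimately show ?case unfolding C_k.simps
    by (intro exI[of _ "\<lambda>_::'a. 0::'a"] conjI)
qed auto

lemma C_k_add: "C_k k f \<Longrightarrow> C_k k g \<Longrightarrow> C_k k (\<lambda>x. f x + g x)"
proof (induction k arbitrary: f g)
  case 0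
  then show ?case by (auto intro: continuous_on_add)
next
  case (Suc k)
  obtain f' g' where
    "\<And>x. GDERIV f x :> f' x" "\<And>b. b \<in> Basis \<Longrightarrow> C_k k (\<lambda>x. f' x \<bullet> b)"
    "\<And>x. GDERIV g x :> g' x" "\<And>b. b \<in> Basis \<Longrightarrow> C_k k (\<lambda>x. g' x \<bullet> b)"
    using Suc.prems unfolding C_k.simps by metis
  then show ?case unfolding C_k.simps
    by (intro exI[of _ "\<lambda>x. f' x + g' x"]) (auto simp: inner_add_left intro!: GDERIV_add Suc.IH)
qed

lemma C_k_mult: "C_k k f \<Longrightarrow> C_k k g \<Longrightarrow> C_k k (\<lambda>x. f x * g x)"
proof (induction k arbitrary: f g)
  case 0
  then show ?case by (auto intro: continuous_on_mult)
next
  case (Suc k)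
  obtain f' g' where *:
    "\<And>x. GDERIV f x :> f' x" "\<And>b. b \<in> Basis \<Longrightarrow> C_k k (\<lambda>x. f' x \<bullet> b)"
    "\<And>x. GDERIV g x :> g' x" "\<And>b. b \<in> Basis \<Longrightarrow> C_k k (\<lambda>x. g' x \<bullet> b)"
    using Suc.prems unfolding C_k.simps by metis
  have "C_k k f" "C_k k g" using Suc.prems C_k_Suc_imp by auto
  then have "C_k k (\<lambda>x. f x * (g' x \<bullet> b) + g x * (f' x \<bullet> b))" if "b \<in> Basis" for b
    using * that by (intro C_k_add Suc.IH) auto
  with * show ?case unfolding C_k.simps
    by (intro exI[of _ "\<lambda>x. f x *\<^sub>R g' x + g x *\<^sub>R f' x"])
       (auto simp: inner_add_left intro!: GDERIV_mult)
qed

lemma smooth_const: "smooth (\<lambda>x. c)"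
  and smooth_add: "smooth f \<Longrightarrow> smooth g \<Longrightarrow> smooth (\<lambda>x. f x + g x)"
  and smooth_mult: "smooth f \<Longrightarrow> smooth g \<Longrightarrow> smooth (\<lambda>x. f x * g x)"
  by (auto simp: smooth_def C_k_const C_k_add C_k_mult)

lemma smooth_prod:
  assumes "\<And>i. i \<in> I \<Longrightarrow> smooth (f i)"
  shows "smooth (\<lambda>x. \<Prod>i\<in>I. f i x)"
  using assms
proof (induction I rule: infinite_finite_induct)
  case (insert i I)
  then show ?case by (simp add: smooth_mult)
qed (auto simp: smooth_const)

lemma GDERIV_unique:
  assumes "GDERIV f x :> D" "GDERIV f x :> E"
  shows "D = E"
  using has_derivative_unique[OF assms[unfolded gderiv_def]] by (metis inner_commute vector_eq_ldot)

lemma smooth_gradient: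
  assumes "smooth f"
  obtains Df where "\<And>x. GDERIV f x :> Df x"
  using assms unfolding smooth_def by (metis C_k.simps(2))

lemma smooth_continuous: "smooth f \<Longrightarrow> continuous_on UNIV f"
  unfolding smooth_def by (metis C_k.simps(1))

lemma smooth_gradient_continuous:
  assumes "smooth f" "\<And>x. GDERIV f x :> Df x"
  shows "continuous_on UNIV Df"
proof -
  have "C_k (Suc 0) f" using assms unfolding smooth_def by blast
  then obtain g where g: "\<And>x. GDERIV f x :> g x" "\<And>b. b \<in> Basis \<Longrightarrow> continuous_on UNIV (\<lambda>x. g x \<bullet> b)"
    by auto
  \<comment> \<open>\<open>C_k\<close> only asserts that some gradient has continuous components;
    uniqueness transfers this to the given one.\<close>
  then have "g = Df" using GDERIV_unique assms(2) by blast
  then show ?thesis using g(2) continuous_on_componentwise by blast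
qed

text \<open>The derivatives of \<open>s \<mapsto> exp (- 1 / s)\<close> are linear combinations of these functions.\<close>

definition flat :: "nat \<Rightarrow> real \<Rightarrow> real" where
  "flat m s = (if s > 0 then (1 / s) ^ m * exp (- 1 / s) else 0)"

text \<open>At 0 the right difference quotient is \<open>(1 / h) ^ (m + 1) * exp (- 1 / h)\<close>,
  and the exponential wins. Keeping all powers \<open>m\<close> in one family makes the family
  closed under differentiation, which is what an induction on the order of smoothness needs.\<close>

lemma DERIV_flat: "(flat m has_real_derivative flat (m + 2) s - real m * flat (m + 1) s) (at s)"
proof -
  consider "s < 0" | "s = 0" | "s > 0" by linarith
  then show ?thesis
  proof cases
    case 1
    have "((\<lambda>_. 0) has_real_derivative 0) (at s)" by simp
    then have "(flat m has_real_derivative 0) (at s)"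
      by (rule has_field_derivative_transform_within_open[of _ _ _ "{..<0}"]) (use 1 in \<open>auto simp: flat_def\<close>)
    with 1 show ?thesis by (simp add: flat_def)
  next
    case 3
    \<comment> \<open>For \<open>m = 0\<close> the truncated exponent \<open>m - 1\<close> is
      harmless, because the factor \<open>real m\<close> vanishes.\<close>
    have e: "real m * inverse s ^ (m - 1) * (inverse s)\<^sup>2 = real m * inverse s ^ (m + 1)"
      by (cases m) (auto simp: power2_eq_square)
    have "((\<lambda>s. inverse s ^ m * exp (- inverse s)) has_real_derivative
             real m * inverse s ^ (m - 1) * (- (inverse s)\<^sup>2) * exp (- inverse s)
             + inverse s ^ m * (exp (- inverse s) * (inverse s)\<^sup>2)) (at s)"
      by (rule derivative_eq_intros refl | use 3 in \<open>simp add: power2_eq_square; fail\<close>)+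
    also have "real m * inverse s ^ (m - 1) * (- (inverse s)\<^sup>2) * exp (- inverse s)
             + inverse s ^ m * (exp (- inverse s) * (inverse s)\<^sup>2)
        = inverse s ^ (m + 2) * exp (- inverse s) - real m * inverse s ^ (m + 1) * exp (- inverse s)"
    proof -
      have "real m * inverse s ^ (m - 1) * (- (inverse s)\<^sup>2) = - (real m * inverse s ^ (m + 1))"
        unfolding e[symmetric] by (rule mult_minus_right)
      moreover have "inverse s ^ m * (exp (- inverse s) * (inverse s)\<^sup>2) = inverse s ^ (m + 2) * exp (- inverse s)"
        by (simp only: power_add mult_ac)
      ultimately show ?thesis by (simp only: mult_minus_left uminus_add_conv_diff)
    qed
    finally have "((\<lambda>s. (1 / s) ^ m * exp (- 1 / s)) has_real_derivative
             (1 / s) ^ (m + 2) * exp (- 1 / s) - real m * ((1 / s) ^ (m + 1) * exp (- 1 / s))) (at s)"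
      by (simp add: inverse_eq_divide mult.assoc)
    then have "(flat m has_real_derivative
             (1 / s) ^ (m + 2) * exp (- 1 / s) - real m * ((1 / s) ^ (m + 1) * exp (- 1 / s))) (at s)"
      by (rule has_field_derivative_transform_within_open[of _ _ _ "{0<..}"]) (use 3 in \<open>auto simp: flat_def\<close>)
    with 3 show ?thesis by (simp add: flat_def)
  next
    case 2
    have "((\<lambda>h. flat m h / h) \<longlongrightarrow> 0) (at_left 0)"
      by (rule tendsto_eventually) (auto simp: flat_def eventually_at_filter)
    moreover have "((\<lambda>h. flat m h / h) \<longlongrightarrow> 0) (at_right 0)"
    proof -
      have "((\<lambda>h. inverse h ^ (m + 1) / exp (inverse h)) \<longlongrightarrow> 0) (at_right (0::real))"
        by (rule filterlim_compose[OF tendsto_power_div_exp_0 filterlim_inverse_at_top_right])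
      then show ?thesis
        by (rule Lim_transform_eventually)
           (auto simp: flat_def eventually_at_filter exp_minus field_simps)
    qed
    ultimately have "((\<lambda>h. flat m h / h) \<longlongrightarrow> 0) (at 0)" by (rule filterlim_split_at)
    then have "(flat m has_real_derivative 0) (at 0)" by (simp add: DERIV_def flat_def)
    with 2 show ?thesis by (simp add: flat_def)
  qed
qed

lemma GDERIV_affine: "GDERIV (\<lambda>x. c + v \<bullet> x) x :> v"
  unfolding gderiv_def
  by (auto intro!: derivative_eq_intros simp: inner_commute)

text \<open>The induction on the order keeps \<open>m\<close> arbitrary: each gradient is
  \<open>v\<close> times a combination of the same functions at \<open>m + 1\<close> and
  \<open>m + 2\<close>. The affine argument covers both kinds of factors in a product bump.\<close>

lemma smooth_flat: "smooth (\<lambda>x. flat m (c + v \<bullet> x))"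
proof -
  have "C_k k (\<lambda>x. flat m (c + v \<bullet> x))" for k
  proof (induction k arbitrary: m)
    case 0
    have "continuous_on UNIV (flat m)"
      using DERIV_flat DERIV_isCont continuous_at_imp_continuous_on by blast
    then have "continuous_on UNIV (\<lambda>x. flat m (c + v \<bullet> x))"
      by (rule continuous_on_compose2) (auto intro!: continuous_intros)
    then show ?case by simp
  next
    case (Suc k)
    let ?g = "\<lambda>x. flat (m + 2) (c + v \<bullet> x) - real m * flat (m + 1) (c + v \<bullet> x)"
    have "GDERIV (\<lambda>x. flat m (c + v \<bullet> x)) x :> ?g x *\<^sub>R v" for x
      by (rule GDERIV_DERIV_compose[OF GDERIV_affine DERIV_flat])
    moreover have "C_k k (\<lambda>x. (?g x *\<^sub>R v) \<bullet> b)" for b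
    proof -
      have "C_k k (\<lambda>x. (v \<bullet> b) * (flat (m + 2) (c + v \<bullet> x) + (- real m) * flat (m + 1) (c + v \<bullet> x)))"
        by (intro C_k_mult C_k_const C_k_add Suc)
      then show ?thesis by (simp add: algebra_simps)
    qed
    ultimately show ?case unfolding C_k.simps by (intro exI[of _ "\<lambda>x. ?g x *\<^sub>R v"]) auto
  qed
  then show ?thesis by (simp add: smooth_def)
qed

section \<open>Bump functions on boxes\<close>

lemma flat_0_bounds: "0 \<le> flat 0 s" "flat 0 s \<le> 1"
  by (auto simp: flat_def)

lemma flat_0_tendsto_1:
  assumes "s > 0"
  shows "(\<lambda>n. flat 0 (real (Suc n) * s)) \<longlonglongrightarrow> 1"
proof -
  have "(\<lambda>n. exp (- (1 / s) * (1 / real (Suc n)))) \<longlonglongrightarrow> exp (- (1 / s) * 0)"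
    by (intro tendsto_intros LIMSEQ_Suc[OF lim_1_over_n])
  moreover have "flat 0 (real (Suc n) * s) = exp (- (1 / s) * (1 / real (Suc n)))" for n
    using assms by (simp add: flat_def field_simps add_pos_nonneg del: of_nat_Suc)
  ultimately show ?thesis by simp
qed

text \<open>The set where the bump is nonzero does not move with \<open>n\<close>; the factor
  \<open>Suc n\<close> only pushes each \<open>exp (- 1 / s)\<close> towards 1 inside the box.
  Indicators of boxes thus become pointwise limits of test functions without mollification.
  \<open>Suc\<close> makes index 0 a genuine bump as well.\<close>

definition box_bump :: "nat \<Rightarrow> 'a::euclidean_space \<Rightarrow> 'a \<Rightarrow> 'a \<Rightarrow> real" where
  "box_bump n a b x =
     (\<Prod>i\<in>Basis. flat 0 (real (Suc n) * (x \<bullet> i - a \<bullet> i)) * flat 0 (real (Suc n) * (b \<bullet> i - x \<bullet> i)))"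

lemma smooth_box_bump: "smooth (box_bump n a b)"
proof -
  have "smooth (\<lambda>x. \<Prod>i\<in>Basis. flat 0 (- real (Suc n) * (a \<bullet> i) + (real (Suc n) *\<^sub>R i) \<bullet> x)
           * flat 0 (real (Suc n) * (b \<bullet> i) + (- real (Suc n) *\<^sub>R i) \<bullet> x))"
    by (intro smooth_prod smooth_mult smooth_flat)
  moreover have "box_bump n a b = (\<lambda>x. \<Prod>i\<in>Basis. flat 0 (- real (Suc n) * (a \<bullet> i) + (real (Suc n) *\<^sub>R i) \<bullet> x)
           * flat 0 (real (Suc n) * (b \<bullet> i) + (- real (Suc n) *\<^sub>R i) \<bullet> x))"
    unfolding box_bump_def by (intro ext prod.cong refl) (simp add: algebra_simps inner_commute)
  ultimately show ?thesis by simp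
qed

lemma box_bump_eq_0_iff: "box_bump n a b x = 0 \<longleftrightarrow> x \<notin> box a b"
proof -
  have "flat 0 (real (Suc n) * (x \<bullet> i - a \<bullet> i)) = 0 \<longleftrightarrow> x \<bullet> i \<le> a \<bullet> i"
    "flat 0 (real (Suc n) * (b \<bullet> i - x \<bullet> i)) = 0 \<longleftrightarrow> b \<bullet> i \<le> x \<bullet> i" for i
    by (auto simp: flat_def not_less zero_less_mult_iff)
  then show ?thesis unfolding box_bump_def
    by (auto simp: mem_box not_less simp del: of_nat_Suc)
qed

lemma box_bump_bounds: "0 \<le> box_bump n a b x" "box_bump n a b x \<le> 1"
  unfolding box_bump_def
  by (auto intro!: prod_nonneg prod_le_1 mult_le_one simp: flat_0_bounds simp del: of_nat_Suc)

lemma box_bump_tendsto: "(\<lambda>n. box_bump n a b x) \<longlonglongrightarrow> indicator (box a b) x"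
proof (cases "x \<in> box a b")
  case True
  have "(\<lambda>n. box_bump n a b x) \<longlonglongrightarrow> (\<Prod>i\<in>(Basis::'a set). 1 * 1)"
    unfolding box_bump_def
    by (intro tendsto_prod tendsto_mult flat_0_tendsto_1) (use True in \<open>auto simp: mem_box\<close>)
  with True show ?thesis by simp
next
  case False
  then have "box_bump n a b x = 0" for n by (simp add: box_bump_eq_0_iff)
  with False show ?thesis by simp
qed

lemma box_bump_test:
  assumes "cbox a b \<subseteq> \<Omega>"
  shows "box_bump n a b \<in> test_functions \<Omega>"
proof -
  have "{x. box_bump n a b x \<noteq> 0} = box a b" by (auto simp: box_bump_eq_0_iff)
  moreover have "closure (box a b) \<subseteq> cbox a b"
    by (rule closure_minimal) (auto simp: box_subset_cbox closed_cbox)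
  ultimately show ?thesis using assms
    by (auto simp: test_functions_def smooth_box_bump intro: compact_closure[THEN iffD2]
        bounded_subset[OF bounded_cbox box_subset_cbox])
qed

section \<open>Linear operations on test functions\<close>

lemma compact_closed_subset_of:
  assumes "compact T" "closure S \<subseteq> T"
  shows "compact (closure (S :: 'a::euclidean_space set))"
  using compact_Int_closed[OF assms(1) closed_closure[of S]] assms(2) by (simp add: Int_absorb1)

lemma test_functions_add:
  assumes "\<phi> \<in> test_functions \<Omega>" "\<psi> \<in> test_functions \<Omega>"
  shows "(\<lambda>x. \<phi> x + \<psi> x) \<in> test_functions \<Omega>"
proof -
  have "closure {x. \<phi> x + \<psi> x \<noteq> 0} \<subseteq> closure ({x. \<phi> x \<noteq> 0} \<union> {x. \<psi> x \<noteq> 0})"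
    by (intro closure_mono) auto
  then have s: "closure {x. \<phi> x + \<psi> x \<noteq> 0} \<subseteq> closure {x. \<phi> x \<noteq> 0} \<union> closure {x. \<psi> x \<noteq> 0}"
    by (simp add: closure_Un)
  moreover have "compact (closure {x. \<phi> x \<noteq> 0} \<union> closure {x. \<psi> x \<noteq> 0})"
    using assms by (auto simp: test_functions_def)
  then have "compact (closure {x. \<phi> x + \<psi> x \<noteq> 0})"
    using s by (rule compact_closed_subset_of)
  ultimately show ?thesis using assms by (auto simp: test_functions_def smooth_add)
qed

lemma test_functions_smooth_mult:
  assumes "\<phi> \<in> test_functions \<Omega>" "smooth \<psi>"
  shows "(\<lambda>x. \<psi> x * \<phi> x) \<in> test_functions \<Omega>"
proof -
  have s: "closure {x. \<psi> x * \<phi> x \<noteq> 0} \<subseteq> closure {x. \<phi> x \<noteq> 0}"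
    by (intro closure_mono) auto
  moreover have "compact (closure {x. \<psi> x * \<phi> x \<noteq> 0})"
    by (rule compact_closed_subset_of[OF _ s]) (use assms in \<open>simp add: test_functions_def\<close>)
  ultimately show ?thesis using assms by (auto simp: test_functions_def smooth_mult)
qed

lemma test_functions_cmult:
  "\<phi> \<in> test_functions \<Omega> \<Longrightarrow> (\<lambda>x. c * \<phi> x) \<in> test_functions \<Omega>"
  by (rule test_functions_smooth_mult[OF _ smooth_const])

section \<open>Square integrable functions\<close>

definition l2 :: "'a measure \<Rightarrow> ('a \<Rightarrow> 'b::euclidean_space) set" where
  "l2 M = {f. f \<in> borel_measurable M \<and> integrable M (\<lambda>x. (norm (f x))\<^sup>2)}"

definition l2norm :: "'a measure \<Rightarrow> ('a \<Rightarrow> 'b::euclidean_space) \<Rightarrow> real" where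
  "l2norm M f = sqrt (LINT x|M. (norm (f x))\<^sup>2)"

lemma l2_integrable: "f \<in> l2 M \<Longrightarrow> integrable M (\<lambda>x. (norm (f x))\<^sup>2)"
  by (simp add: l2_def)

lemma l2norm_nonneg: "0 \<le> l2norm M f"
  by (simp add: l2norm_def)

lemma l2norm_power2: "(l2norm M f)\<^sup>2 = (LINT x|M. (norm (f x))\<^sup>2)"
  by (simp add: l2norm_def)

lemma l2_scaleR: "f \<in> l2 M \<Longrightarrow> (\<lambda>x. c *\<^sub>R f x) \<in> l2 M"
  by (auto simp: l2_def power_mult_distrib)

lemma l2norm_scaleR: "l2norm M (\<lambda>x. c *\<^sub>R f x) = \<bar>c\<bar> * l2norm M f"
  by (simp add: l2norm_def power_mult_distrib real_sqrt_mult)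

lemma l2_inner_integrable:
  assumes "f \<in> l2 M" "g \<in> l2 M"
  shows "integrable M (\<lambda>x. f x \<bullet> g x)"
proof (rule Bochner_Integration.integrable_bound)
  show "integrable M (\<lambda>x. (norm (f x))\<^sup>2 + (norm (g x))\<^sup>2)"
    using assms by (auto simp: l2_def)
  have "\<bar>f x \<bullet> g x\<bar> \<le> (norm (f x))\<^sup>2 + (norm (g x))\<^sup>2" for x
  proof -
    have "\<bar>f x \<bullet> g x\<bar> \<le> norm (f x) * norm (g x)" by (rule Cauchy_Schwarz_ineq2)
    also have "\<dots> \<le> (norm (f x))\<^sup>2 + (norm (g x))\<^sup>2"
      using sum_squares_bound[of "norm (f x)" "norm (g x)"]
      mult_nonneg_nonneg[OF norm_ge_zero[of "f x"] norm_ge_zero[of "g x"]] by linarith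
    finally show ?thesis .
  qed
  then show "AE x in M. norm (f x \<bullet> g x) \<le> norm ((norm (f x))\<^sup>2 + (norm (g x))\<^sup>2)" by auto
qed (use assms in \<open>auto simp: l2_def\<close>)

lemma norm_add_power2: "(norm (a + b))\<^sup>2 = (norm a)\<^sup>2 + 2 * (a \<bullet> b) + (norm (b::'b::euclidean_space))\<^sup>2"
  by (simp add: power2_norm_eq_inner inner_add inner_commute)

lemma l2_add: "f \<in> l2 M \<Longrightarrow> g \<in> l2 M \<Longrightarrow> (\<lambda>x. f x + g x) \<in> l2 M"
  using l2_inner_integrable[of f M g] by (auto simp: l2_def norm_add_power2)

lemma l2_diff: "f \<in> l2 M \<Longrightarrow> g \<in> l2 M \<Longrightarrow> (\<lambda>x. f x - g x) \<in> l2 M"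
  using l2_add[of f M "\<lambda>x. (- 1) *\<^sub>R g x"] l2_scaleR[of g M "- 1"] by simp

lemma l2norm_add_power2:
  assumes "f \<in> l2 M" "g \<in> l2 M"
  shows "(l2norm M (\<lambda>x. f x + g x))\<^sup>2 = (l2norm M f)\<^sup>2 + 2 * (LINT x|M. f x \<bullet> g x) + (l2norm M g)\<^sup>2"
  using assms l2_inner_integrable[OF assms]
  by (simp add: l2norm_power2 norm_add_power2 l2_def)

lemma l2_Cauchy_Schwarz:
  assumes "f \<in> l2 M" "g \<in> l2 M"
  shows "\<bar>LINT x|M. f x \<bullet> g x\<bar> \<le> l2norm M f * l2norm M g"
proof -
  define I where "I = (LINT x|M. f x \<bullet> g x)"
  \<comment> \<open>Expanding the squared norm of \<open>f + t g\<close> gives a polynomial in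
    \<open>t\<close> that is never negative; both cases below insert a suitable
    \<open>t\<close>.\<close>
  have q: "0 \<le> (l2norm M f)\<^sup>2 + 2 * t * I + t\<^sup>2 * (l2norm M g)\<^sup>2" for t
  proof -
    have "0 \<le> (l2norm M (\<lambda>x. f x + t *\<^sub>R g x))\<^sup>2" by simp
    also have "\<dots> = (l2norm M f)\<^sup>2 + 2 * t * I + t\<^sup>2 * (l2norm M g)\<^sup>2"
      using l2_inner_integrable[OF assms]
      by (subst l2norm_add_power2) (use assms l2_scaleR in \<open>auto simp: I_def l2norm_scaleR power_mult_distrib\<close>)
    finally show ?thesis .
  qed
  have "I\<^sup>2 \<le> (l2norm M f)\<^sup>2 * (l2norm M g)\<^sup>2"
  proof (cases "l2norm M g = 0")
    case True
    have "I = 0"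
    proof (rule ccontr)
      assume "I \<noteq> 0"
      \<comment> \<open>The bound is linear in \<open>t\<close> here, and this \<open>t\<close>
        turns it into 0 \<le> -1.\<close>
      then have "2 * (- ((l2norm M f)\<^sup>2 + 1) / (2 * I)) * I = - ((l2norm M f)\<^sup>2 + 1)" by simp
      with q[of "- ((l2norm M f)\<^sup>2 + 1) / (2 * I)"] True show False by simp
    qed
    then show ?thesis by simp
  next
    case False
    \<comment> \<open>The inserted \<open>t\<close> is the minimizer of the quadratic.\<close>
    then have "2 * (- I / (l2norm M g)\<^sup>2) * I + (- I / (l2norm M g)\<^sup>2)\<^sup>2 * (l2norm M g)\<^sup>2 = - I\<^sup>2 / (l2norm M g)\<^sup>2"
      by (simp add: field_simps power2_eq_square)
    with q[of "- I / (l2norm M g)\<^sup>2"] have "I\<^sup>2 / (l2norm M g)\<^sup>2 \<le> (l2norm M f)\<^sup>2" by simp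
    then show ?thesis using False by (simp add: field_simps)
  qed
  then have "I\<^sup>2 \<le> (l2norm M f * l2norm M g)\<^sup>2" by (simp add: power_mult_distrib)
  then show ?thesis unfolding I_def[symmetric]
    by (rule power2_le_imp_le[of "\<bar>I\<bar>", simplified]) (simp add: l2norm_nonneg)
qed

lemma l2norm_triangle:
  assumes "f \<in> l2 M" "g \<in> l2 M"
  shows "l2norm M (\<lambda>x. f x + g x) \<le> l2norm M f + l2norm M g"
proof (rule power2_le_imp_le)
  show "(l2norm M (\<lambda>x. f x + g x))\<^sup>2 \<le> (l2norm M f + l2norm M g)\<^sup>2"
    using l2_Cauchy_Schwarz[OF assms] by (simp add: l2norm_add_power2[OF assms] power2_sum)
qed (simp add: l2norm_nonneg)

lemma l2norm_minus_commute: "l2norm M (\<lambda>x. f x - g x) = l2norm M (\<lambda>x. g x - f x)"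
  by (simp add: l2norm_def norm_minus_commute)

lemma l2norm_triangle_diff:
  assumes "f \<in> l2 M" "g \<in> l2 M" "h \<in> l2 M"
  shows "l2norm M (\<lambda>x. f x - h x) \<le> l2norm M (\<lambda>x. f x - g x) + l2norm M (\<lambda>x. g x - h x)"
  using l2norm_triangle[OF l2_diff[OF assms(1,2)] l2_diff[OF assms(2,3)]] by simp

lemma l2norm_triangle_abs:
  assumes "f \<in> l2 M" "g \<in> l2 M"
  shows "\<bar>l2norm M f - l2norm M g\<bar> \<le> l2norm M (\<lambda>x. f x - g x)"
  using l2norm_triangle[OF l2_diff[OF assms] assms(2)]
    l2norm_triangle[OF l2_diff[OF assms(2,1)] assms(1)] l2norm_minus_commute[of M f g] by simp

lemma l2norm_cong_AE:
  assumes "f \<in> borel_measurable M" "g \<in> borel_measurable M" "AE x in M. f x = g x"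
  shows "l2norm M f = l2norm M g"
proof -
  have "(LINT x|M. (norm (f x))\<^sup>2) = (LINT x|M. (norm (g x))\<^sup>2)"
    using assms by (intro integral_cong_AE) auto
  then show ?thesis by (simp add: l2norm_def)
qed

lemma l2_cong_AE:
  assumes "f \<in> l2 M" "g \<in> borel_measurable M" "AE x in M. f x = g x"
  shows "g \<in> l2 M"
proof -
  have "integrable M (\<lambda>x. (norm (g x))\<^sup>2)"
    by (rule integrable_cong_AE_imp[OF l2_integrable[OF assms(1)]]) (use assms in auto)
  then show ?thesis using assms by (simp add: l2_def)
qed

lemma l2_tendsto_imp_l2norm_tendsto:
  assumes "\<And>n. f n \<in> l2 M" "g \<in> l2 M" "(\<lambda>n. l2norm M (\<lambda>x. f n x - g x)) \<longlonglongrightarrow> 0"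
  shows "(\<lambda>n. l2norm M (f n)) \<longlonglongrightarrow> l2norm M g"
proof -
  have "(\<lambda>n. l2norm M (f n) - l2norm M g) \<longlonglongrightarrow> 0"
    by (rule Lim_null_comparison[OF _ assms(3)])
       (use l2norm_triangle_abs[OF assms(1,2)] in auto)
  then show ?thesis by (simp add: LIM_zero_iff)
qed

lemma l2_const: "finite_measure M \<Longrightarrow> (\<lambda>x. c) \<in> l2 M"
  by (auto simp: l2_def finite_measure.integrable_const)

lemma l2_imp_integrable:
  assumes "finite_measure M" "f \<in> l2 M"
  shows "integrable M f"
proof (rule Bochner_Integration.integrable_bound)
  show "integrable M (\<lambda>x. 1 + (norm (f x))\<^sup>2)"
    using assms by (auto simp: l2_def finite_measure.integrable_const)
  have "norm (f x) \<le> 1 + (norm (f x))\<^sup>2" for x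
    using sum_squares_bound[of "norm (f x)" 1] norm_ge_zero[of "f x"] unfolding power_one by linarith
  then show "AE x in M. norm (f x) \<le> norm (1 + (norm (f x))\<^sup>2)" by auto
qed (use assms in \<open>auto simp: l2_def\<close>)

lemma l2_l1_bound:
  assumes "finite_measure M" "f \<in> l2 M"
  shows "(LINT x|M. norm (f x)) \<le> sqrt (measure M (space M)) * l2norm M f"
proof -
  have "(\<lambda>x. norm (f x)) \<in> l2 M" using assms by (auto simp: l2_def)
  from l2_Cauchy_Schwarz[OF l2_const[OF assms(1), of 1] this]
  have "\<bar>LINT x|M. norm (f x)\<bar> \<le> l2norm M (\<lambda>x. 1::real) * l2norm M (\<lambda>x. norm (f x))" by simp
  then show ?thesis by (simp add: l2norm_def)
qed

text \<open>Fatou's lemma with integrability of the limit as part of the conclusion. It serves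
  twice: for the completeness of L^2 and for the L^p term of the energy, where the bound holds only
  eventually.\<close>

lemma Fatou_bound:
  fixes u :: "nat \<Rightarrow> 'a \<Rightarrow> real"
  assumes "\<And>k. integrable M (u k)" "\<And>k x. 0 \<le> u k x" "v \<in> borel_measurable M" "\<And>x. 0 \<le> v x"
    and "AE x in M. (\<lambda>k. u k x) \<longlonglongrightarrow> v x" "\<forall>\<^sub>F k in sequentially. (LINT x|M. u k x) \<le> C"
  shows "integrable M v" "(LINT x|M. v x) \<le> C"
proof -
  \<comment> \<open>\<open>ennreal\<close> sends negative reals to 0, so \<open>C\<close> must be
    known to be nonnegative before the final bound can be read back in the reals.\<close>
  obtain k0 where "(LINT x|M. u k0 x) \<le> C" using assms(6) by (auto simp: eventually_sequentially)
  then have C: "0 \<le> C" using order_trans[OF Bochner_Integration.integral_nonneg[of M "u k0"]] assms(2) by blast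
  have "(\<integral>\<^sup>+x. ennreal (v x) \<partial>M) = (\<integral>\<^sup>+x. liminf (\<lambda>k. ennreal (u k x)) \<partial>M)"
  proof (rule nn_integral_cong_AE)
    show "AE x in M. ennreal (v x) = liminf (\<lambda>k. ennreal (u k x))"
      using assms(5)
    proof eventually_elim
      case (elim x)
      then have "(\<lambda>k. ennreal (u k x)) \<longlonglongrightarrow> ennreal (v x)" by (rule tendsto_ennrealI)
      then show ?case by (rule lim_imp_Liminf[OF sequentially_bot, symmetric])
    qed
  qed
  also have "\<dots> \<le> liminf (\<lambda>k. \<integral>\<^sup>+x. ennreal (u k x) \<partial>M)"
    using assms(1) by (intro nn_integral_liminf) auto
  also have "\<dots> = liminf (\<lambda>k. ennreal (LINT x|M. u k x))"
    using assms(1,2) by (simp add: nn_integral_eq_integral)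
  also have "\<dots> \<le> limsup (\<lambda>k. ennreal (LINT x|M. u k x))" by (simp add: Liminf_le_Limsup)
  also have "\<dots> \<le> ennreal C"
    by (rule Limsup_bounded) (use assms(6) in \<open>eventually_elim, auto intro: ennreal_leI\<close>)
  finally have le: "(\<integral>\<^sup>+x. ennreal (v x) \<partial>M) \<le> ennreal C" .
  show i: "integrable M v"
    using le assms(3,4) by (intro integrableI_nonneg) (auto simp: order_le_less_trans)
  show "(LINT x|M. v x) \<le> C"
    using le i assms(4) C by (simp add: nn_integral_eq_integral)
qed

text \<open>On a finite measure space an L^2 Cauchy sequence is Cauchy in L^1, which yields an
  almost everywhere convergent subsequence; Fatou's lemma then recovers L^2 convergence of the whole
  sequence. The subsequence is exported because the L^p term needs pointwise convergence.\<close>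

proposition l2_complete:
  fixes f :: "nat \<Rightarrow> 'a \<Rightarrow> 'b::euclidean_space"
  assumes M: "finite_measure M" and f: "\<And>n. f n \<in> l2 M"
    and C: "\<And>e. e > 0 \<Longrightarrow> \<exists>K. \<forall>m\<ge>K. \<forall>n\<ge>K. l2norm M (\<lambda>x. f m x - f n x) < e"
  obtains g r where "g \<in> l2 M" "strict_mono (r::nat\<Rightarrow>nat)" "AE x in M. (\<lambda>i. f (r i) x) \<longlonglongrightarrow> g x"
    "(\<lambda>n. l2norm M (\<lambda>x. f n x - g x)) \<longlonglongrightarrow> 0"
proof -
  \<comment> \<open>The summand 1 keeps \<open>c\<close> positive even if the space has measure
    0.\<close>
  define c where "c = sqrt (measure M (space M)) + 1"
  have c: "c > 0" by (simp add: c_def add_nonneg_pos)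
  have L1: "\<exists>K. \<forall>m\<ge>K. \<forall>n\<ge>K. (LINT x|M. norm (f m x - f n x)) < e" if e: "e > 0" for e
  proof -
    obtain K where K: "\<And>m n. m \<ge> K \<Longrightarrow> n \<ge> K \<Longrightarrow> l2norm M (\<lambda>x. f m x - f n x) < e / c"
      using C[of "e / c"] e c by auto
    have "(LINT x|M. norm (f m x - f n x)) < e" if "m \<ge> K" "n \<ge> K" for m n
    proof -
      have "(LINT x|M. norm (f m x - f n x)) \<le> sqrt (measure M (space M)) * l2norm M (\<lambda>x. f m x - f n x)"
        by (rule l2_l1_bound[OF M l2_diff[OF f f]])
      also have "\<dots> \<le> c * l2norm M (\<lambda>x. f m x - f n x)"
        by (intro mult_right_mono) (auto simp: c_def l2norm_nonneg)
      also have "\<dots> < e" using K[OF that] c by (simp add: field_simps)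
      finally show ?thesis .
    qed
    then show ?thesis by blast
  qed
  obtain r where r: "strict_mono r" "AE x in M. Cauchy (\<lambda>i. f (r i) x)"
    using cauchy_L1_AE_cauchy_subseq[of M f] l2_imp_integrable[OF M f] L1 by blast
  define g where "g x = lim (\<lambda>i. f (r i) x)" for x
  have meas: "\<And>n. f n \<in> borel_measurable M" using f by (auto simp: l2_def)
  then have gm [measurable]: "g \<in> borel_measurable M"
    unfolding g_def by (intro borel_measurable_lim_metric) auto
  have conv: "AE x in M. (\<lambda>i. f (r i) x) \<longlonglongrightarrow> g x"
    using r(2) by eventually_elim (simp add: g_def Cauchy_convergent_iff convergent_LIMSEQ_iff)
  \<comment> \<open>With \<open>n\<close> fixed, Fatou's lemma is applied to
    \<open>f n - f (r k)\<close> as \<open>k\<close> grows.\<close>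
  have key: "(\<lambda>x. f n x - g x) \<in> l2 M \<and> l2norm M (\<lambda>x. f n x - g x) \<le> e"
    if e: "e > 0" and K: "\<And>m n. m \<ge> K \<Longrightarrow> n \<ge> K \<Longrightarrow> l2norm M (\<lambda>x. f m x - f n x) < e" and n: "n \<ge> K" for e K n
  proof -
    have 1: "AE x in M. (\<lambda>k. (norm (f n x - f (r k) x))\<^sup>2) \<longlonglongrightarrow> (norm (f n x - g x))\<^sup>2"
      using conv by eventually_elim (intro tendsto_intros)
    have 2: "\<forall>\<^sub>F k in sequentially. (LINT x|M. (norm (f n x - f (r k) x))\<^sup>2) \<le> e\<^sup>2"
      unfolding eventually_sequentially
    proof (intro exI[of _ K] allI impI)
      fix k assume "K \<le> k"
      then have "K \<le> r k" using seq_suble[OF r(1), of k] by simp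
      from K[OF n this] show "(LINT x|M. (norm (f n x - f (r k) x))\<^sup>2) \<le> e\<^sup>2"
        unfolding l2norm_power2[symmetric] by (intro power_mono) (auto simp: l2norm_nonneg)
    qed
    note F = Fatou_bound[OF _ _ _ _ 1 2]
    have "integrable M (\<lambda>x. (norm (f n x - g x))\<^sup>2)" "(LINT x|M. (norm (f n x - g x))\<^sup>2) \<le> e\<^sup>2"
      using l2_integrable[OF l2_diff[OF f f]] meas by (intro F; simp)+
    then show ?thesis using meas e
      by (auto simp: l2_def l2norm_def intro!: real_le_lsqrt)
  qed
  have tends: "(\<lambda>n. l2norm M (\<lambda>x. f n x - g x)) \<longlonglongrightarrow> 0"
  proof (rule LIMSEQ_I)
    fix e :: real assume "e > 0"
    then obtain K where "\<And>m n. m \<ge> K \<Longrightarrow> n \<ge> K \<Longrightarrow> l2norm M (\<lambda>x. f m x - f n x) < e / 2"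
      using C[of "e / 2"] by auto
    with key[of "e / 2" K] \<open>e > 0\<close>
    show "\<exists>no. \<forall>n\<ge>no. norm (l2norm M (\<lambda>x. f n x - g x) - 0) < e"
      by (intro exI[of _ K]) (force simp: l2norm_nonneg)
  qed
  obtain K where "\<And>m n. m \<ge> K \<Longrightarrow> n \<ge> K \<Longrightarrow> l2norm M (\<lambda>x. f m x - f n x) < 1"
    using C[of 1] by auto
  then have "(\<lambda>x. f K x - g x) \<in> l2 M" using key[of 1 K K] by auto
  then have "g \<in> l2 M" using l2_diff[OF f[of K]] by fastforce
  then show ?thesis using that r(1) conv tends by blast
qed

section \<open>Weak gradients\<close>

lemma onorm_inner: "onorm (\<lambda>h. h \<bullet> (D::'a::euclidean_space)) \<le> norm D"
  by (rule onorm_le) (metis Cauchy_Schwarz_ineq2 mult.commute real_norm_def)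

lemma GDERIV_bound:
  fixes f :: "'a::euclidean_space \<Rightarrow> real"
  assumes "\<And>x. GDERIV f x :> Df x" "\<And>x. norm (Df x) \<le> B"
  shows "\<bar>f x - f y\<bar> \<le> B * norm (x - y)"
proof -
  have "norm (f x - f y) \<le> B * norm (x - y)"
  proof (rule differentiable_bound[of UNIV f "\<lambda>x h. h \<bullet> Df x" B x y])
    show "(f has_derivative (\<lambda>h. h \<bullet> Df x)) (at x)" for x
      using assms(1) by (simp add: gderiv_def)
    show "onorm (\<lambda>h. h \<bullet> Df x) \<le> B" for x
      by (rule order_trans[OF onorm_inner assms(2)])
  qed auto
  then show ?thesis by simp
qed

lemma GDERIV_line:
  assumes "GDERIV f (x + t *\<^sub>R v) :> D"
  shows "((\<lambda>t. f (x + t *\<^sub>R v)) has_real_derivative D \<bullet> v) (at t)"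
proof -
  have "((\<lambda>t. f (x + t *\<^sub>R v)) has_derivative (\<lambda>s. (s *\<^sub>R v) \<bullet> D)) (at t)"
    by (rule has_derivative_compose[of "\<lambda>t. x + t *\<^sub>R v" "\<lambda>s. s *\<^sub>R v" t UNIV f "\<lambda>h. h \<bullet> D"])
       (use assms in \<open>auto intro!: derivative_eq_intros simp: gderiv_def\<close>)
  then show ?thesis unfolding has_field_derivative_def
    by (simp add: inner_commute mult_commute_abs)
qed

lemma GDERIV_zero_outside_support:
  assumes "GDERIV f x :> D" "x \<notin> closure {x. f x \<noteq> 0}"
  shows "D = 0"
proof -
  have "open (- closure {x. f x \<noteq> 0})" by auto
  moreover have "f y = 0" if "y \<in> - closure {x. f x \<noteq> 0}" for y
    using that closure_subset[of "{x. f x \<noteq> 0}"] by blast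
  moreover have "GDERIV (\<lambda>x. 0) x :> 0" by (rule GDERIV_const)
  ultimately have "GDERIV f x :> 0"
    using assms(2) unfolding gderiv_def
    by (metis (no_types, lifting) ComplI has_derivative_transform_within_open)
  then show ?thesis using GDERIV_unique assms(1) by blast
qed

section \<open>Compactly supported functions on the whole space\<close>

lemma integrable_continuous_compact_support:
  fixes f :: "'a::euclidean_space \<Rightarrow> 'b::euclidean_space"
  assumes "continuous_on UNIV f" "compact K" "\<And>x. x \<notin> K \<Longrightarrow> f x = 0"
  shows "integrable lborel f"
proof -
  have "integrable lborel (\<lambda>x. indicator K x *\<^sub>R f x)"
    by (rule borel_integrable_compact[OF assms(2) continuous_on_subset[OF assms(1)]]) simp
  moreover have "(\<lambda>x. indicator K x *\<^sub>R f x) = f"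
    using assms(3) by (auto simp: indicator_def)
  ultimately show ?thesis by simp
qed

lemma bounded_continuous_compact_support:
  fixes f :: "'a::euclidean_space \<Rightarrow> 'b::euclidean_space"
  assumes "continuous_on UNIV f" "compact K" "\<And>x. x \<notin> K \<Longrightarrow> f x = 0"
  obtains B where "B > 0" "\<And>x. norm (f x) \<le> B"
proof -
  have "compact (f ` K)" using assms by (intro compact_continuous_image continuous_on_subset[OF assms(1)]) auto
  then obtain B where B: "B > 0" "\<And>x. x \<in> K \<Longrightarrow> norm (f x) \<le> B"
    using compact_imp_bounded bounded_pos by (metis imageI)
  then have "norm (f x) \<le> B" for x using assms(3)[of x] by (cases "x \<in> K") auto
  with B show ?thesis using that by blast
qed

lemma lborel_integral_translate:
  fixes f :: "'a::euclidean_space \<Rightarrow> 'b::euclidean_space"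
  assumes [measurable]: "f \<in> borel_measurable borel"
  shows "(LINT x|lborel. f (x + c)) = (LINT x|lborel. f x)"
    "integrable lborel (\<lambda>x. f (x + c)) \<longleftrightarrow> integrable lborel f"
proof -
  have "(LINT x|distr lborel borel ((+) c). f x) = (LINT x|lborel. f (c + x))"
    by (rule integral_distr) auto
  then show "(LINT x|lborel. f (x + c)) = (LINT x|lborel. f x)"
    by (simp add: lborel_distr_plus add.commute)
  have "integrable (distr lborel borel ((+) c)) f \<longleftrightarrow> integrable lborel (\<lambda>x. f (c + x))"
    by (rule integrable_distr_eq) auto
  then show "integrable lborel (\<lambda>x. f (x + c)) \<longleftrightarrow> integrable lborel f"
    by (simp add: lborel_distr_plus add.commute)
qed

text \<open>The difference quotients have integral \<open>0\<close> by translation invariance.\<close>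

lemma integral_directional_derivative_zero:
  fixes f :: "'a::euclidean_space \<Rightarrow> real"
  assumes K: "compact K" "\<And>x. x \<notin> K \<Longrightarrow> f x = 0"
    and D: "\<And>x. GDERIV f x :> Df x" "continuous_on UNIV Df" "\<And>x. x \<notin> K \<Longrightarrow> Df x = 0"
    and v: "norm v \<le> 1"
  shows "(LINT x|lborel. Df x \<bullet> v) = 0"
proof -
  define q where "q n x = (f (x + (1 / real (Suc n)) *\<^sub>R v) - f x) / (1 / real (Suc n))" for n x
  obtain B where B: "B > 0" "\<And>x. norm (Df x) \<le> B"
    using bounded_continuous_compact_support[OF D(2) K(1) D(3)] by blast
  obtain R where R: "\<And>x. x \<in> K \<Longrightarrow> norm x \<le> R"
    using compact_imp_bounded[OF K(1)] bounded_iff by blast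
  have cf: "continuous_on UNIV f"
    using D(1) unfolding gderiv_def continuous_on_eq_continuous_at[OF open_UNIV]
    using has_derivative_continuous by blast
  then have [measurable]: "f \<in> borel_measurable borel" "Df \<in> borel_measurable borel"
    using D(2) borel_measurable_continuous_onI by auto
  have fi: "integrable lborel f" by (rule integrable_continuous_compact_support[OF cf K])
  have "(LINT x|lborel. q n x) = 0" for n
    using fi by (simp add: q_def lborel_integral_translate del: of_nat_Suc)
  moreover have "(\<lambda>n. LINT x|lborel. q n x) \<longlonglongrightarrow> (LINT x|lborel. Df x \<bullet> v)"
  proof (rule integral_dominated_convergence)
    \<comment> \<open>One dominating function serves all \<open>n\<close>: the shifts have length at
      most 1, so for \<open>x\<close> outside radius \<open>R + 1\<close> both points miss
      \<open>K\<close>, and inside the mean value estimate gives \<open>B\<close>.\<close>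
    show "integrable lborel (\<lambda>x. indicator (cball 0 (R + 1)) x *\<^sub>R B)"
      by (rule borel_integrable_compact) auto
    show "AE x in lborel. (\<lambda>n. q n x) \<longlonglongrightarrow> Df x \<bullet> v"
    proof (rule AE_I2)
      fix x
      have "((\<lambda>t. f (x + t *\<^sub>R v)) has_real_derivative Df x \<bullet> v) (at 0)"
        by (rule GDERIV_line) (simp add: D(1))
      then have "((\<lambda>t. (f (x + t *\<^sub>R v) - f x) / t) \<longlongrightarrow> Df x \<bullet> v) (at 0)"
        by (simp add: DERIV_def)
      moreover have "filterlim (\<lambda>n. 1 / real (Suc n)) (at 0) sequentially"
        unfolding filterlim_at by (auto intro!: LIMSEQ_Suc[OF lim_1_over_n] simp del: of_nat_Suc)
      ultimately show "(\<lambda>n. q n x) \<longlonglongrightarrow> Df x \<bullet> v"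
        unfolding q_def by (rule filterlim_compose)
    qed
    show "AE x in lborel. norm (q n x) \<le> indicator (cball 0 (R + 1)) x *\<^sub>R B" for n
    proof (rule AE_I2)
      fix x
      let ?h = "1 / real (Suc n)"
      have hv: "norm (?h *\<^sub>R v) \<le> ?h" using v by (simp add: divide_right_mono)
      show "norm (q n x) \<le> indicator (cball 0 (R + 1)) x *\<^sub>R B"
      proof (cases "x \<in> cball 0 (R + 1)")
        case True
        have "\<bar>f (x + ?h *\<^sub>R v) - f x\<bar> \<le> B * norm (?h *\<^sub>R v)"
          using GDERIV_bound[of f Df B "x + ?h *\<^sub>R v" x] D(1) B(2) by simp
        also have "\<dots> \<le> B * ?h" using B(1) hv by (intro mult_left_mono) auto
        finally have "norm (q n x) \<le> B"
          unfolding q_def real_norm_def abs_divide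
          by (subst pos_divide_le_eq) (auto simp del: of_nat_Suc)
        with True show ?thesis by simp
      next
        case False
        have "?h \<le> 1" by simp
        then have "norm (?h *\<^sub>R v) \<le> 1" using hv by linarith
        moreover have "norm x \<le> norm (x + ?h *\<^sub>R v) + norm (?h *\<^sub>R v)"
          by (metis add_diff_cancel norm_triangle_ineq4)
        moreover have "norm x > R + 1" using False by (simp add: dist_norm)
        ultimately have "\<not> norm x \<le> R" "\<not> norm (x + ?h *\<^sub>R v) \<le> R" by linarith+
        then have "x \<notin> K" "x + ?h *\<^sub>R v \<notin> K" using R by blast+
        then show ?thesis using False by (simp add: q_def K(2) del: of_nat_Suc)
      qed
    qed
  qed (auto simp: q_def)
  ultimately show ?thesis by (simp add: LIMSEQ_const_iff)
qed

lemma l2_scaleR_integrable: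
  assumes "f \<in> l2 M" "g \<in> l2 M"
  shows "integrable M (\<lambda>x. f x *\<^sub>R g x)"
proof (rule Bochner_Integration.integrable_bound)
  have "(\<lambda>x. \<bar>f x\<bar>) \<in> l2 M" "(\<lambda>x. norm (g x)) \<in> l2 M" using assms by (auto simp: l2_def)
  then show "integrable M (\<lambda>x. \<bar>f x\<bar> \<bullet> norm (g x))" by (rule l2_inner_integrable)
qed (use assms in \<open>auto simp: l2_def\<close>)

lemma l2_tendsto_inner:
  assumes "\<And>n. f n \<in> l2 M" "g \<in> l2 M" "h \<in> l2 M" "(\<lambda>n. l2norm M (\<lambda>x. f n x - g x)) \<longlonglongrightarrow> 0"
  shows "(\<lambda>n. LINT x|M. f n x \<bullet> h x) \<longlonglongrightarrow> (LINT x|M. g x \<bullet> h x)"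
proof -
  have "(\<lambda>n. l2norm M (\<lambda>x. f n x - g x) * l2norm M h) \<longlonglongrightarrow> 0 * l2norm M h"
    using assms(4) by (intro tendsto_mult) auto
  then have l: "(\<lambda>n. l2norm M (\<lambda>x. f n x - g x) * l2norm M h) \<longlonglongrightarrow> 0" by simp
  have "(\<lambda>n. (LINT x|M. f n x \<bullet> h x) - (LINT x|M. g x \<bullet> h x)) \<longlonglongrightarrow> 0"
  proof (rule Lim_null_comparison[OF _ l], intro always_eventually allI)
    fix n
    have "(LINT x|M. f n x \<bullet> h x) - (LINT x|M. g x \<bullet> h x) = (LINT x|M. (f n x - g x) \<bullet> h x)"
      using assms by (simp add: inner_diff_left l2_inner_integrable)
    then show "norm ((LINT x|M. f n x \<bullet> h x) - (LINT x|M. g x \<bullet> h x)) \<le> l2norm M (\<lambda>x. f n x - g x) * l2norm M h"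
      using l2_Cauchy_Schwarz[OF l2_diff[OF assms(1,2)] assms(3)] by simp
  qed
  then show ?thesis by (simp add: LIM_zero_iff)
qed

lemma Lp_2_eq_l2: "Lp 2 \<Omega> = l2 (lebesgue_on \<Omega>)"
  by (simp add: Lp_def l2_def)

lemma Lp_norm_2_eq_l2norm: "Lp_norm 2 \<Omega> f = l2norm (lebesgue_on \<Omega>) f"
  by (simp add: Lp_norm_def l2norm_def powr_half_sqrt)

section \<open>Test functions and their gradients on a bounded open set\<close>

locale bounded_open =
  fixes \<Omega> :: "'a::euclidean_space set"
  assumes op: "open \<Omega>" and bd: "bounded \<Omega>"
begin

abbreviation "M \<equiv> lebesgue_on \<Omega>"

lemma sets_\<Omega> [simp]: "\<Omega> \<in> sets lebesgue"
  using op by (simp add: lmeasurable_open fmeasurableD bd)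

lemma finite_M: "finite_measure M"
  using op bd by (intro finite_measure_lebesgue_on lmeasurable_open)

lemma borel_measurable_M:
  assumes "f \<in> borel_measurable borel"
  shows "f \<in> borel_measurable M"
  using assms by (auto intro!: measurable_restrict_space1 measurable_completion)

text \<open>Translation arguments live on \<open>lborel\<close>, the function spaces on
  \<open>lebesgue_on \<Omega>\<close>. For Borel functions vanishing off \<open>\<Omega>\<close> the
  two settings agree, so estimates move freely between them.\<close>

lemma integral_M_eq_lborel:
  fixes f :: "'a \<Rightarrow> 'b::euclidean_space"
  assumes "f \<in> borel_measurable borel" "\<And>x. x \<notin> \<Omega> \<Longrightarrow> f x = 0"
  shows "(LINT x|M. f x) = (LINT x|lborel. f x)" "integrable M f \<longleftrightarrow> integrable lborel f"
proof -
  have e: "(\<lambda>x. indicator \<Omega> x *\<^sub>R f x) = f" using assms(2) by (auto simp: indicator_def)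
  show "(LINT x|M. f x) = (LINT x|lborel. f x)"
    using assms(1) by (subst integral_restrict_space) (auto simp: e integral_completion)
  show "integrable M f \<longleftrightarrow> integrable lborel f"
    using assms(1) by (subst integrable_restrict_space) (auto simp: e integrable_completion)
qed

lemma l2_M_eq_lborel:
  fixes f :: "'a \<Rightarrow> 'b::euclidean_space"
  assumes [measurable]: "f \<in> borel_measurable borel" and "\<And>x. x \<notin> \<Omega> \<Longrightarrow> f x = 0"
  shows "f \<in> l2 M \<longleftrightarrow> f \<in> l2 lborel" "l2norm M f = l2norm lborel f"
proof -
  have "(\<lambda>x. (norm (f x))\<^sup>2) \<in> borel_measurable borel" "\<And>x. x \<notin> \<Omega> \<Longrightarrow> (norm (f x))\<^sup>2 = 0"
    using assms by auto
  from integral_M_eq_lborel[OF this] show "f \<in> l2 M \<longleftrightarrow> f \<in> l2 lborel" "l2norm M f = l2norm lborel f"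
    using borel_measurable_M[OF assms(1)] by (auto simp: l2_def l2norm_def)
qed

text \<open>The classical gradient is carried as data, so that linear combinations and limits can be
  taken for function and gradient together, in the graph of the gradient.\<close>

definition test_pair :: "('a \<Rightarrow> real) \<Rightarrow> ('a \<Rightarrow> 'a) \<Rightarrow> bool" where
  "test_pair \<phi> D \<longleftrightarrow> \<phi> \<in> test_functions \<Omega> \<and> (\<forall>x. GDERIV \<phi> x :> D x)"

lemma test_pairD:
  assumes "test_pair \<phi> D"
  obtains K where "compact K" "K \<subseteq> \<Omega>" "\<And>x. x \<notin> K \<Longrightarrow> \<phi> x = 0" "\<And>x. x \<notin> K \<Longrightarrow> D x = 0"
    "continuous_on UNIV \<phi>" "continuous_on UNIV D"
proof
  let ?K = "closure {x. \<phi> x \<noteq> 0}"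
  have \<phi>: "smooth \<phi>" "compact ?K" "?K \<subseteq> \<Omega>" "\<And>x. GDERIV \<phi> x :> D x"
    using assms by (auto simp: test_pair_def test_functions_def)
  then show "compact ?K" "?K \<subseteq> \<Omega>" "continuous_on UNIV \<phi>" "continuous_on UNIV D"
    using smooth_continuous smooth_gradient_continuous[OF \<phi>(1,4)] by auto
  show "\<phi> x = 0" if "x \<notin> ?K" for x using that closure_subset[of "{x. \<phi> x \<noteq> 0}"] by blast
  show "D x = 0" if "x \<notin> ?K" for x using GDERIV_zero_outside_support \<phi>(4) that by blast
qed

lemma test_pair_exists: "\<phi> \<in> test_functions \<Omega> \<Longrightarrow> \<exists>D. test_pair \<phi> D"
  unfolding test_pair_def test_functions_def using smooth_gradient by blast

lemma test_pair_add:
  "test_pair \<phi> D \<Longrightarrow> test_pair \<psi> E \<Longrightarrow> test_pair (\<lambda>x. \<phi> x + \<psi> x) (\<lambda>x. D x + E x)"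
  by (auto simp: test_pair_def test_functions_add intro!: GDERIV_add)

lemma test_pair_cmult:
  assumes "test_pair \<phi> D"
  shows "test_pair (\<lambda>x. c * \<phi> x) (\<lambda>x. c *\<^sub>R D x)"
  using assms GDERIV_mult[OF GDERIV_const, of \<phi> _ _ c]
  by (auto simp: test_pair_def test_functions_cmult)

lemma l2_continuous_compact_support:
  fixes f :: "'a \<Rightarrow> 'b::euclidean_space"
  assumes "continuous_on UNIV f" "compact K" "K \<subseteq> \<Omega>" "\<And>x. x \<notin> K \<Longrightarrow> f x = 0"
  shows "f \<in> l2 lborel" "f \<in> l2 M" "l2norm M f = l2norm lborel f"
proof -
  have m: "f \<in> borel_measurable borel" by (rule borel_measurable_continuous_onI[OF assms(1)])
  have "integrable lborel (\<lambda>x. (norm (f x))\<^sup>2)"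
    by (rule integrable_continuous_compact_support[OF _ assms(2)])
       (use assms in \<open>auto intro!: continuous_intros\<close>)
  with m show l: "f \<in> l2 lborel" by (simp add: l2_def)
  show "f \<in> l2 M" "l2norm M f = l2norm lborel f"
    using l2_M_eq_lborel[OF m] assms(3,4) l by blast+
qed

lemma test_pair_l2:
  assumes "test_pair \<phi> D"
  shows "\<phi> \<in> l2 lborel" "\<phi> \<in> l2 M" "l2norm M \<phi> = l2norm lborel \<phi>"
    "D \<in> l2 lborel" "D \<in> l2 M" "l2norm M D = l2norm lborel D"
proof -
  obtain K where K: "compact K" "K \<subseteq> \<Omega>" "\<And>x. x \<notin> K \<Longrightarrow> \<phi> x = 0" "\<And>x. x \<notin> K \<Longrightarrow> D x = 0"
    "continuous_on UNIV \<phi>" "continuous_on UNIV D" using test_pairD[OF assms] by blast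
  show "\<phi> \<in> l2 lborel" "\<phi> \<in> l2 M" "l2norm M \<phi> = l2norm lborel \<phi>"
    "D \<in> l2 lborel" "D \<in> l2 M" "l2norm M D = l2norm lborel D"
    using l2_continuous_compact_support K by blast+
qed

text \<open>The product of \<open>\<phi>\<close> and \<open>\<psi>\<close> has compact support, so
  its directional derivative integrates to 0, and the product rule splits that integral. Unit basis
  vectors are the directions wanted later, which fits \<open>norm v \<le> 1\<close>.\<close>

lemma integration_by_parts:
  assumes "test_pair \<phi> D" "test_pair \<psi> E" "norm v \<le> 1"
  shows "(LINT x|M. \<phi> x * (E x \<bullet> v)) = - (LINT x|M. \<psi> x * (D x \<bullet> v))"
proof -
  obtain K where K: "compact K" "K \<subseteq> \<Omega>" "\<And>x. x \<notin> K \<Longrightarrow> \<phi> x = 0" "\<And>x. x \<notin> K \<Longrightarrow> D x = 0"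
    "continuous_on UNIV \<phi>" "continuous_on UNIV D" using test_pairD[OF assms(1)] by blast
  obtain L where L: "continuous_on UNIV \<psi>" "continuous_on UNIV E" using test_pairD[OF assms(2)] by blast
  have z: "\<phi> x = 0" "D x = 0" if "x \<notin> \<Omega>" for x using K(2-4) that by auto
  have "(LINT x|lborel. (\<phi> x *\<^sub>R E x + \<psi> x *\<^sub>R D x) \<bullet> v) = 0"
  proof (rule integral_directional_derivative_zero[OF K(1)])
    show "GDERIV (\<lambda>x. \<phi> x * \<psi> x) x :> \<phi> x *\<^sub>R E x + \<psi> x *\<^sub>R D x" for x
      using assms by (auto simp: test_pair_def intro: GDERIV_mult)
  qed (use K L assms(3) in \<open>auto intro!: continuous_intros\<close>)
  moreover have "integrable lborel (\<lambda>x. \<phi> x * (E x \<bullet> v))" "integrable lborel (\<lambda>x. \<psi> x * (D x \<bullet> v))"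
    by (rule integrable_continuous_compact_support[OF _ K(1)]; use K L in \<open>auto intro!: continuous_intros\<close>)+
  ultimately have "(LINT x|lborel. \<phi> x * (E x \<bullet> v)) = - (LINT x|lborel. \<psi> x * (D x \<bullet> v))"
    by (simp add: inner_add_left)
  moreover have "(LINT x|M. \<phi> x * (E x \<bullet> v)) = (LINT x|lborel. \<phi> x * (E x \<bullet> v))"
    "(LINT x|M. \<psi> x * (D x \<bullet> v)) = (LINT x|lborel. \<psi> x * (D x \<bullet> v))"
    by (rule integral_M_eq_lborel(1);
        use K L z in \<open>auto intro!: borel_measurable_continuous_onI continuous_intros\<close>)+
  ultimately show ?thesis by simp
qed

text \<open>
  The \<open>L\<^sup>2\<close> closure of the graph of the gradient on test functions. It replaces \<open>H01 \<Omega>\<close> and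
  \<open>weak_gradient \<Omega>\<close>, and is linear and closed without appeal to uniqueness of weak gradients.
\<close>

definition grad0 :: "('a \<Rightarrow> real) \<Rightarrow> ('a \<Rightarrow> 'a) \<Rightarrow> bool" where
  "grad0 u G \<longleftrightarrow> u \<in> l2 M \<and> G \<in> l2 M \<and>
     (\<forall>e>0. \<exists>\<phi> D. test_pair \<phi> D \<and> l2norm M (\<lambda>x. u x - \<phi> x) < e \<and> l2norm M (\<lambda>x. G x - D x) < e)"

lemma grad0_l2: "grad0 u G \<Longrightarrow> u \<in> l2 M" "grad0 u G \<Longrightarrow> G \<in> l2 M"
  by (auto simp: grad0_def)

lemma grad0_sequence:
  assumes "grad0 u G"
  obtains \<phi> D where "\<And>n. test_pair (\<phi> n) (D n)"
    "(\<lambda>n. l2norm M (\<lambda>x. \<phi> n x - u x)) \<longlonglongrightarrow> 0" "(\<lambda>n. l2norm M (\<lambda>x. D n x - G x)) \<longlonglongrightarrow> 0"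
proof -
  have "\<exists>p. test_pair (fst p) (snd p) \<and> l2norm M (\<lambda>x. u x - fst p x) < 1 / real (Suc n)
      \<and> l2norm M (\<lambda>x. G x - snd p x) < 1 / real (Suc n)" for n
    using assms unfolding grad0_def by (simp del: of_nat_Suc)
  then have "\<forall>n. \<exists>p. test_pair (fst p) (snd p) \<and> l2norm M (\<lambda>x. u x - fst p x) < 1 / real (Suc n)
      \<and> l2norm M (\<lambda>x. G x - snd p x) < 1 / real (Suc n)" by blast
  from choice[OF this] obtain p where p: "\<And>n. test_pair (fst (p n)) (snd (p n))"
    "\<And>n. l2norm M (\<lambda>x. u x - fst (p n) x) < 1 / real (Suc n)"
    "\<And>n. l2norm M (\<lambda>x. G x - snd (p n) x) < 1 / real (Suc n)" by blast
  have l: "(\<lambda>n. 1 / real (Suc n)) \<longlonglongrightarrow> 0" by (rule LIMSEQ_Suc[OF lim_1_over_n])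
  show ?thesis
  proof (rule that[of "\<lambda>n. fst (p n)" "\<lambda>n. snd (p n)"])
    show "(\<lambda>n. l2norm M (\<lambda>x. fst (p n) x - u x)) \<longlonglongrightarrow> 0"
      by (rule Lim_null_comparison[OF _ l])
         (use p(2)[THEN less_imp_le] in \<open>auto intro!: always_eventually simp: l2norm_nonneg l2norm_minus_commute[of _ "fst (p _)"] simp del: of_nat_Suc\<close>)
    show "(\<lambda>n. l2norm M (\<lambda>x. snd (p n) x - G x)) \<longlonglongrightarrow> 0"
      by (rule Lim_null_comparison[OF _ l])
         (use p(3)[THEN less_imp_le] in \<open>auto intro!: always_eventually simp: l2norm_nonneg l2norm_minus_commute[of _ "snd (p _)"] simp del: of_nat_Suc\<close>)
  qed (rule p(1))
qed

lemma grad0_test: "test_pair \<phi> D \<Longrightarrow> grad0 \<phi> D"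
  unfolding grad0_def using test_pair_l2[of \<phi> D]
  by (auto intro!: exI[of _ \<phi>] exI[of _ D] simp: l2norm_def)

lemma grad0_add:
  assumes "grad0 u G" "grad0 v H"
  shows "grad0 (\<lambda>x. u x + v x) (\<lambda>x. G x + H x)"
  unfolding grad0_def
proof (intro conjI allI impI)
  note l = grad0_l2[OF assms(1)] grad0_l2[OF assms(2)]
  show "(\<lambda>x. u x + v x) \<in> l2 M" "(\<lambda>x. G x + H x) \<in> l2 M" using l by (auto intro: l2_add)
  fix e :: real assume "e > 0"
  then obtain \<phi> D \<psi> E where
    p: "test_pair \<phi> D" "l2norm M (\<lambda>x. u x - \<phi> x) < e / 2" "l2norm M (\<lambda>x. G x - D x) < e / 2"
    and q: "test_pair \<psi> E" "l2norm M (\<lambda>x. v x - \<psi> x) < e / 2" "l2norm M (\<lambda>x. H x - E x) < e / 2"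
    using assms unfolding grad0_def by (meson half_gt_zero)
  note lp = test_pair_l2[OF p(1)] and lq = test_pair_l2[OF q(1)]
  have "l2norm M (\<lambda>x. (u x - \<phi> x) + (v x - \<psi> x)) < e"
    using l2norm_triangle[OF l2_diff[OF l(1) lp(2)] l2_diff[OF l(3) lq(2)]] p q by linarith
  moreover have "l2norm M (\<lambda>x. (G x - D x) + (H x - E x)) < e"
    using l2norm_triangle[OF l2_diff[OF l(2) lp(5)] l2_diff[OF l(4) lq(5)]] p q by linarith
  ultimately show "\<exists>\<phi> D. test_pair \<phi> D \<and> l2norm M (\<lambda>x. u x + v x - \<phi> x) < e \<and> l2norm M (\<lambda>x. G x + H x - D x) < e"
    using test_pair_add[OF p(1) q(1)]
    by (intro exI[of _ "\<lambda>x. \<phi> x + \<psi> x"] exI[of _ "\<lambda>x. D x + E x"]) (simp add: add_diff_add)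
qed

lemma grad0_cmult:
  assumes "grad0 u G"
  shows "grad0 (\<lambda>x. c * u x) (\<lambda>x. c *\<^sub>R G x)"
  unfolding grad0_def
proof (intro conjI allI impI)
  note l = grad0_l2[OF assms]
  show "(\<lambda>x. c * u x) \<in> l2 M" "(\<lambda>x. c *\<^sub>R G x) \<in> l2 M" using l l2_scaleR[of u M c] l2_scaleR by auto
  fix e :: real assume e: "e > 0"
  then obtain \<phi> D where
    p: "test_pair \<phi> D" "l2norm M (\<lambda>x. u x - \<phi> x) < e / (\<bar>c\<bar> + 1)" "l2norm M (\<lambda>x. G x - D x) < e / (\<bar>c\<bar> + 1)"
    using assms unfolding grad0_def by (meson add_nonneg_pos abs_ge_zero zero_less_one divide_pos_pos)
  \<comment> \<open>The tolerance was divided by \<open>\<bar>c\<bar> + 1\<close> rather than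
    \<open>\<bar>c\<bar>\<close>, so that \<open>c = 0\<close> needs no separate case.\<close>
  have b: "\<bar>c\<bar> * t < e" if "0 \<le> t" "t < e / (\<bar>c\<bar> + 1)" for t
  proof -
    have "t * (\<bar>c\<bar> + 1) < e" using that(2) by (simp add: pos_less_divide_eq add_nonneg_pos)
    then show ?thesis using that(1) by (simp add: algebra_simps)
  qed
  have "l2norm M (\<lambda>x. c *\<^sub>R (u x - \<phi> x)) < e" "l2norm M (\<lambda>x. c *\<^sub>R (G x - D x)) < e"
    unfolding l2norm_scaleR using b p l2norm_nonneg by blast+
  then show "\<exists>\<phi> D. test_pair \<phi> D \<and> l2norm M (\<lambda>x. c * u x - \<phi> x) < e \<and> l2norm M (\<lambda>x. c *\<^sub>R G x - D x) < e"
    using test_pair_cmult[OF p(1), of c]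
    by (intro exI[of _ "\<lambda>x. c * \<phi> x"] exI[of _ "\<lambda>x. c *\<^sub>R D x"]) (simp add: algebra_simps)
qed

lemma grad0_closed:
  assumes "\<And>n. grad0 (u n) (G n)" "v \<in> l2 M" "H \<in> l2 M"
    "(\<lambda>n. l2norm M (\<lambda>x. u n x - v x)) \<longlonglongrightarrow> 0" "(\<lambda>n. l2norm M (\<lambda>x. G n x - H x)) \<longlonglongrightarrow> 0"
  shows "grad0 v H"
  unfolding grad0_def
proof (intro conjI allI impI)
  fix e :: real assume e: "e > 0"
  have "\<forall>\<^sub>F n in sequentially. l2norm M (\<lambda>x. u n x - v x) < e / 2 \<and> l2norm M (\<lambda>x. G n x - H x) < e / 2"
    using order_tendstoD(2)[OF assms(4), of "e / 2"] order_tendstoD(2)[OF assms(5), of "e / 2"] e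
    by (simp add: eventually_conj)
  then obtain n where "l2norm M (\<lambda>x. u n x - v x) < e / 2 \<and> l2norm M (\<lambda>x. G n x - H x) < e / 2"
    using eventually_happens'[OF sequentially_bot] by blast
  then have n: "l2norm M (\<lambda>x. v x - u n x) < e / 2" "l2norm M (\<lambda>x. H x - G n x) < e / 2"
    by (simp_all add: l2norm_minus_commute[of M v] l2norm_minus_commute[of M H])
  obtain \<phi> D where
    p: "test_pair \<phi> D" "l2norm M (\<lambda>x. u n x - \<phi> x) < e / 2" "l2norm M (\<lambda>x. G n x - D x) < e / 2"
    using assms(1)[of n] e unfolding grad0_def by (meson half_gt_zero)
  note l = grad0_l2[OF assms(1)] test_pair_l2[OF p(1)]
  have "l2norm M (\<lambda>x. v x - \<phi> x) < e" "l2norm M (\<lambda>x. H x - D x) < e"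
    using l2norm_triangle_diff[OF assms(2) l(1)[of n] l(4)] l2norm_triangle_diff[OF assms(3) l(2)[of n] l(7)] n p
    by linarith+
  with p show "\<exists>\<phi> D. test_pair \<phi> D \<and> l2norm M (\<lambda>x. v x - \<phi> x) < e \<and> l2norm M (\<lambda>x. H x - D x) < e" by blast
qed (use assms in auto)

lemma integrable_M_loc_integrable:
  assumes "integrable M f"
  shows "loc_integrable \<Omega> (f :: 'a \<Rightarrow> 'b::euclidean_space)"
  unfolding loc_integrable_def
proof (intro allI impI)
  fix K :: "'a set" assume K: "compact K \<and> K \<subseteq> \<Omega>"
  have "set_integrable lebesgue \<Omega> f"
    using assms by (simp add: set_integrable_def integrable_restrict_space)
  moreover have "K \<in> sets lebesgue" using K by (simp add: borel_compact)
  ultimately show "f absolutely_integrable_on K"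
    using K set_integrable_subset by blast
qed

text \<open>For test pairs the identity is integration by parts, and both sides are continuous along
  L^2 convergence when tested against fixed square integrable functions. The limit is taken
  componentwise, where only real integrals of inner products occur.\<close>

lemma grad0_has_weak_gradient:
  assumes "grad0 u G"
  shows "has_weak_gradient \<Omega> u G"
  unfolding has_weak_gradient_def
proof (intro conjI ballI allI impI)
  note l = grad0_l2[OF assms]
  show "loc_integrable \<Omega> u" "loc_integrable \<Omega> G"
    using l l2_imp_integrable[OF finite_M] integrable_M_loc_integrable by blast+
  fix \<psi> E assume "\<psi> \<in> test_functions \<Omega>" "\<forall>x. GDERIV \<psi> x :> E x"
  then have \<psi>: "test_pair \<psi> E" by (simp add: test_pair_def)
  note l\<psi> = test_pair_l2[OF \<psi>]
  obtain \<phi> D where \<phi>: "\<And>n. test_pair (\<phi> n) (D n)"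
    "(\<lambda>n. l2norm M (\<lambda>x. \<phi> n x - u x)) \<longlonglongrightarrow> 0" "(\<lambda>n. l2norm M (\<lambda>x. D n x - G x)) \<longlonglongrightarrow> 0"
    using grad0_sequence[OF assms] by blast
  note l\<phi> = test_pair_l2[OF \<phi>(1)]
  show "(LINT x|M. u x *\<^sub>R E x) = - (LINT x|M. \<psi> x *\<^sub>R G x)"
  proof (rule euclidean_eqI)
    fix b :: 'a assume b: "b \<in> Basis"
    have Eb: "(\<lambda>x. E x \<bullet> b) \<in> l2 M"
    proof -
      have "integrable M (\<lambda>x. (E x \<bullet> b)\<^sup>2)"
      proof (rule Bochner_Integration.integrable_bound[OF l2_integrable[OF l\<psi>(5)]])
        show "AE x in M. norm ((E x \<bullet> b)\<^sup>2) \<le> norm ((norm (E x))\<^sup>2)"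
          using Basis_le_norm[OF b] by (auto simp: abs_le_square_iff[symmetric])
      qed (use l\<psi>(5) in \<open>auto simp: l2_def\<close>)
      then show ?thesis using l\<psi>(5) by (auto simp: l2_def)
    qed
    have \<psi>b: "(\<lambda>x. \<psi> x *\<^sub>R b) \<in> l2 M"
      using l\<psi>(2) b by (auto simp: l2_def)
    have "(\<lambda>n. LINT x|M. \<phi> n x \<bullet> (E x \<bullet> b)) \<longlonglongrightarrow> (LINT x|M. u x \<bullet> (E x \<bullet> b))"
      by (rule l2_tendsto_inner[OF l\<phi>(2) l(1) Eb \<phi>(2)])
    moreover have "(\<lambda>n. - (LINT x|M. D n x \<bullet> (\<psi> x *\<^sub>R b))) \<longlonglongrightarrow> - (LINT x|M. G x \<bullet> (\<psi> x *\<^sub>R b))"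
      by (intro tendsto_minus l2_tendsto_inner[OF l\<phi>(5) l(2) \<psi>b \<phi>(3)])
    moreover have "(LINT x|M. \<phi> n x \<bullet> (E x \<bullet> b)) = - (LINT x|M. D n x \<bullet> (\<psi> x *\<^sub>R b))" for n
      using integration_by_parts[OF \<phi>(1)[of n] \<psi>, of b] b by simp
    ultimately have "(LINT x|M. u x \<bullet> (E x \<bullet> b)) = - (LINT x|M. G x \<bullet> (\<psi> x *\<^sub>R b))"
      using LIMSEQ_unique by simp
    moreover have "(LINT x|M. u x *\<^sub>R E x) \<bullet> b = (LINT x|M. (u x *\<^sub>R E x) \<bullet> b)"
      "(LINT x|M. \<psi> x *\<^sub>R G x) \<bullet> b = (LINT x|M. (\<psi> x *\<^sub>R G x) \<bullet> b)"
      by (rule integral_inner_left[symmetric], rule l2_scaleR_integrable; use l l\<psi> in simp)+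
    ultimately show "(LINT x|M. u x *\<^sub>R E x) \<bullet> b = (- (LINT x|M. \<psi> x *\<^sub>R G x)) \<bullet> b" by simp
  qed
qed

end

section \<open>Uniqueness of weak gradients and the description of \<open>H01\<close> by
  pairs\<close>

context bounded_open
begin

text \<open>On the compact support of \<open>\<phi>\<close> the function \<open>F\<close> is
  integrable and \<open>\<phi>\<close> is bounded. The indicator of that support may then be
  replaced by the one of \<open>\<Omega>\<close>, since \<open>\<phi>\<close> vanishes in
  between.\<close>

lemma loc_integrable_scaleR_test:
  fixes F :: "'a \<Rightarrow> 'b::euclidean_space"
  assumes "loc_integrable \<Omega> F" "test_pair \<phi> D"
  shows "integrable M (\<lambda>x. \<phi> x *\<^sub>R F x)"
proof -
  obtain K where K: "compact K" "K \<subseteq> \<Omega>" "\<And>x. x \<notin> K \<Longrightarrow> \<phi> x = 0" "\<And>x. x \<notin> K \<Longrightarrow> D x = 0"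
    "continuous_on UNIV \<phi>" "continuous_on UNIV D"
    by (rule test_pairD[OF assms(2)]) (rule that; assumption)
  obtain B where "B > 0" and B: "\<And>x. norm (\<phi> x) \<le> B"
    using bounded_continuous_compact_support[OF K(5,1,3)] by blast
  have F1: "integrable lebesgue (\<lambda>x. indicator K x *\<^sub>R F x)"
    using assms(1) K(1,2) by (auto simp: loc_integrable_def set_integrable_def)
  have \<phi>m: "\<phi> \<in> borel_measurable lebesgue"
    by (intro measurable_completion) (simp add: borel_measurable_continuous_onI[OF K(5)])
  have "integrable lebesgue (\<lambda>x. \<phi> x *\<^sub>R (indicator K x *\<^sub>R F x))"
  proof (rule Bochner_Integration.integrable_bound)
    show "integrable lebesgue (\<lambda>x. B * norm (indicator K x *\<^sub>R F x))"
      using F1 by (intro integrable_mult_right integrable_norm)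
    show "(\<lambda>x. \<phi> x *\<^sub>R (indicator K x *\<^sub>R F x)) \<in> borel_measurable lebesgue"
      by (intro borel_measurable_scaleR \<phi>m borel_measurable_integrable[OF F1])
    have "norm (\<phi> x *\<^sub>R (indicator K x *\<^sub>R F x)) \<le> B * norm (indicator K x *\<^sub>R F x)" for x
      unfolding norm_scaleR[of "\<phi> x"] using B[of x] by (intro mult_right_mono) auto
    then show "AE x in lebesgue. norm (\<phi> x *\<^sub>R (indicator K x *\<^sub>R F x)) \<le> norm (B * norm (indicator K x *\<^sub>R F x))"
      by (intro AE_I2) (metis abs_ge_self order_trans real_norm_def)
  qed
  moreover have "(\<lambda>x. \<phi> x *\<^sub>R (indicator K x *\<^sub>R F x)) = (\<lambda>x. indicator \<Omega> x *\<^sub>R (\<phi> x *\<^sub>R F x))"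
    using K(2,3) by (auto simp: indicator_def fun_eq_iff)
  ultimately show ?thesis by (simp add: integrable_restrict_space)
qed

text \<open>
  The test functions are tested on boxes by dominated convergence; a function with vanishing
  integrals over small cubes vanishes at its Lebesgue points.
\<close>

lemma orthogonal_to_test_functions_zero_on_box:
  fixes F :: "'a \<Rightarrow> 'b::euclidean_space"
  assumes F: "loc_integrable \<Omega> F" and z: "\<And>\<phi>. \<phi> \<in> test_functions \<Omega> \<Longrightarrow> (LINT x|M. \<phi> x *\<^sub>R F x) = 0"
    and cd: "cbox c d \<subseteq> \<Omega>"
  shows "\<exists>N. negligible N \<and> (\<forall>x\<in>box c d - N. F x = 0)"
proof -
  \<comment> \<open>Cutting off to the closed box turns local into global integrability without
    changing \<open>F\<close> inside the box.\<close>
  define F1 where "F1 = (\<lambda>x. indicator (cbox c d) x *\<^sub>R F x)"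
  have F1: "integrable lebesgue F1"
    using F cd by (auto simp: loc_integrable_def set_integrable_def F1_def)
  have F1s: "set_integrable lebesgue S F1" if "S \<in> sets lebesgue" for S
    unfolding set_integrable_def using F1 that by (intro integrable_mult_indicator)
  have int0: "integral (cbox a b) F1 = 0" if ab: "cbox a b \<subseteq> cbox c d" for a b
  proof -
    have "(LINT x|lebesgue. box_bump n a b x *\<^sub>R F1 x) = 0" for n
    proof -
      have "indicator \<Omega> x *\<^sub>R (box_bump n a b x *\<^sub>R F x) = box_bump n a b x *\<^sub>R F1 x" for x
      proof (cases "x \<in> box a b")
        case True
        then have "x \<in> cbox c d" using ab box_subset_cbox by blast
        then show ?thesis using cd by (auto simp: F1_def)
      next
        case False
        then have "box_bump n a b x = 0" by (simp add: box_bump_eq_0_iff)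
        then show ?thesis by simp
      qed
      moreover have "(LINT x|M. box_bump n a b x *\<^sub>R F x) = 0"
        by (rule z[OF box_bump_test]) (use ab cd in blast)
      ultimately show ?thesis by (simp add: integral_restrict_space)
    qed
    moreover have "(\<lambda>n. LINT x|lebesgue. box_bump n a b x *\<^sub>R F1 x) \<longlonglongrightarrow> (LINT x|lebesgue. indicator (box a b) x *\<^sub>R F1 x)"
    proof (rule integral_dominated_convergence)
      show "integrable lebesgue (\<lambda>x. norm (F1 x))" using F1 by auto
      show "AE x in lebesgue. (\<lambda>n. box_bump n a b x *\<^sub>R F1 x) \<longlonglongrightarrow> indicator (box a b) x *\<^sub>R F1 x"
        by (intro AE_I2 tendsto_intros box_bump_tendsto)
      show "AE x in lebesgue. norm (box_bump n a b x *\<^sub>R F1 x) \<le> norm (F1 x)" for n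
        using box_bump_bounds[of n a b] by (intro AE_I2) (simp add: mult_left_le_one_le)
      have "box_bump n a b \<in> borel_measurable lebesgue" for n
        using borel_measurable_continuous_onI[OF smooth_continuous[OF smooth_box_bump]]
        by (intro measurable_completion) simp
      then show "(\<lambda>x. box_bump n a b x *\<^sub>R F1 x) \<in> borel_measurable lebesgue" for n
        using F1 by (intro borel_measurable_scaleR) auto
      have "(\<lambda>x. indicator (box a b) x :: real) \<in> borel_measurable lebesgue"
        by (rule borel_measurable_indicator) simp
      then show "(\<lambda>x. indicator (box a b) x *\<^sub>R F1 x) \<in> borel_measurable lebesgue"
        using F1 by (intro borel_measurable_scaleR) auto
    qed
    ultimately have "(LINT x:box a b|lebesgue. F1 x) = 0"
      by (simp add: LIMSEQ_const_iff set_lebesgue_integral_def)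
    then have "integral (box a b) F1 = 0"
      using set_lebesgue_integral_eq_integral(2)[OF F1s[of "box a b"]] by simp
    then show ?thesis by (simp add: integral_open_interval)
  qed
  \<comment> \<open>Lebesgue differentiation in the form that uses cubes with lower corner
    \<open>x\<close>; for small \<open>h\<close> they stay inside the box.\<close>
  obtain N where N: "negligible N" "\<And>x e. \<lbrakk>x \<notin> N; 0 < e\<rbrakk> \<Longrightarrow>
      \<exists>d>0. \<forall>h. 0 < h \<and> h < d \<longrightarrow> norm (integral (cbox x (x + h *\<^sub>R One)) F1 /\<^sub>R h ^ DIM('a) - F1 x) < e"
    using integrable_ccontinuous_explicit[of F1] set_lebesgue_integral_eq_integral(1)[OF F1s] by auto
  have "F x = 0" if x: "x \<in> box c d - N" for x
  proof (rule ccontr)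
    assume nz: "F x \<noteq> 0"
    have "x \<in> cbox c d" using x box_subset_cbox by blast
    then have F1x: "norm (F1 x) > 0" using nz by (simp add: F1_def)
    obtain t where t: "t > 0" "\<And>h. 0 < h \<and> h < t \<Longrightarrow> norm (integral (cbox x (x + h *\<^sub>R One)) F1 /\<^sub>R h ^ DIM('a) - F1 x) < norm (F1 x)"
      using N(2)[of x "norm (F1 x)"] x F1x by blast
    have "\<forall>\<^sub>F h in at_right (0::real). x + h *\<^sub>R One \<in> box c d"
    proof (rule topological_tendstoD)
      have "((\<lambda>h. x + h *\<^sub>R One) \<longlongrightarrow> x + 0 *\<^sub>R One) (at_right (0::real))" by (intro tendsto_intros)
      then show "((\<lambda>h. x + h *\<^sub>R One) \<longlongrightarrow> x) (at_right (0::real))" by simp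
    qed (use x in auto)
    moreover have "\<forall>\<^sub>F h in at_right (0::real). 0 < h \<and> h < t"
      using t(1) eventually_at_right by blast
    ultimately have "\<forall>\<^sub>F h in at_right (0::real). x + h *\<^sub>R One \<in> box c d \<and> 0 < h \<and> h < t"
      by eventually_elim auto
    then obtain h where h: "x + h *\<^sub>R One \<in> box c d" "0 < h" "h < t"
      using eventually_happens'[OF trivial_limit_at_right_real] by blast
    have "cbox x (x + h *\<^sub>R One) \<subseteq> cbox c d"
    proof
      fix y assume y: "y \<in> cbox x (x + h *\<^sub>R One)"
      show "y \<in> cbox c d"
        unfolding mem_box
      proof (intro ballI conjI)
        fix i :: 'a assume i: "i \<in> Basis"
        have "x \<bullet> i \<le> y \<bullet> i" "y \<bullet> i \<le> (x + h *\<^sub>R One) \<bullet> i" using y i unfolding mem_box by blast+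
        moreover have "c \<bullet> i < x \<bullet> i" "(x + h *\<^sub>R One) \<bullet> i < d \<bullet> i" using x h(1) i unfolding mem_box Diff_iff by blast+
        ultimately show "c \<bullet> i \<le> y \<bullet> i" "y \<bullet> i \<le> d \<bullet> i" by linarith+
      qed
    qed
    \<comment> \<open>As the integral over the cube is 0, the estimate reads
      \<open>norm (F1 x) < norm (F1 x)\<close>.\<close>
    from int0[OF this] t(2)[of h] h show False by simp
  qed
  with N(1) show ?thesis by blast
qed

text \<open>Each box contributes its own exceptional null set, so Lindelof's theorem is used to
  cover \<open>\<Omega>\<close> by countably many boxes before taking the union.\<close>

lemma orthogonal_to_test_functions_AE_zero:
  fixes F :: "'a \<Rightarrow> 'b::euclidean_space"
  assumes F: "loc_integrable \<Omega> F" and z: "\<And>\<phi>. \<phi> \<in> test_functions \<Omega> \<Longrightarrow> (LINT x|M. \<phi> x *\<^sub>R F x) = 0"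
  shows "AE x in M. F x = 0"
proof -
  define \<F> where "\<F> = {S. \<exists>c d. S = box c d \<and> cbox c d \<subseteq> \<Omega>}"
  have "\<And>S. S \<in> \<F> \<Longrightarrow> open S" by (auto simp: \<F>_def)
  then obtain \<G> where \<G>: "\<G> \<subseteq> \<F>" "countable \<G>" "\<Union>\<G> = \<Union>\<F>" using Lindelof by metis
  have cover: "x \<in> \<Union>\<F>" if x: "x \<in> \<Omega>" for x
  proof -
    obtain c d where "cbox c d \<subseteq> \<Omega>" "x \<in> box c d" using open_contains_cbox[OF op x] by metis
    then show ?thesis unfolding \<F>_def by blast
  qed
  have "\<forall>S\<in>\<G>. \<exists>N. negligible N \<and> (\<forall>x\<in>S - N. F x = 0)"
    using \<G>(1) orthogonal_to_test_functions_zero_on_box[OF F z] unfolding \<F>_def by blast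
  from bchoice[OF this] obtain N where
    N: "\<And>S. S \<in> \<G> \<Longrightarrow> negligible (N S)" "\<And>S x. S \<in> \<G> \<Longrightarrow> x \<in> S - N S \<Longrightarrow> F x = 0"
    by blast
  have "negligible (\<Union>(N ` \<G>))"
    using \<G>(2) N(1) by (intro negligible_countable_Union) auto
  then have "AE x in lebesgue. x \<notin> \<Union>(N ` \<G>)"
    unfolding negligible_iff_null_sets by (rule AE_not_in)
  then have "AE x in lebesgue. x \<in> \<Omega> \<longrightarrow> F x = 0"
  proof eventually_elim
    case (elim x)
    show ?case
    proof
      assume "x \<in> \<Omega>"
      then obtain S where "S \<in> \<G>" "x \<in> S" using cover \<G>(3) by blast
      with elim N(2) show "F x = 0" by blast
    qed
  qed
  then show ?thesis by (simp add: AE_restrict_space_iff)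
qed

lemma loc_integrable_diff:
  "loc_integrable \<Omega> F \<Longrightarrow> loc_integrable \<Omega> G \<Longrightarrow> loc_integrable \<Omega> (\<lambda>x. F x - G x)"
  unfolding loc_integrable_def by (auto intro: set_integral_diff(1))

text \<open>The difference of two weak gradients is orthogonal to all test functions. This is what
  gives meaning to \<open>weak_gradient\<close>, of which \<open>SOME\<close> reveals nothing but
  \<open>has_weak_gradient\<close>.\<close>

lemma has_weak_gradient_unique:
  assumes "has_weak_gradient \<Omega> u G" "has_weak_gradient \<Omega> u H"
  shows "AE x in M. G x = H x"
proof -
  have l: "loc_integrable \<Omega> G" "loc_integrable \<Omega> H" using assms by (auto simp: has_weak_gradient_def)
  have "AE x in M. G x - H x = 0"
  proof (rule orthogonal_to_test_functions_AE_zero)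
    show "loc_integrable \<Omega> (\<lambda>x. G x - H x)" using l by (rule loc_integrable_diff)
    fix \<phi> assume \<phi>: "\<phi> \<in> test_functions \<Omega>"
    then obtain D where D: "test_pair \<phi> D" using test_pair_exists by blast
    then have "(LINT x|M. \<phi> x *\<^sub>R G x) = (LINT x|M. \<phi> x *\<^sub>R H x)"
      using assms \<phi> unfolding has_weak_gradient_def test_pair_def by force
    \<comment> \<open>Splitting the integral requires both parts to be integrable; local
      integrability yields this only after multiplication by a test function.\<close>
    then show "(LINT x|M. \<phi> x *\<^sub>R (G x - H x)) = 0"
      using loc_integrable_scaleR_test[OF l(1) D] loc_integrable_scaleR_test[OF l(2) D]
      by (simp add: scaleR_diff_right)
  qed
  then show ?thesis by simp
qed

text \<open>Completeness of Lebesgue measure. It makes the gradient representative chosen by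
  \<open>SOME\<close> measurable on all of \<open>\<Omega>\<close> as soon as one square integrable
  weak gradient is known.\<close>

lemma borel_measurable_M_AE:
  fixes g :: "'a \<Rightarrow> 'b::euclidean_space"
  assumes "f \<in> borel_measurable M" "AE x in M. f x = g x"
  shows "g \<in> borel_measurable M"
proof -
  have f: "(\<lambda>x. indicator \<Omega> x *\<^sub>R f x) \<in> borel_measurable lebesgue"
    using assms(1) by (simp add: borel_measurable_restrict_space_iff)
  have "AE x in lebesgue. indicator \<Omega> x *\<^sub>R f x = indicator \<Omega> x *\<^sub>R g x"
    using assms(2) by (auto simp: AE_restrict_space_iff indicator_def elim: eventually_mono)
  then have "(\<lambda>x. indicator \<Omega> x *\<^sub>R g x) \<in> borel_measurable lebesgue"
    by (rule borel_measurable_AE[OF f])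
  then show ?thesis by (simp add: borel_measurable_restrict_space_iff)
qed

lemma weak_gradient_eq:
  assumes "has_weak_gradient \<Omega> u G" "G \<in> l2 M"
  shows "AE x in M. weak_gradient \<Omega> u x = G x" "weak_gradient \<Omega> u \<in> l2 M"
    "l2norm M (weak_gradient \<Omega> u) = l2norm M G"
proof -
  have "has_weak_gradient \<Omega> u (weak_gradient \<Omega> u)"
    unfolding weak_gradient_def by (rule someI[of "has_weak_gradient \<Omega> u", OF assms(1)])
  from has_weak_gradient_unique[OF this assms(1)]
  show ae: "AE x in M. weak_gradient \<Omega> u x = G x" .
  then have ae': "AE x in M. G x = weak_gradient \<Omega> u x" by eventually_elim simp
  have m: "weak_gradient \<Omega> u \<in> borel_measurable M"
    by (rule borel_measurable_M_AE[OF _ ae']) (use assms(2) in \<open>simp add: l2_def\<close>)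
  show "weak_gradient \<Omega> u \<in> l2 M" by (rule l2_cong_AE[OF assms(2) m ae'])
  show "l2norm M (weak_gradient \<Omega> u) = l2norm M G"
    using m assms(2) ae by (intro l2norm_cong_AE) (auto simp: l2_def)
qed

text \<open>In both directions the point is that \<open>G - D\<close> is a weak gradient of
  \<open>u - \<phi>\<close>, hence can replace \<open>weak_gradient\<close> inside
  \<open>H1_norm\<close>. That norm is then comparable with the pair of L^2 distances used in
  \<open>grad0\<close>.\<close>

lemma H01_iff_grad0: "u \<in> H01 \<Omega> \<longleftrightarrow> (\<exists>G. grad0 u G)"
proof
  assume u: "u \<in> H01 \<Omega>"
  then obtain G where G: "u \<in> l2 M" "has_weak_gradient \<Omega> u G" "G \<in> l2 M"
    by (auto simp: H01_def H1_def Lp_2_eq_l2)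
  have "grad0 u G"
    unfolding grad0_def
  proof (intro conjI allI impI)
    fix e :: real assume "e > 0"
    then obtain \<phi> where \<phi>: "\<phi> \<in> test_functions \<Omega>" "H1_norm \<Omega> (\<lambda>x. u x - \<phi> x) < e"
      using u by (auto simp: H01_def)
    then obtain D where D: "test_pair \<phi> D" using test_pair_exists by blast
    note l = test_pair_l2[OF D]
    have w\<phi>: "has_weak_gradient \<Omega> \<phi> D" using D grad0_test grad0_has_weak_gradient by blast
    \<comment> \<open>Linearity of \<open>grad0\<close> cannot be used here, since
      \<open>grad0 u G\<close> is the claim; the weak identity for the difference is checked
      directly.\<close>
    have "has_weak_gradient \<Omega> (\<lambda>x. u x - \<phi> x) (\<lambda>x. G x - D x)"
      unfolding has_weak_gradient_def
    proof (intro conjI ballI allI impI)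
      show "loc_integrable \<Omega> (\<lambda>x. u x - \<phi> x)" "loc_integrable \<Omega> (\<lambda>x. G x - D x)"
        using G(2) w\<phi> by (auto simp: has_weak_gradient_def intro: loc_integrable_diff)
      fix \<psi> E assume \<psi>: "\<psi> \<in> test_functions \<Omega>" "\<forall>x. GDERIV \<psi> x :> E x"
      then have p: "test_pair \<psi> E" by (simp add: test_pair_def)
      note l\<psi> = test_pair_l2[OF p]
      have "(LINT x|M. u x *\<^sub>R E x) = - (LINT x|M. \<psi> x *\<^sub>R G x)"
        "(LINT x|M. \<phi> x *\<^sub>R E x) = - (LINT x|M. \<psi> x *\<^sub>R D x)"
        using G(2) w\<phi> \<psi> by (auto simp: has_weak_gradient_def)
      then show "(LINT x|M. (u x - \<phi> x) *\<^sub>R E x) = - (LINT x|M. \<psi> x *\<^sub>R (G x - D x))"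
        using l2_scaleR_integrable[OF G(1) l\<psi>(5)] l2_scaleR_integrable[OF l(2) l\<psi>(5)]
          l2_scaleR_integrable[OF l\<psi>(2) G(3)] l2_scaleR_integrable[OF l\<psi>(2) l(5)]
        by (simp add: scaleR_diff_left scaleR_diff_right)
    qed
    from weak_gradient_eq(3)[OF this l2_diff[OF G(3) l(5)]]
    have "sqrt ((l2norm M (\<lambda>x. u x - \<phi> x))\<^sup>2 + (l2norm M (\<lambda>x. G x - D x))\<^sup>2) < e"
      using \<phi>(2) by (simp add: H1_norm_def Lp_norm_2_eq_l2norm)
    then have "l2norm M (\<lambda>x. u x - \<phi> x) < e" "l2norm M (\<lambda>x. G x - D x) < e"
      using real_sqrt_sum_squares_ge1 real_sqrt_sum_squares_ge2 order_le_less_trans by blast+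
    with D show "\<exists>\<phi> D. test_pair \<phi> D \<and> l2norm M (\<lambda>x. u x - \<phi> x) < e \<and> l2norm M (\<lambda>x. G x - D x) < e" by blast
  qed (use G in auto)
  then show "\<exists>G. grad0 u G" by blast
next
  assume "\<exists>G. grad0 u G"
  then obtain G where G: "grad0 u G" ..
  note l = grad0_l2[OF G]
  have "u \<in> H1 \<Omega>" using l grad0_has_weak_gradient[OF G] by (auto simp: H1_def Lp_2_eq_l2)
  moreover have "\<exists>\<phi>\<in>test_functions \<Omega>. H1_norm \<Omega> (\<lambda>x. u x - \<phi> x) < e" if e: "e > 0" for e
  proof -
    obtain \<phi> D where p: "test_pair \<phi> D" "l2norm M (\<lambda>x. u x - \<phi> x) < e / 2" "l2norm M (\<lambda>x. G x - D x) < e / 2"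
      using G e unfolding grad0_def by (meson half_gt_zero)
    have "grad0 (\<lambda>x. u x - \<phi> x) (\<lambda>x. G x - D x)"
      using grad0_add[OF G grad0_cmult[OF grad0_test[OF p(1)], of "- 1"]] by simp
    from weak_gradient_eq(3)[OF grad0_has_weak_gradient[OF this] grad0_l2(2)[OF this]]
    have "H1_norm \<Omega> (\<lambda>x. u x - \<phi> x) = sqrt ((l2norm M (\<lambda>x. u x - \<phi> x))\<^sup>2 + (l2norm M (\<lambda>x. G x - D x))\<^sup>2)"
      by (simp add: H1_norm_def Lp_norm_2_eq_l2norm)
    also have "\<dots> \<le> l2norm M (\<lambda>x. u x - \<phi> x) + l2norm M (\<lambda>x. G x - D x)"
      by (rule sqrt_sum_squares_le_sum) (auto simp: l2norm_nonneg)
    also have "\<dots> < e" using p by simp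
    finally show ?thesis using p(1) by (auto simp: test_pair_def)
  qed
  ultimately show "u \<in> H01 \<Omega>" by (simp add: H01_def)
qed

lemma grad0_weak_gradient:
  assumes "grad0 u G"
  shows "AE x in M. weak_gradient \<Omega> u x = G x" "weak_gradient \<Omega> u \<in> l2 M"
    "l2norm M (weak_gradient \<Omega> u) = l2norm M G"
  using weak_gradient_eq[OF grad0_has_weak_gradient[OF assms] grad0_l2(2)[OF assms]] by auto

end

section \<open>Compactness\<close>

text \<open>The estimates below exchange integrals of nonnegative functions; this rule turns their
  outcome in \<open>ennreal\<close> into square integrability and a norm bound at once.\<close>

lemma l2I_nn_integral:
  fixes f :: "'a \<Rightarrow> 'b::euclidean_space"
  assumes f: "f \<in> borel_measurable M" and c: "0 \<le> c" "(\<integral>\<^sup>+x. ennreal ((norm (f x))\<^sup>2) \<partial>M) \<le> ennreal (c\<^sup>2)"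
  shows "f \<in> l2 M" "l2norm M f \<le> c"
proof -
  have i: "integrable M (\<lambda>x. (norm (f x))\<^sup>2)"
    using c f by (intro integrableI_nonneg) (auto simp: order_le_less_trans)
  then show "f \<in> l2 M" using f by (simp add: l2_def)
  have "(LINT x|M. (norm (f x))\<^sup>2) \<le> c\<^sup>2"
    using c i by (simp add: nn_integral_eq_integral)
  then show "l2norm M f \<le> c" unfolding l2norm_def using c(1) by (simp add: real_le_lsqrt)
qed

lemma l2_nn_integral:
  assumes "f \<in> l2 M"
  shows "(\<integral>\<^sup>+x. ennreal ((norm (f x))\<^sup>2) \<partial>M) = ennreal ((l2norm M f)\<^sup>2)"
  using l2_integrable[OF assms] by (simp add: nn_integral_eq_integral l2norm_power2)

lemma l2_bounded:
  fixes f :: "'a \<Rightarrow> 'b::euclidean_space"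
  assumes "finite_measure M" "f \<in> borel_measurable M" "\<And>x. norm (f x) \<le> B"
  shows "f \<in> l2 M"
proof -
  have "integrable M (\<lambda>x. (norm (f x))\<^sup>2)"
  proof (rule Bochner_Integration.integrable_bound)
    show "integrable M (\<lambda>x. B\<^sup>2)" using assms(1) by (rule finite_measure.integrable_const)
    show "AE x in M. norm ((norm (f x))\<^sup>2) \<le> norm (B\<^sup>2)"
      using power_mono[OF assms(3) norm_ge_zero, where n = 2] by auto
  qed (use assms in auto)
  with assms(2) show ?thesis by (simp add: l2_def)
qed

lemma l2_bound_by_constant:
  fixes f :: "'a \<Rightarrow> 'b::euclidean_space"
  assumes "finite_measure M" "f \<in> l2 M" "0 \<le> B" "\<And>x. x \<in> space M \<Longrightarrow> norm (f x) \<le> B"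
  shows "l2norm M f \<le> B * sqrt (measure M (space M))"
proof -
  have "(LINT x|M. (norm (f x))\<^sup>2) \<le> (LINT x|M. B\<^sup>2)"
    using assms by (intro integral_mono l2_integrable finite_measure.integrable_const power_mono) auto
  then have "l2norm M f \<le> sqrt (B\<^sup>2 * measure M (space M))"
    unfolding l2norm_def by (simp add: mult.commute)
  then show ?thesis using assms(3) by (simp add: real_sqrt_mult)
qed

text \<open>Cauchy-Schwarz against the constant 1, that is, Jensen's inequality for the square
  before normalization of the measure.\<close>

lemma power2_integral_le:
  fixes f :: "'a \<Rightarrow> real"
  assumes "finite_measure M" "f \<in> l2 M"
  shows "(LINT x|M. f x)\<^sup>2 \<le> measure M (space M) * (LINT x|M. (f x)\<^sup>2)"
proof -
  have "\<bar>LINT x|M. f x\<bar> \<le> l2norm M f * l2norm M (\<lambda>x. 1::real)"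
    using l2_Cauchy_Schwarz[OF assms(2) l2_const[OF assms(1), of 1]] by simp
  then have "\<bar>LINT x|M. f x\<bar>\<^sup>2 \<le> (l2norm M f * l2norm M (\<lambda>x. 1::real))\<^sup>2"
    by (intro power_mono) auto
  then show ?thesis by (simp add: power_mult_distrib l2norm_power2 mult.commute)
qed

section \<open>The translation estimate in L^2\<close>

lemma sigma_finite_lborel_pair:
  "finite_measure P \<Longrightarrow> pair_sigma_finite (lborel :: 'a::euclidean_space measure) P"
  by (simp add: pair_sigma_finite_def lborel.sigma_finite_measure_axioms finite_measure.axioms(1))

lemma nn_integral_lborel_translate:
  fixes g :: "'a::euclidean_space \<Rightarrow> ennreal"
  assumes [measurable]: "g \<in> borel_measurable borel"
  shows "(\<integral>\<^sup>+x. g (x + c) \<partial>lborel) = (\<integral>\<^sup>+x. g x \<partial>lborel)"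
proof -
  have "(\<integral>\<^sup>+x. g x \<partial>distr lborel borel ((+) c)) = (\<integral>\<^sup>+x. g (c + x) \<partial>lborel)"
    by (rule nn_integral_distr) auto
  then show ?thesis by (simp add: lborel_distr_plus add.commute)
qed

text \<open>The parameter space of a segment from \<open>x\<close> to \<open>x + z\<close>. It has
  total mass 1, so Cauchy-Schwarz costs no constant, and as a finite measure it can be paired with
  \<open>lborel\<close> for exchanging integrals.\<close>

abbreviation "unit_interval \<equiv> restrict_space lborel {0..1::real}"

lemma unit_interval_finite: "finite_measure unit_interval" "measure unit_interval (space unit_interval) = 1"
proof -
  have e: "emeasure unit_interval (space unit_interval) = 1"
    by (simp add: space_restrict_space emeasure_restrict_space)
  then show "finite_measure unit_interval" by (intro finite_measureI) simp
  show "measure unit_interval (space unit_interval) = 1" using e by (simp add: measure_def)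
qed

text \<open>The fundamental theorem of calculus along the segment, followed by Cauchy-Schwarz on the
  unit interval. The bound \<open>B\<close> makes the gradient square integrable along the segment.
  The conclusion is phrased in \<open>ennreal\<close>, ready for integration over
  \<open>x\<close>.\<close>

lemma difference_power2_le:
  fixes f :: "'a::euclidean_space \<Rightarrow> real"
  assumes D: "\<And>x. GDERIV f x :> D x" "continuous_on UNIV D" "\<And>x. norm (D x) \<le> B"
  shows "ennreal ((f (x + z) - f x)\<^sup>2) \<le> ennreal ((norm z)\<^sup>2) * (\<integral>\<^sup>+t. ennreal ((norm (D (x + t *\<^sub>R z)))\<^sup>2) \<partial>unit_interval)"
proof -
  let ?I = unit_interval
  have c: "continuous_on UNIV (\<lambda>t. D (x + t *\<^sub>R z))"
    by (rule continuous_on_compose2[OF D(2)]) (auto intro!: continuous_intros)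
  then have m: "(\<lambda>t. D (x + t *\<^sub>R z)) \<in> borel_measurable ?I"
    by (intro measurable_restrict_space1) (simp add: borel_measurable_continuous_onI)
  have l: "(\<lambda>t. D (x + t *\<^sub>R z)) \<in> l2 ?I"
    by (rule l2_bounded[OF unit_interval_finite(1) m]) (rule D(3))
  have lz: "(\<lambda>t. D (x + t *\<^sub>R z) \<bullet> z) \<in> l2 ?I"
  proof (rule l2_bounded[OF unit_interval_finite(1)])
    show "norm (D (x + t *\<^sub>R z) \<bullet> z) \<le> B * norm z" for t
    proof -
      have "norm (D (x + t *\<^sub>R z) \<bullet> z) \<le> norm (D (x + t *\<^sub>R z)) * norm z"
        by (simp add: Cauchy_Schwarz_ineq2)
      also have "\<dots> \<le> B * norm z" by (intro mult_right_mono D(3)) auto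
      finally show ?thesis .
    qed
  qed (use m in simp)
  have "(LINT t|lborel. indicator {0..1} t *\<^sub>R (D (x + t *\<^sub>R z) \<bullet> z)) = f (x + 1 *\<^sub>R z) - f (x + 0 *\<^sub>R z)"
  proof (rule integral_FTC_atLeastAtMost)
    show "((\<lambda>t. f (x + t *\<^sub>R z)) has_vector_derivative D (x + t *\<^sub>R z) \<bullet> z) (at t within {0..1})" for t
      using GDERIV_line[OF D(1)] has_real_derivative_iff_has_vector_derivative has_vector_derivative_at_within by blast
    show "continuous_on {0..1} (\<lambda>t. D (x + t *\<^sub>R z) \<bullet> z)"
      by (intro continuous_intros continuous_on_subset[OF c]) auto
  qed auto
  then have "f (x + z) - f x = (LINT t|?I. D (x + t *\<^sub>R z) \<bullet> z)"
    by (subst integral_restrict_space) auto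
  then have "(f (x + z) - f x)\<^sup>2 \<le> (LINT t|?I. (D (x + t *\<^sub>R z) \<bullet> z)\<^sup>2)"
    using power2_integral_le[OF unit_interval_finite(1) lz] unit_interval_finite(2) by simp
  also have "\<dots> \<le> (LINT t|?I. (norm z)\<^sup>2 * (norm (D (x + t *\<^sub>R z)))\<^sup>2)"
  proof (rule integral_mono)
    show "(D (x + t *\<^sub>R z) \<bullet> z)\<^sup>2 \<le> (norm z)\<^sup>2 * (norm (D (x + t *\<^sub>R z)))\<^sup>2" for t
      using Cauchy_Schwarz_ineq[of "D (x + t *\<^sub>R z)" z] by (simp add: power2_norm_eq_inner mult.commute)
  qed (use l2_integrable[OF lz] l2_integrable[OF l] in auto)
  also have "\<dots> = (norm z)\<^sup>2 * (LINT t|?I. (norm (D (x + t *\<^sub>R z)))\<^sup>2)" by simp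
  finally have "ennreal ((f (x + z) - f x)\<^sup>2) \<le> ennreal ((norm z)\<^sup>2) * ennreal (LINT t|?I. (norm (D (x + t *\<^sub>R z)))\<^sup>2)"
    by (simp add: ennreal_leI flip: ennreal_mult)
  then show ?thesis using l2_integrable[OF l] by (simp add: nn_integral_eq_integral)
qed

text \<open>The pointwise bound is integrated over \<open>x\<close> and the integrals are exchanged:
  for each \<open>t\<close> the inner integral is a translate of that of the squared gradient, hence
  independent of \<open>t\<close>.\<close>

lemma translation_estimate:
  fixes f :: "'a::euclidean_space \<Rightarrow> real"
  assumes D: "\<And>x. GDERIV f x :> D x" "continuous_on UNIV D" "\<And>x. norm (D x) \<le> B" "D \<in> l2 lborel"
  shows "(\<integral>\<^sup>+x. ennreal ((f (x + z) - f x)\<^sup>2) \<partial>lborel) \<le> ennreal ((norm z * l2norm lborel D)\<^sup>2)"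
proof -
  let ?I = unit_interval
  interpret pair_sigma_finite "lborel :: 'a measure" ?I
    by (rule sigma_finite_lborel_pair[OF unit_interval_finite(1)])
  have [measurable]: "D \<in> borel_measurable borel" by (rule borel_measurable_continuous_onI[OF D(2)])
  have "(\<lambda>t::real. t) \<in> measurable ?I borel" by (intro measurable_restrict_space1) simp
  then have [measurable]: "snd \<in> borel_measurable ((lborel :: 'a measure) \<Otimes>\<^sub>M ?I)"
    by (rule measurable_compose[OF measurable_snd])
  have [measurable]: "fst \<in> borel_measurable ((lborel :: 'a measure) \<Otimes>\<^sub>M ?I)"
    using measurable_fst[of lborel ?I] by simp
  have "(\<lambda>p. ennreal ((norm (D (fst p + snd p *\<^sub>R z)))\<^sup>2)) \<in> borel_measurable (lborel \<Otimes>\<^sub>M ?I)"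
    by measurable
  then have m: "case_prod (\<lambda>x t. ennreal ((norm (D (x + t *\<^sub>R z)))\<^sup>2)) \<in> borel_measurable (lborel \<Otimes>\<^sub>M ?I)"
    by (simp add: case_prod_beta')
  have "(\<integral>\<^sup>+x. ennreal ((f (x + z) - f x)\<^sup>2) \<partial>lborel)
      \<le> (\<integral>\<^sup>+x. ennreal ((norm z)\<^sup>2) * (\<integral>\<^sup>+t. ennreal ((norm (D (x + t *\<^sub>R z)))\<^sup>2) \<partial>?I) \<partial>lborel)"
    by (intro nn_integral_mono difference_power2_le[OF D(1-3)])
  also have "\<dots> = ennreal ((norm z)\<^sup>2) * (\<integral>\<^sup>+x. (\<integral>\<^sup>+t. ennreal ((norm (D (x + t *\<^sub>R z)))\<^sup>2) \<partial>?I) \<partial>lborel)"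
    using m by (intro nn_integral_cmult M2.borel_measurable_nn_integral)
  also have "(\<integral>\<^sup>+x. (\<integral>\<^sup>+t. ennreal ((norm (D (x + t *\<^sub>R z)))\<^sup>2) \<partial>?I) \<partial>lborel)
      = (\<integral>\<^sup>+t. (\<integral>\<^sup>+x. ennreal ((norm (D (x + t *\<^sub>R z)))\<^sup>2) \<partial>lborel) \<partial>?I)"
    by (rule Fubini'[OF m, symmetric])
  also have "\<dots> = (\<integral>\<^sup>+t. ennreal ((l2norm lborel D)\<^sup>2) \<partial>?I)"
  proof (rule nn_integral_cong)
    fix t
    have "(\<integral>\<^sup>+x. ennreal ((norm (D (x + t *\<^sub>R z)))\<^sup>2) \<partial>lborel) = (\<integral>\<^sup>+x. ennreal ((norm (D x))\<^sup>2) \<partial>lborel)"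
      by (rule nn_integral_lborel_translate[of "\<lambda>x. ennreal ((norm (D x))\<^sup>2)"]) measurable
    then show "(\<integral>\<^sup>+x. ennreal ((norm (D (x + t *\<^sub>R z)))\<^sup>2) \<partial>lborel) = ennreal ((l2norm lborel D)\<^sup>2)"
      by (simp add: l2_nn_integral[OF D(4)])
  qed
  also have "\<dots> = ennreal ((l2norm lborel D)\<^sup>2)"
    by (simp add: space_restrict_space emeasure_restrict_space)
  finally show ?thesis by (simp add: power_mult_distrib ennreal_mult)
qed

text \<open>Convolution with the normalized indicator of a ball. No smooth kernel is needed:
  Lipschitz continuity of the averages suffices for Arzela-Ascoli.\<close>

definition ball_average :: "real \<Rightarrow> ('a::euclidean_space \<Rightarrow> real) \<Rightarrow> 'a \<Rightarrow> real" where
  "ball_average \<epsilon> f x = (LINT z|restrict_space lborel (cball 0 \<epsilon>). f (x + z)) / measure lborel (cball (0::'a) \<epsilon>)"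

lemma cball_measure:
  assumes "\<epsilon> > 0"
  defines "P \<equiv> restrict_space lborel (cball (0::'a::euclidean_space) \<epsilon>)"
  shows "finite_measure P" "measure P (space P) = measure lborel (cball (0::'a) \<epsilon>)"
    "measure lborel (cball (0::'a) \<epsilon>) > 0" "emeasure P (space P) = ennreal (measure lborel (cball (0::'a) \<epsilon>))"
proof -
  have fin: "emeasure lborel (cball (0::'a) \<epsilon>) < \<infinity>"
    by (rule emeasure_bounded_finite) simp
  have e: "emeasure P (space P) = emeasure lborel (cball (0::'a) \<epsilon>)"
    unfolding P_def by (simp add: space_restrict_space emeasure_restrict_space)
  then show "finite_measure P" using fin by (intro finite_measureI) auto
  show "measure P (space P) = measure lborel (cball (0::'a) \<epsilon>)" using e by (simp add: measure_def)
  show "measure lborel (cball (0::'a) \<epsilon>) > 0"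
    using content_cball_pos[OF assms(1), of "0::'a"] by (simp add: measure_completion)
  show "emeasure P (space P) = ennreal (measure lborel (cball (0::'a) \<epsilon>))"
    using e fin by (simp add: emeasure_eq_ennreal_measure)
qed

context
  fixes f :: "'a::euclidean_space \<Rightarrow> real" and B' \<epsilon> \<mu> :: real
  assumes f: "continuous_on UNIV f" "\<And>x. norm (f x) \<le> B'" "f \<in> l2 lborel"
    and \<epsilon>: "\<epsilon> > 0" and mu: "\<mu> = measure lborel (cball (0::'a) \<epsilon>)"
begin

private abbreviation "P \<equiv> restrict_space lborel (cball (0::'a) \<epsilon>)"
private lemmas P_facts = cball_measure[OF \<epsilon>, where 'a = 'a, folded mu]

private lemma ball_average_eq: "ball_average \<epsilon> f x = (LINT z|P. f (x + z)) / \<mu>"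
  by (simp add: ball_average_def mu)

private lemma fm [measurable]: "f \<in> borel_measurable borel"
  by (rule borel_measurable_continuous_onI[OF f(1)])

private lemma shift_l2: "(\<lambda>z. f (x + z)) \<in> l2 P"
proof (rule l2_bounded[OF P_facts(1)])
  have "(\<lambda>z. f (x + z)) \<in> borel_measurable borel" by measurable
  then show "(\<lambda>z. f (x + z)) \<in> borel_measurable P" by (intro measurable_restrict_space1) simp
qed (rule f(2))

private lemma nn_integral_P_le:
  assumes "g \<in> borel_measurable borel"
  shows "(\<integral>\<^sup>+x. ennreal ((norm (g x))\<^sup>2) \<partial>P) \<le> (\<integral>\<^sup>+x. ennreal ((norm (g x::real))\<^sup>2) \<partial>lborel)"
  by (subst nn_integral_restrict_space) (auto intro!: nn_integral_mono simp: indicator_def)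

text \<open>Cauchy-Schwarz on the ball gives a factor \<open>sqrt \<mu>\<close>, of which the
  division by \<open>\<mu>\<close> leaves \<open>1 / sqrt \<mu>\<close>. The bound degenerates as
  the radius shrinks, which is harmless because the radius is fixed wherever it is used.\<close>

lemma ball_average_bound: "\<bar>ball_average \<epsilon> f x\<bar> \<le> l2norm lborel f / sqrt \<mu>"
proof -
  have "l2norm P (\<lambda>z. f (x + z)) \<le> l2norm lborel f"
  proof (rule l2I_nn_integral(2))
    show "(\<lambda>z. f (x + z)) \<in> borel_measurable P" using shift_l2 by (simp add: l2_def)
    have "(\<integral>\<^sup>+z. ennreal ((norm (f (x + z)))\<^sup>2) \<partial>P) \<le> (\<integral>\<^sup>+z. ennreal ((norm (f (x + z)))\<^sup>2) \<partial>lborel)"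
      by (rule nn_integral_P_le) measurable
    also have "\<dots> = (\<integral>\<^sup>+z. ennreal ((norm (f z))\<^sup>2) \<partial>lborel)"
      using nn_integral_lborel_translate[of "\<lambda>z. ennreal ((norm (f z))\<^sup>2)" x] by (simp add: add.commute)
    finally show "(\<integral>\<^sup>+z. ennreal ((norm (f (x + z)))\<^sup>2) \<partial>P) \<le> ennreal ((l2norm lborel f)\<^sup>2)"
      by (simp only: l2_nn_integral[OF f(3)])
  qed (rule l2norm_nonneg)
  then have "(l2norm P (\<lambda>z. f (x + z)))\<^sup>2 \<le> (l2norm lborel f)\<^sup>2"
    by (intro power_mono l2norm_nonneg)
  then have "(LINT z|P. f (x + z))\<^sup>2 \<le> \<mu> * (l2norm lborel f)\<^sup>2"
    using power2_integral_le[OF P_facts(1) shift_l2, of x] P_facts(2,3)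
    by (simp add: l2norm_power2) (meson less_imp_le mult_left_mono order_trans)
  then have "(LINT z|P. f (x + z))\<^sup>2 / \<mu>\<^sup>2 \<le> (l2norm lborel f)\<^sup>2 / \<mu>"
    using P_facts(3) by (simp add: field_simps power2_eq_square)
  then have "(ball_average \<epsilon> f x)\<^sup>2 \<le> (l2norm lborel f / sqrt \<mu>)\<^sup>2"
    using P_facts(3) by (simp add: ball_average_eq power_divide)
  then show ?thesis
    by (rule power2_le_imp_le[of "\<bar>ball_average \<epsilon> f x\<bar>", simplified])
       (simp add: l2norm_nonneg less_imp_le[OF P_facts(3)])
qed

text \<open>The error is an average of translation differences with
  \<open>norm z \<le> \<epsilon>\<close>. After Jensen's inequality and an exchange of integrals
  each difference is covered by the translation estimate, and \<open>1 / \<mu>\<close> cancels the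
  mass of the ball.\<close>

lemma ball_average_error:
  assumes D: "\<And>x. GDERIV f x :> D x" "continuous_on UNIV D" "\<And>x. norm (D x) \<le> B" "D \<in> l2 lborel"
    and m: "ball_average \<epsilon> f \<in> borel_measurable borel"
  shows "(\<lambda>x. ball_average \<epsilon> f x - f x) \<in> l2 lborel"
    "l2norm lborel (\<lambda>x. ball_average \<epsilon> f x - f x) \<le> \<epsilon> * l2norm lborel D"
proof -
  interpret pair_sigma_finite "lborel :: 'a measure" P
    by (rule sigma_finite_lborel_pair[OF P_facts(1)])
  note \<mu> = P_facts(3)
  have "(\<lambda>t. t) \<in> measurable P borel" by (intro measurable_restrict_space1) simp
  then have [measurable]: "snd \<in> borel_measurable ((lborel :: 'a measure) \<Otimes>\<^sub>M P)"
    by (rule measurable_compose[OF measurable_snd])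
  have [measurable]: "fst \<in> borel_measurable ((lborel :: 'a measure) \<Otimes>\<^sub>M P)"
    using measurable_fst[of lborel P] by simp
  have "(\<lambda>p. ennreal ((f (fst p + snd p) - f (fst p))\<^sup>2)) \<in> borel_measurable (lborel \<Otimes>\<^sub>M P)"
    by measurable
  then have mm: "case_prod (\<lambda>x z. ennreal ((f (x + z) - f x)\<^sup>2)) \<in> borel_measurable (lborel \<Otimes>\<^sub>M P)"
    by (simp add: case_prod_beta')
  have pt: "ennreal ((norm (ball_average \<epsilon> f x - f x))\<^sup>2) \<le> ennreal (1 / \<mu>) * (\<integral>\<^sup>+z. ennreal ((f (x + z) - f x)\<^sup>2) \<partial>P)" for x
  proof -
    have l: "(\<lambda>z. f (x + z) - f x) \<in> l2 P"
      by (intro l2_diff shift_l2 l2_const[OF P_facts(1)])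
    have "(LINT z|P. f (x + z) - f x) = (LINT z|P. f (x + z)) - f x * \<mu>"
      using l2_imp_integrable[OF P_facts(1) shift_l2[of x]] P_facts(2)
      by (subst Bochner_Integration.integral_diff)
         (auto intro!: finite_measure.integrable_const[OF P_facts(1)])
    then have "ball_average \<epsilon> f x - f x = (LINT z|P. f (x + z) - f x) / \<mu>"
      using \<mu> by (simp add: ball_average_eq field_simps)
    then have "(norm (ball_average \<epsilon> f x - f x))\<^sup>2 = (LINT z|P. f (x + z) - f x)\<^sup>2 / \<mu>\<^sup>2"
      by (simp add: power_divide)
    also have "\<dots> \<le> (\<mu> * (LINT z|P. (f (x + z) - f x)\<^sup>2)) / \<mu>\<^sup>2"
      using power2_integral_le[OF P_facts(1) l] P_facts(2)
      by (intro divide_right_mono) auto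
    also have "\<dots> = 1 / \<mu> * (LINT z|P. (f (x + z) - f x)\<^sup>2)"
      using \<mu> by (simp add: field_simps power2_eq_square)
    finally have "ennreal ((norm (ball_average \<epsilon> f x - f x))\<^sup>2) \<le> ennreal (1 / \<mu> * (LINT z|P. (f (x + z) - f x)\<^sup>2))"
      by (rule ennreal_leI)
    also have "\<dots> = ennreal (1 / \<mu>) * ennreal (LINT z|P. (f (x + z) - f x)\<^sup>2)"
      using \<mu> by (intro ennreal_mult) auto
    also have "ennreal (LINT z|P. (f (x + z) - f x)\<^sup>2) = (\<integral>\<^sup>+z. ennreal ((f (x + z) - f x)\<^sup>2) \<partial>P)"
      using l2_integrable[OF l] by (simp add: nn_integral_eq_integral)
    finally show ?thesis .
  qed
  have "(\<integral>\<^sup>+x. ennreal ((norm (ball_average \<epsilon> f x - f x))\<^sup>2) \<partial>lborel)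
      \<le> (\<integral>\<^sup>+x. ennreal (1 / \<mu>) * (\<integral>\<^sup>+z. ennreal ((f (x + z) - f x)\<^sup>2) \<partial>P) \<partial>lborel)"
    by (intro nn_integral_mono pt)
  also have "\<dots> = ennreal (1 / \<mu>) * (\<integral>\<^sup>+x. (\<integral>\<^sup>+z. ennreal ((f (x + z) - f x)\<^sup>2) \<partial>P) \<partial>lborel)"
    using mm by (intro nn_integral_cmult M2.borel_measurable_nn_integral)
  also have "(\<integral>\<^sup>+x. (\<integral>\<^sup>+z. ennreal ((f (x + z) - f x)\<^sup>2) \<partial>P) \<partial>lborel)
      = (\<integral>\<^sup>+z. (\<integral>\<^sup>+x. ennreal ((f (x + z) - f x)\<^sup>2) \<partial>lborel) \<partial>P)"
    by (rule Fubini'[OF mm, symmetric])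
  also have "\<dots> \<le> (\<integral>\<^sup>+z. ennreal ((\<epsilon> * l2norm lborel D)\<^sup>2) \<partial>P)"
  proof (rule nn_integral_mono)
    fix z assume "z \<in> space P"
    then have "norm z \<le> \<epsilon>" by (simp add: space_restrict_space)
    then have "(norm z * l2norm lborel D)\<^sup>2 \<le> (\<epsilon> * l2norm lborel D)\<^sup>2"
      by (intro power_mono mult_right_mono) (auto simp: l2norm_nonneg)
    then show "(\<integral>\<^sup>+x. ennreal ((f (x + z) - f x)\<^sup>2) \<partial>lborel) \<le> ennreal ((\<epsilon> * l2norm lborel D)\<^sup>2)"
      using translation_estimate[OF D, of z] ennreal_leI order_trans by blast
  qed
  also have "\<dots> = ennreal ((\<epsilon> * l2norm lborel D)\<^sup>2) * ennreal \<mu>"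
    unfolding P_facts(4)[symmetric] by (rule nn_integral_const)
  finally have "(\<integral>\<^sup>+x. ennreal ((norm (ball_average \<epsilon> f x - f x))\<^sup>2) \<partial>lborel)
      \<le> ennreal (1 / \<mu>) * (ennreal ((\<epsilon> * l2norm lborel D)\<^sup>2) * ennreal \<mu>)"
    by (simp add: mult_left_mono)
  also have "\<dots> = ennreal ((\<epsilon> * l2norm lborel D)\<^sup>2)"
    using \<mu> by (simp flip: ennreal_mult)
  finally have b: "(\<integral>\<^sup>+x. ennreal ((norm (ball_average \<epsilon> f x - f x))\<^sup>2) \<partial>lborel) \<le> ennreal ((\<epsilon> * l2norm lborel D)\<^sup>2)" .
  have "(\<lambda>x. ball_average \<epsilon> f x - f x) \<in> borel_measurable lborel" using m by simp
  from l2I_nn_integral[OF this _ b] \<epsilon>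
  show "(\<lambda>x. ball_average \<epsilon> f x - f x) \<in> l2 lborel"
    "l2norm lborel (\<lambda>x. ball_average \<epsilon> f x - f x) \<le> \<epsilon> * l2norm lborel D"
    by (auto simp: l2norm_nonneg)
qed

end

text \<open>Averaging commutes with translation. A difference of averages thus becomes a single
  average at \<open>y\<close>, to which the sup bound applies.\<close>

lemma ball_average_diff:
  fixes f g :: "'a::euclidean_space \<Rightarrow> real"
  assumes "continuous_on UNIV f" "\<And>x. norm (f x) \<le> B" "\<epsilon> > 0"
  shows "ball_average \<epsilon> f x - ball_average \<epsilon> f y = ball_average \<epsilon> (\<lambda>u. f (u + (x - y)) - f u) y"
proof -
  let ?P = "restrict_space lborel (cball (0::'a) \<epsilon>)"
  have i: "integrable ?P (\<lambda>z. f (v + z))" for v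
  proof -
    have "(\<lambda>z. f (v + z)) \<in> borel_measurable borel"
      by (intro borel_measurable_continuous_onI continuous_on_compose2[OF assms(1)]) (auto intro!: continuous_intros)
    then have "(\<lambda>z. f (v + z)) \<in> borel_measurable ?P" by (intro measurable_restrict_space1) simp
    then show ?thesis
      using l2_imp_integrable l2_bounded assms(2) cball_measure(1)[OF assms(3)] by blast
  qed
  have "(LINT z|?P. f (x + z)) - (LINT z|?P. f (y + z)) = (LINT z|?P. f (x + z) - f (y + z))"
    using i by simp
  then show ?thesis by (simp add: ball_average_def algebra_simps flip: diff_divide_distrib)
qed

section \<open>Rellich's theorem\<close>

context bounded_open
begin

text \<open>Averages of a test function may leak out of \<open>\<Omega>\<close>, so here no support
  condition is imposed and only an inequality between the norms is available.\<close>

lemma l2_lborel_imp_M: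
  fixes f :: "'a \<Rightarrow> 'b::euclidean_space"
  assumes m: "f \<in> borel_measurable borel" and f: "f \<in> l2 lborel"
  shows "f \<in> l2 M" "l2norm M f \<le> l2norm lborel f"
proof -
  have "(\<integral>\<^sup>+x. ennreal ((norm (f x))\<^sup>2) \<partial>M) = (\<integral>\<^sup>+x. ennreal ((norm (f x))\<^sup>2) * indicator \<Omega> x \<partial>lebesgue)"
    by (subst nn_integral_restrict_space) auto
  also have "\<dots> \<le> (\<integral>\<^sup>+x. ennreal ((norm (f x))\<^sup>2) \<partial>lebesgue)"
    by (intro nn_integral_mono) (auto simp: indicator_def)
  also have "\<dots> = ennreal ((l2norm lborel f)\<^sup>2)"
    by (simp only: nn_integral_completion l2_nn_integral[OF f])
  finally have "(\<integral>\<^sup>+x. ennreal ((norm (f x))\<^sup>2) \<partial>M) \<le> ennreal ((l2norm lborel f)\<^sup>2)" .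
  from l2I_nn_integral[OF borel_measurable_M[OF m] l2norm_nonneg this]
  show "f \<in> l2 M" "l2norm M f \<le> l2norm lborel f" by auto
qed

lemma test_pair_bounded:
  assumes "test_pair \<phi> D"
  shows "\<exists>B. \<forall>x. norm (\<phi> x) \<le> B" "\<exists>B. \<forall>x. norm (D x) \<le> B"
proof -
  obtain K where K: "compact K" "K \<subseteq> \<Omega>" "\<And>x. x \<notin> K \<Longrightarrow> \<phi> x = 0" "\<And>x. x \<notin> K \<Longrightarrow> D x = 0"
    "continuous_on UNIV \<phi>" "continuous_on UNIV D"
    by (rule test_pairD[OF assms]) (rule that; assumption)
  show "\<exists>B. \<forall>x. norm (\<phi> x) \<le> B"
    by (rule bounded_continuous_compact_support[OF K(5,1)]) (use K(3) in auto)
  show "\<exists>B. \<forall>x. norm (D x) \<le> B"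
    by (rule bounded_continuous_compact_support[OF K(6,1)]) (use K(4) in auto)
qed

text \<open>
  The \<open>L\<^sup>2\<close> error of averaging is small uniformly over bounded families, while for a fixed
  radius the averages of such a family fall under the Arzela-Ascoli theorem.
\<close>

lemma test_pair_ball_average:
  assumes t: "test_pair \<phi> D" and C: "l2norm M \<phi> \<le> C" "l2norm M D \<le> C" and \<epsilon>: "\<epsilon> > 0"
  defines "\<kappa> \<equiv> C / sqrt (measure lborel (cball (0::'a) \<epsilon>))"
  shows "\<bar>ball_average \<epsilon> \<phi> x\<bar> \<le> \<kappa>" "\<bar>ball_average \<epsilon> \<phi> x - ball_average \<epsilon> \<phi> y\<bar> \<le> norm (x - y) * \<kappa>"
    "continuous_on UNIV (ball_average \<epsilon> \<phi>)" "ball_average \<epsilon> \<phi> \<in> l2 M"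
    "l2norm M (\<lambda>x. ball_average \<epsilon> \<phi> x - \<phi> x) \<le> \<epsilon> * C"
proof -
  let ?\<mu> = "measure lborel (cball (0::'a) \<epsilon>)"
  obtain K where "compact K" "K \<subseteq> \<Omega>" "\<And>x. x \<notin> K \<Longrightarrow> \<phi> x = 0" "\<And>x. x \<notin> K \<Longrightarrow> D x = 0"
    and c: "continuous_on UNIV \<phi>" "continuous_on UNIV D"
    by (rule test_pairD[OF t]) (rule that; assumption)
  obtain B B' where B: "\<And>x. norm (\<phi> x) \<le> B" "\<And>x. norm (D x) \<le> B'"
    using test_pair_bounded[OF t] by blast
  have G: "\<And>x. GDERIV \<phi> x :> D x" using t by (simp add: test_pair_def)
  note l = test_pair_l2[OF t]
  have Cl: "l2norm lborel \<phi> \<le> C" "l2norm lborel D \<le> C" using C l(3,6) by simp_all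
  have [measurable]: "\<phi> \<in> borel_measurable borel" by (rule borel_measurable_continuous_onI[OF c(1)])
  have bound: "\<bar>ball_average \<epsilon> \<phi> x\<bar> \<le> \<kappa>" for x
    using ball_average_bound[OF c(1) B(1) l(1) \<epsilon> refl, of x] divide_right_mono[OF Cl(1), of "sqrt ?\<mu>"]
    unfolding \<kappa>_def by simp
  then show "\<bar>ball_average \<epsilon> \<phi> x\<bar> \<le> \<kappa>" .
  \<comment> \<open>The sup bound for averages asks only for the L^2 norm of the translated
    difference, which the translation estimate bounds by \<open>norm (x - y)\<close> times the
    gradient norm.\<close>
  have lip: "\<bar>ball_average \<epsilon> \<phi> x - ball_average \<epsilon> \<phi> y\<bar> \<le> norm (x - y) * \<kappa>" for x y
  proof -
    let ?g = "\<lambda>u. \<phi> (u + (x - y)) - \<phi> u"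
    have cg: "continuous_on UNIV ?g"
      by (intro continuous_intros continuous_on_compose2[OF c(1)]) auto
    have bg: "norm (?g u) \<le> B + B" for u
      using norm_triangle_ineq4[of "\<phi> (u + (x - y))" "\<phi> u"] B(1)[of u] B(1)[of "u + (x - y)"] by linarith
    have "?g \<in> borel_measurable lborel" by measurable
    from l2I_nn_integral[OF this, of "norm (x - y) * l2norm lborel D"]
    have lg: "?g \<in> l2 lborel" "l2norm lborel ?g \<le> norm (x - y) * l2norm lborel D"
      using translation_estimate[OF G c(2) B(2) l(4), of "x - y"] by (auto simp: l2norm_nonneg)
    have "l2norm lborel ?g \<le> norm (x - y) * C"
      using lg(2) Cl(2) by (meson mult_left_mono norm_ge_zero order_trans)
    then have "l2norm lborel ?g / sqrt ?\<mu> \<le> norm (x - y) * C / sqrt ?\<mu>"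
      by (rule divide_right_mono) simp
    then show ?thesis
      using ball_average_bound[OF cg bg lg(1) \<epsilon> refl, of y] ball_average_diff[OF c(1) B(1) \<epsilon>, of x y]
      by (simp add: \<kappa>_def)
  qed
  then show "\<bar>ball_average \<epsilon> \<phi> x - ball_average \<epsilon> \<phi> y\<bar> \<le> norm (x - y) * \<kappa>" .
  show co: "continuous_on UNIV (ball_average \<epsilon> \<phi>)"
  proof -
    have "\<kappa> \<ge> 0" using bound[of 0] by linarith
    then have "\<kappa>-lipschitz_on UNIV (ball_average \<epsilon> \<phi>)"
      using lip by (auto intro!: lipschitz_onI simp: dist_norm mult.commute)
    then show ?thesis by (rule lipschitz_on_continuous_on)
  qed
  have m: "ball_average \<epsilon> \<phi> \<in> borel_measurable borel" by (rule borel_measurable_continuous_onI[OF co])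
  show "ball_average \<epsilon> \<phi> \<in> l2 M"
    by (rule l2_bounded[OF finite_M borel_measurable_M[OF m], of \<kappa>]) (use bound in auto)
  note e = ball_average_error[OF c(1) B(1) l(1) \<epsilon> refl G c(2) B(2) l(4) m]
  have "l2norm M (\<lambda>x. ball_average \<epsilon> \<phi> x - \<phi> x) \<le> l2norm lborel (\<lambda>x. ball_average \<epsilon> \<phi> x - \<phi> x)"
    by (rule l2_lborel_imp_M(2)[OF _ e(1)]) (use m in measurable)
  also have "\<dots> \<le> \<epsilon> * l2norm lborel D" by (rule e(2))
  also have "\<dots> \<le> \<epsilon> * C" using Cl(2) \<epsilon> by simp
  finally show "l2norm M (\<lambda>x. ball_average \<epsilon> \<phi> x - \<phi> x) \<le> \<epsilon> * C" .
qed

text \<open>The tolerance fixes the radius, the radius fixes the family of averages, and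
  Arzela-Ascoli extracts a subsequence for this family. The subsequence therefore depends on
  \<open>e\<close>, and a diagonal argument has to follow.\<close>

lemma rellich_step:
  fixes \<phi> :: "nat \<Rightarrow> 'a \<Rightarrow> real"
  assumes t: "\<And>n. test_pair (\<phi> n) (D n)" and C: "\<And>n. l2norm M (\<phi> n) \<le> C" "\<And>n. l2norm M (D n) \<le> C"
    and e: "e > 0"
  shows "\<exists>k. strict_mono (k::nat\<Rightarrow>nat) \<and> (\<exists>N. \<forall>m\<ge>N. \<forall>n\<ge>N. l2norm M (\<lambda>x. \<phi> (k m) x - \<phi> (k n) x) \<le> e)"
proof -
  have C0: "C \<ge> 0" using C(1)[of 0] l2norm_nonneg[of M "\<phi> 0"] by linarith
  \<comment> \<open>Two averaging errors occur, each at most \<open>e / 4\<close> by this choice;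
    adding 1 to \<open>C\<close> avoids division by 0.\<close>
  define \<epsilon> where "\<epsilon> = e / (4 * (C + 1))"
  have \<epsilon>: "\<epsilon> > 0" using e C0 by (simp add: \<epsilon>_def)
  have "4 * (\<epsilon> * C) = e * (C / (C + 1))" using C0 by (simp add: \<epsilon>_def field_simps)
  also have "\<dots> \<le> e * 1" using e C0 by (intro mult_left_mono) auto
  finally have \<epsilon>C: "\<epsilon> * C \<le> e / 4" by simp
  define F where "F n = ball_average \<epsilon> (\<phi> n)" for n
  define \<kappa> where "\<kappa> = C / sqrt (measure lborel (cball (0::'a) \<epsilon>))"
  note T = test_pair_ball_average[OF t C \<epsilon>, folded F_def \<kappa>_def]
  have \<kappa>0: "\<kappa> \<ge> 0" using C0 by (simp add: \<kappa>_def)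
  obtain g k where k: "strict_mono (k::nat\<Rightarrow>nat)"
    "\<And>e. 0 < e \<Longrightarrow> \<exists>N. \<forall>n x. n \<ge> N \<and> x \<in> closure \<Omega> \<longrightarrow> norm (F (k n) x - g x) < e"
  proof (rule Arzela_Ascoli[of "closure \<Omega>" F \<kappa>])
    show "compact (closure \<Omega>)" using bd by simp
    show "norm (F n x) \<le> \<kappa>" for n x using T(1) by simp
    fix x :: 'a and e :: real assume e: "0 < e"
    have "norm (F n x - F n y) < e" if "norm (x - y) < e / (\<kappa> + 1)" for n y
    proof -
      have "norm (F n x - F n y) \<le> norm (x - y) * \<kappa>" using T(2) by simp
      also have "\<dots> \<le> norm (x - y) * (\<kappa> + 1)" by (intro mult_left_mono) auto
      also have "\<dots> < e" using that \<kappa>0 by (simp add: pos_less_divide_eq add_nonneg_pos)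
      finally show ?thesis .
    qed
    moreover have "e / (\<kappa> + 1) > 0" using e \<kappa>0 by (simp add: add_nonneg_pos)
    ultimately show "\<exists>d>0. \<forall>n y. y \<in> closure \<Omega> \<and> norm (x - y) < d \<longrightarrow> norm (F n x - F n y) < e" by blast
  qed blast
  define s where "s = sqrt (measure M (space M))"
  have s0: "s \<ge> 0" by (simp add: s_def)
  \<comment> \<open>Two averages, each within \<open>\<delta>\<close> of \<open>g\<close>, differ by
    at most \<open>2 * \<delta>\<close>; in L^2 this costs \<open>2 * \<delta> * s\<close>, the
    remaining \<open>e / 2\<close>.\<close>
  define \<delta> where "\<delta> = e / (4 * (s + 1))"
  have \<delta>: "\<delta> > 0" using e s0 by (simp add: \<delta>_def)
  have "4 * (\<delta> * s) = e * (s / (s + 1))" using s0 by (simp add: \<delta>_def field_simps)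
  also have "\<dots> \<le> e * 1" using e s0 by (intro mult_left_mono) auto
  finally have \<delta>s: "2 * \<delta> * s \<le> e / 2" by simp
  obtain N where N: "\<And>n x. n \<ge> N \<Longrightarrow> x \<in> closure \<Omega> \<Longrightarrow> norm (F (k n) x - g x) < \<delta>"
    using k(2)[OF \<delta>] by blast
  have "l2norm M (\<lambda>x. \<phi> (k m) x - \<phi> (k n) x) \<le> e" if "m \<ge> N" "n \<ge> N" for m n
  proof -
    have "l2norm M (\<lambda>x. F (k m) x - F (k n) x) \<le> 2 * \<delta> * s"
      unfolding s_def
    proof (rule l2_bound_by_constant[OF finite_M l2_diff[OF T(4) T(4)]])
      fix x assume "x \<in> space M"
      then have "x \<in> closure \<Omega>" using closure_subset[of \<Omega>] by (auto simp: space_restrict_space)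
      then show "norm (F (k m) x - F (k n) x) \<le> 2 * \<delta>"
        using N[OF that(1), of x] N[OF that(2), of x] by simp
    qed (use \<delta> in simp)
    moreover have "l2norm M (\<lambda>x. \<phi> (k m) x - \<phi> (k n) x)
        \<le> l2norm M (\<lambda>x. \<phi> (k m) x - F (k m) x) + l2norm M (\<lambda>x. F (k m) x - \<phi> (k n) x)"
      by (rule l2norm_triangle_diff[OF test_pair_l2(2)[OF t] T(4) test_pair_l2(2)[OF t]])
    moreover have "l2norm M (\<lambda>x. F (k m) x - \<phi> (k n) x)
        \<le> l2norm M (\<lambda>x. F (k m) x - F (k n) x) + l2norm M (\<lambda>x. F (k n) x - \<phi> (k n) x)"
      by (rule l2norm_triangle_diff[OF T(4) T(4) test_pair_l2(2)[OF t]])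
    moreover have "l2norm M (\<lambda>x. \<phi> (k m) x - F (k m) x) \<le> \<epsilon> * C"
      unfolding l2norm_minus_commute[of M "\<phi> (k m)"] by (rule T(5))
    moreover have "l2norm M (\<lambda>x. F (k n) x - \<phi> (k n) x) \<le> \<epsilon> * C" by (rule T(5))
    ultimately show ?thesis using \<epsilon>C \<delta>s by linarith
  qed
  with k(1) show ?thesis by blast
qed

proposition rellich_test_functions:
  fixes \<phi> :: "nat \<Rightarrow> 'a \<Rightarrow> real"
  assumes t: "\<And>n. test_pair (\<phi> n) (D n)" and C: "\<And>n. l2norm M (\<phi> n) \<le> C" "\<And>n. l2norm M (D n) \<le> C"
  obtains k where "strict_mono (k::nat\<Rightarrow>nat)"
    "\<And>e. e > 0 \<Longrightarrow> \<exists>N. \<forall>m\<ge>N. \<forall>n\<ge>N. l2norm M (\<lambda>x. \<phi> (k m) x - \<phi> (k n) x) < e"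
proof -
  \<comment> \<open>\<open>Q i r\<close> says that the subsequence \<open>r\<close> is Cauchy up to
    the tolerance \<open>1 / Suc i\<close>; the diagonal sequence satisfies this for all
    \<open>i\<close>.\<close>
  define Q where "Q i r \<longleftrightarrow> (\<exists>N. \<forall>m\<ge>N. \<forall>n\<ge>N. l2norm M (\<lambda>x. \<phi> (r m) x - \<phi> (r n) x) \<le> 1 / real (Suc i))"
    for i and r :: "nat \<Rightarrow> nat"
  obtain k where k: "strict_mono (k::nat\<Rightarrow>nat)" "\<And>i. Q i (id \<circ> k)"
  proof (rule subsequence_diagonalization_lemma[of Q id])
    show "\<exists>k. strict_mono (k::nat\<Rightarrow>nat) \<and> Q i (r \<circ> k)" for i r
      using rellich_step[of "\<phi> \<circ> r" "D \<circ> r" C "1 / real (Suc i)"] t C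
      by (simp add: Q_def del: of_nat_Suc)
    \<comment> \<open>Diagonalization requires \<open>Q i\<close> to survive passing to a sequence
      whose late members occur at least as late in \<open>k1\<close>; \<open>j \<le> j'\<close>
      keeps the indices beyond \<open>N'\<close>.\<close>
    show "Q i (r \<circ> k2)" if Q1: "Q i (r \<circ> k1)" and kk: "\<And>j. N \<le> j \<Longrightarrow> \<exists>j'. j \<le> j' \<and> k2 j = k1 j'"
      for i and r :: "nat \<Rightarrow> nat" and k1 k2 :: "nat \<Rightarrow> nat" and N
    proof -
      obtain N' where N': "\<And>m n. m \<ge> N' \<Longrightarrow> n \<ge> N' \<Longrightarrow> l2norm M (\<lambda>x. \<phi> (r (k1 m)) x - \<phi> (r (k1 n)) x) \<le> 1 / real (Suc i)"
        using Q1 unfolding Q_def by (auto simp del: of_nat_Suc)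
      show ?thesis unfolding Q_def
      proof (intro exI[of _ "max N N'"] allI impI)
        fix m n assume "max N N' \<le> m" "max N N' \<le> n"
        moreover obtain m' n' where "m \<le> m'" "k2 m = k1 m'" "n \<le> n'" "k2 n = k1 n'"
          using kk calculation by (meson max.boundedE)
        ultimately show "l2norm M (\<lambda>x. \<phi> ((r \<circ> k2) m) x - \<phi> ((r \<circ> k2) n) x) \<le> 1 / real (Suc i)"
          using N'[of m' n'] by (simp del: of_nat_Suc)
      qed
    qed
  qed blast
  show ?thesis
  proof (rule that[OF k(1)])
    fix e :: real assume "e > 0"
    then obtain i where i: "1 / real (Suc i) < e" using reals_Archimedean[of e] by (auto simp: inverse_eq_divide)
    then show "\<exists>N. \<forall>m\<ge>N. \<forall>n\<ge>N. l2norm M (\<lambda>x. \<phi> (k m) x - \<phi> (k n) x) < e"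
      using k(2)[of i] unfolding Q_def comp_def id_def by (meson order_le_less_trans)
  qed
qed

text \<open>Each \<open>u n\<close> is replaced by a test function within \<open>1 / Suc n\<close>
  in both components. This costs 1 in the bounds, and along any subsequence the replacement error
  tends to 0.\<close>

proposition rellich:
  fixes u :: "nat \<Rightarrow> 'a \<Rightarrow> real"
  assumes g: "\<And>n. grad0 (u n) (G n)" and C: "\<And>n. l2norm M (u n) \<le> C" "\<And>n. l2norm M (G n) \<le> C"
  obtains k where "strict_mono (k::nat\<Rightarrow>nat)"
    "\<And>e. e > 0 \<Longrightarrow> \<exists>N. \<forall>m\<ge>N. \<forall>n\<ge>N. l2norm M (\<lambda>x. u (k m) x - u (k n) x) < e"
proof -
  have "\<exists>p. test_pair (fst p) (snd p) \<and> l2norm M (\<lambda>x. u n x - fst p x) < 1 / real (Suc n)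
      \<and> l2norm M (\<lambda>x. G n x - snd p x) < 1 / real (Suc n)" for n
    using g[of n] unfolding grad0_def by (simp del: of_nat_Suc)
  then have "\<forall>n. \<exists>p. test_pair (fst p) (snd p) \<and> l2norm M (\<lambda>x. u n x - fst p x) < 1 / real (Suc n)
      \<and> l2norm M (\<lambda>x. G n x - snd p x) < 1 / real (Suc n)" by blast
  from choice[OF this] obtain p where p: "\<And>n. test_pair (fst (p n)) (snd (p n))"
    "\<And>n. l2norm M (\<lambda>x. u n x - fst (p n) x) < 1 / real (Suc n)"
    "\<And>n. l2norm M (\<lambda>x. G n x - snd (p n) x) < 1 / real (Suc n)" by blast
  define \<phi> where "\<phi> n = fst (p n)" for n
  define D where "D n = snd (p n)" for n
  note p' = p[folded \<phi>_def D_def]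
  note lu = grad0_l2[OF g] and lp = test_pair_l2[OF p'(1)]
  have one: "1 / real (Suc n) \<le> 1" for n by simp
  have b: "l2norm M (\<phi> n) \<le> C + 1" "l2norm M (D n) \<le> C + 1" for n
    using l2norm_triangle_abs[OF lu(1)[of n] lp(2)[of n]] C(1)[of n] p'(2)[of n]
      l2norm_triangle_abs[OF lu(2)[of n] lp(5)[of n]] C(2)[of n] p'(3)[of n] one[of n] by linarith+
  obtain k where k: "strict_mono (k::nat\<Rightarrow>nat)"
    "\<And>e. e > 0 \<Longrightarrow> \<exists>N. \<forall>m\<ge>N. \<forall>n\<ge>N. l2norm M (\<lambda>x. \<phi> (k m) x - \<phi> (k n) x) < e"
    by (rule rellich_test_functions[OF p'(1) b]) (rule that; assumption)
  show ?thesis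
  proof (rule that[OF k(1)])
    fix e :: real assume e: "e > 0"
    then obtain N where N: "\<And>m n. m \<ge> N \<Longrightarrow> n \<ge> N \<Longrightarrow> l2norm M (\<lambda>x. \<phi> (k m) x - \<phi> (k n) x) < e / 3"
      using k(2)[of "e / 3"] by auto
    obtain N' where N': "1 / real (Suc N') < e / 3"
      using reals_Archimedean[of "e / 3"] e by (auto simp: inverse_eq_divide)
    have close: "l2norm M (\<lambda>x. u (k n) x - \<phi> (k n) x) < e / 3" if "n \<ge> N'" for n
    proof -
      have "N' \<le> k n" using seq_suble[OF k(1), of n] that by simp
      then have "1 / real (Suc (k n)) \<le> 1 / real (Suc N')" by (intro divide_left_mono) auto
      then show ?thesis using p'(2)[of "k n"] N' by linarith
    qed
    have "l2norm M (\<lambda>x. u (k m) x - u (k n) x) < e" if "m \<ge> max N N'" "n \<ge> max N N'" for m n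
      using l2norm_triangle_diff[OF lu(1)[of "k m"] lp(2)[of "k m"] lu(1)[of "k n"]]
        l2norm_triangle_diff[OF lp(2)[of "k m"] lp(2)[of "k n"] lu(1)[of "k n"]]
        N[of m n] close[of m] close[of n] that
      unfolding l2norm_minus_commute[of M "\<phi> (k n)" "u (k n)"] by simp
    then show "\<exists>N. \<forall>m\<ge>N. \<forall>n\<ge>N. l2norm M (\<lambda>x. u (k m) x - u (k n) x) < e" by blast
  qed
qed

end

section \<open>Existence of a minimizer\<close>

text \<open>Away from 0 this is the power rule on either side. At 0 the difference quotient is at
  most \<open>\<bar>h\<bar>\<close>, because
  \<open>\<bar>h\<bar> powr p \<le> \<bar>h\<bar> powr 2\<close> for
  \<open>\<bar>h\<bar> < 1\<close>.\<close>

lemma DERIV_abs_powr: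
  fixes p :: real
  assumes "2 \<le> p"
  shows "((\<lambda>x. \<bar>x\<bar> powr p) has_real_derivative p * (\<bar>x\<bar> powr (p - 2) * x)) (at x)"
proof -
  have pw: "y powr (p - 1) = y powr (p - 2) * y" if "y > 0" for y :: real
  proof -
    have "y powr (p - 2 + 1) = y powr (p - 2) * y powr 1" by (rule powr_add)
    then show ?thesis using that by simp
  qed
  consider "x > 0" | "x < 0" | "x = 0" by linarith
  then show ?thesis
  proof cases
    case 1
    have "((\<lambda>x. x powr p) has_real_derivative p * x powr (p - 1)) (at x)"
      by (rule has_real_derivative_powr[OF 1])
    then have "((\<lambda>x. \<bar>x\<bar> powr p) has_real_derivative p * x powr (p - 1)) (at x)"
      by (rule has_field_derivative_transform_within_open[of _ _ _ "{0<..}"]) (use 1 in auto)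
    then show ?thesis using 1 pw[of x] by simp
  next
    case 2
    have "((\<lambda>x. (- x) powr p) has_real_derivative p * (- x) powr (p - 1) * - 1) (at x)"
      by (rule DERIV_chain2[OF has_real_derivative_powr]) (use 2 in \<open>auto intro!: derivative_eq_intros\<close>)
    then have "((\<lambda>x. \<bar>x\<bar> powr p) has_real_derivative p * (- x) powr (p - 1) * - 1) (at x)"
      by (rule has_field_derivative_transform_within_open[of _ _ _ "{..<0}"]) (use 2 in auto)
    then show ?thesis using 2 pw[of "- x"] by simp
  next
    case 3
    have "((\<lambda>h. \<bar>h\<bar> powr p / h) \<longlongrightarrow> 0) (at (0::real))"
    proof (rule Lim_null_comparison)
      show "\<forall>\<^sub>F h in at (0::real). norm (\<bar>h\<bar> powr p / h) \<le> \<bar>h\<bar>"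
        unfolding eventually_at
      proof (intro exI[of _ "1::real"] conjI ballI impI)
        fix h :: real assume h: "h \<noteq> 0 \<and> dist h 0 < 1"
        then have "\<bar>h\<bar> powr p \<le> \<bar>h\<bar> powr 2" using assms by (intro powr_mono') auto
        then have "\<bar>h\<bar> powr p \<le> \<bar>h\<bar> * \<bar>h\<bar>" by (simp add: power2_eq_square)
        then show "norm (\<bar>h\<bar> powr p / h) \<le> \<bar>h\<bar>" using h by (simp add: pos_divide_le_eq)
      qed simp
      show "((\<lambda>h. \<bar>h\<bar>) \<longlongrightarrow> 0) (at (0::real))" by (rule tendsto_rabs_zero) simp
    qed
    then show ?thesis using 3 by (simp add: DERIV_def)
  qed
qed

lemma convex_abs_powr:
  fixes p :: real
  assumes "2 \<le> p"
  shows "convex_on UNIV (\<lambda>x::real. \<bar>x\<bar> powr p)"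
proof (rule convex_on_realI[OF _ DERIV_abs_powr[OF assms]])
  fix x y :: real assume xy: "x \<le> y"
  have m: "a powr (p - 2) * a \<le> b powr (p - 2) * b" if "0 \<le> a" "a \<le> b" for a b :: real
    using assms that by (intro mult_mono powr_mono2) auto
  consider "0 \<le> x" | "x < 0" "0 \<le> y" | "y < 0" by linarith
  then have "\<bar>x\<bar> powr (p - 2) * x \<le> \<bar>y\<bar> powr (p - 2) * y"
  proof cases
    case 1
    then show ?thesis using m[of x y] xy by simp
  next
    case 2
    then have "\<bar>x\<bar> powr (p - 2) * x \<le> 0" "0 \<le> \<bar>y\<bar> powr (p - 2) * y"
      by (auto intro: mult_nonneg_nonpos)
    then show ?thesis by linarith
  next
    case 3
    then show ?thesis using m[of "- y" "- x"] xy by simp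
  qed
  then show "p * (\<bar>x\<bar> powr (p - 2) * x) \<le> p * (\<bar>y\<bar> powr (p - 2) * y)"
    using assms by (intro mult_left_mono) auto
qed simp

lemma abs_powr_midpoint:
  fixes p :: real
  assumes "2 \<le> p"
  shows "\<bar>x / 2 + y / 2\<bar> powr p \<le> \<bar>x\<bar> powr p / 2 + \<bar>y\<bar> powr p / 2"
  using convex_onD[OF convex_abs_powr[OF assms], of "1/2" x y] by simp

section \<open>The energy on the unit sphere of L^2\<close>

locale ground_state_problem = bounded_open \<Omega> for \<Omega> :: "'a::euclidean_space set" +
  fixes p :: real
  assumes p: "2 \<le> p" and ne: "\<Omega> \<noteq> {}"
begin

abbreviation "pint u \<equiv> (LINT x|M. \<bar>u x\<bar> powr p)"

lemma Lp_iff: "u \<in> Lp p \<Omega> \<longleftrightarrow> u \<in> borel_measurable M \<and> integrable M (\<lambda>x. \<bar>u x\<bar> powr p)"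
  by (simp add: Lp_def)

lemma Lp_cmult: "(u :: 'a \<Rightarrow> real) \<in> Lp p \<Omega> \<Longrightarrow> (\<lambda>x. c * u x) \<in> Lp p \<Omega>"
  by (auto simp: Lp_iff abs_mult powr_mult)

lemma pint_cmult: "pint (\<lambda>x. c * u x) = \<bar>c\<bar> powr p * pint u"
  by (simp add: abs_mult powr_mult)

text \<open>Convexity of the integrand replaces Minkowski's inequality: it gives membership of the
  midpoint and the bound needed for uniform convexity. Sums are then doubled midpoints.\<close>

lemma Lp_midpoint:
  assumes "u \<in> Lp p \<Omega>" "v \<in> Lp p \<Omega>"
  shows "(\<lambda>x. u x / 2 + v x / 2) \<in> Lp p \<Omega>" "pint (\<lambda>x. u x / 2 + v x / 2) \<le> pint u / 2 + pint v / 2"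
proof -
  have [measurable]: "u \<in> borel_measurable M" "v \<in> borel_measurable M" using assms by (auto simp: Lp_iff)
  have i: "integrable M (\<lambda>x. \<bar>u x\<bar> powr p / 2 + \<bar>v x\<bar> powr p / 2)" using assms by (auto simp: Lp_iff)
  have "integrable M (\<lambda>x. \<bar>u x / 2 + v x / 2\<bar> powr p)"
    by (rule Bochner_Integration.integrable_bound[OF i]) (use abs_powr_midpoint[OF p] in auto)
  then show l: "(\<lambda>x. u x / 2 + v x / 2) \<in> Lp p \<Omega>" by (simp add: Lp_iff)
  have "pint (\<lambda>x. u x / 2 + v x / 2) \<le> (LINT x|M. \<bar>u x\<bar> powr p / 2 + \<bar>v x\<bar> powr p / 2)"
    using l i abs_powr_midpoint[OF p] by (intro integral_mono) (auto simp: Lp_iff)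
  also have "\<dots> = pint u / 2 + pint v / 2" using assms by (simp add: Lp_iff)
  finally show "pint (\<lambda>x. u x / 2 + v x / 2) \<le> pint u / 2 + pint v / 2" .
qed

lemma Lp_add:
  fixes u v :: "'a \<Rightarrow> real"
  assumes "u \<in> Lp p \<Omega>" "v \<in> Lp p \<Omega>"
  shows "(\<lambda>x. u x + v x) \<in> Lp p \<Omega>"
  using Lp_cmult[OF Lp_midpoint(1)[OF assms], of 2] by (simp add: algebra_simps)

lemma energy_eq:
  assumes "grad0 u G"
  shows "energy p \<Omega> u = (l2norm M G)\<^sup>2 / 2 + pint u / p"
  using grad0_weak_gradient(3)[OF assms] by (simp add: energy_def flip: l2norm_power2)

definition admissible :: "('a \<Rightarrow> real) \<Rightarrow> bool" where
  "admissible u \<longleftrightarrow> u \<in> Lp p \<Omega> \<inter> H01 \<Omega> \<and> Lp_norm 2 \<Omega> u = 1"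

text \<open>The two parts of the energy scale with different degrees. The formula serves the
  midpoints in the compactness argument and the variations in the Euler-Lagrange equation.\<close>

lemma admissible_normalize:
  assumes "u \<in> Lp p \<Omega>" "grad0 u G" "l2norm M u > 0"
  shows "admissible (\<lambda>x. (1 / l2norm M u) * u x)"
    "energy p \<Omega> (\<lambda>x. (1 / l2norm M u) * u x)
       = (l2norm M G)\<^sup>2 / (2 * (l2norm M u)\<^sup>2) + pint u / (p * l2norm M u powr p)"
proof -
  let ?c = "1 / l2norm M u"
  have g: "grad0 (\<lambda>x. ?c * u x) (\<lambda>x. ?c *\<^sub>R G x)" by (rule grad0_cmult[OF assms(2)])
  have "l2norm M (\<lambda>x. ?c * u x) = 1"
    using l2norm_scaleR[of M ?c u] assms(3) by simp
  then show "admissible (\<lambda>x. ?c * u x)"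
    unfolding admissible_def Lp_norm_2_eq_l2norm using Lp_cmult[OF assms(1)] H01_iff_grad0 g by blast
  have "energy p \<Omega> (\<lambda>x. ?c * u x) = (\<bar>?c\<bar> * l2norm M G)\<^sup>2 / 2 + \<bar>?c\<bar> powr p * pint u / p"
    unfolding energy_eq[OF g] l2norm_scaleR pint_cmult ..
  also have "\<bar>?c\<bar> powr p = 1 / l2norm M u powr p"
    using assms(3) by (simp add: powr_divide)
  also have "(\<bar>?c\<bar> * l2norm M G)\<^sup>2 / 2 + 1 / l2norm M u powr p * pint u / p
      = (l2norm M G)\<^sup>2 / (2 * (l2norm M u)\<^sup>2) + pint u / (p * l2norm M u powr p)"
    by (simp add: power_divide power_mult_distrib field_simps)
  finally show "energy p \<Omega> (\<lambda>x. ?c * u x)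
       = (l2norm M G)\<^sup>2 / (2 * (l2norm M u)\<^sup>2) + pint u / (p * l2norm M u powr p)" .
qed

text \<open>A normalized bump on some box in \<open>\<Omega>\<close>; its norm is positive because
  the bump vanishes nowhere in the open box. This makes the infimum below meaningful.\<close>

lemma admissible_exists: "\<exists>u. admissible u"
proof -
  obtain x where x: "x \<in> \<Omega>" using ne by blast
  obtain a b where ab: "cbox a b \<subseteq> \<Omega>" "\<forall>i\<in>Basis. a \<bullet> i < b \<bullet> i"
    using open_contains_cbox[OF op x] by metis
  let ?\<phi> = "box_bump 0 a b"
  obtain D where D: "test_pair ?\<phi> D" using test_pair_exists[OF box_bump_test[OF ab(1)]] by blast
  note l = test_pair_l2[OF D]
  have "l2norm lborel ?\<phi> \<noteq> 0"
  proof
    assume "l2norm lborel ?\<phi> = 0"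
    then have "(LINT x|lborel. (norm (?\<phi> x))\<^sup>2) = 0" by (simp add: l2norm_def)
    then have "AE x in lborel. (norm (?\<phi> x))\<^sup>2 = 0"
      using integral_nonneg_eq_0_iff_AE[OF l2_integrable[OF l(1)]] by simp
    then have "AE x in lborel. x \<notin> box a b" by (simp add: box_bump_eq_0_iff)
    then have "emeasure lborel (box a b) = 0"
      using AE_iff_null_sets[of "box a b" lborel] by (auto simp: null_sets_def)
    moreover have "emeasure lborel (box a b) = ennreal (\<Prod>i\<in>Basis. (b - a) \<bullet> i)"
      using ab(2) by (intro emeasure_lborel_box) (auto intro: less_imp_le)
    moreover have "(\<Prod>i\<in>Basis. (b - a) \<bullet> i) > 0"
      using ab(2) by (intro prod_pos) (auto simp: inner_diff_left)
    ultimately show False by (metis ennreal_eq_0_iff not_less)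
  qed
  then have pos: "l2norm M ?\<phi> > 0" using l(3) l2norm_nonneg[of M ?\<phi>] by simp
  have "integrable M (\<lambda>x. \<bar>?\<phi> x\<bar> powr p)"
  proof (rule Bochner_Integration.integrable_bound)
    show "integrable M (\<lambda>x. 1::real)" by (rule finite_measure.integrable_const[OF finite_M])
    have "\<bar>?\<phi> x\<bar> powr p \<le> 1" for x
      using box_bump_bounds[of 0 a b x] p powr_mono2[of p "?\<phi> x" 1] by simp
    then show "AE x in M. norm (\<bar>?\<phi> x\<bar> powr p) \<le> norm (1::real)" by simp
  qed (use l(2) in \<open>auto simp: l2_def\<close>)
  then have "?\<phi> \<in> Lp p \<Omega>" using l(2) by (simp add: Lp_iff l2_def)
  from admissible_normalize(1)[OF this grad0_test[OF D] pos] show ?thesis by blast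
qed

lemma admissible_grad0:
  assumes "admissible u"
  obtains G where "grad0 u G" "u \<in> Lp p \<Omega>" "l2norm M u = 1"
  using assms H01_iff_grad0 unfolding admissible_def Lp_norm_2_eq_l2norm by auto

lemma energy_nonneg: "0 \<le> energy p \<Omega> u"
  using p unfolding energy_def by (intro add_nonneg_nonneg mult_nonneg_nonneg Bochner_Integration.integral_nonneg) auto

definition inf_energy :: real where
  "inf_energy = Inf (energy p \<Omega> ` {u. admissible u})"

lemma inf_energy_le: "admissible u \<Longrightarrow> inf_energy \<le> energy p \<Omega> u"
  unfolding inf_energy_def using energy_nonneg by (intro cInf_lower bdd_belowI[of _ 0]) auto

lemma inf_energy_nonneg: "0 \<le> inf_energy"
  unfolding inf_energy_def using admissible_exists energy_nonneg by (intro cInf_greatest) auto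

lemma inf_energy_approx: "e > 0 \<Longrightarrow> \<exists>u. admissible u \<and> energy p \<Omega> u < inf_energy + e"
  unfolding inf_energy_def
  using cInf_lessD[of "energy p \<Omega> ` {u. admissible u}" "inf_energy + e"] admissible_exists
  by (auto simp: inf_energy_def)

text \<open>
  Uniform convexity of the Dirichlet term: the gradients of two almost minimizing functions are
  close if the functions are, because the midpoint has almost unit norm and thus cannot have
  small energy.
\<close>

lemma gradient_distance:
  assumes u: "u \<in> Lp p \<Omega>" "grad0 u G" "l2norm M u = 1" "energy p \<Omega> u \<le> inf_energy + e"
    and v: "v \<in> Lp p \<Omega>" "grad0 v H" "l2norm M v = 1" "energy p \<Omega> v \<le> inf_energy + e"
    and d: "l2norm M (\<lambda>x. u x - v x) \<le> d" "d \<le> 1"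
  shows "(l2norm M (\<lambda>x. G x - H x))\<^sup>2 \<le> 8 * (e + inf_energy * (1 - (1 - d / 2) powr p))"
proof -
  define w where "w = (\<lambda>x. u x / 2 + v x / 2)"
  define K where "K = (\<lambda>x. (1 / 2) *\<^sub>R G x + (1 / 2) *\<^sub>R H x)"
  note lu = grad0_l2[OF u(2)] and lv = grad0_l2[OF v(2)]
  have gw: "grad0 w K"
    using grad0_add[OF grad0_cmult[OF u(2), of "1/2"] grad0_cmult[OF v(2), of "1/2"]]
    by (simp add: w_def K_def)
  have pw: "w \<in> Lp p \<Omega>" "pint w \<le> pint u / 2 + pint v / 2"
    unfolding w_def using Lp_midpoint[OF u(1) v(1)] by auto
  define s where "s = l2norm M w"
  have d0: "0 \<le> d" using d(1) l2norm_nonneg order_trans by blast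
  have hv: "(\<lambda>x. (1 / 2) *\<^sub>R (u x - v x)) \<in> l2 M" by (rule l2_scaleR[OF l2_diff[OF lu(1) lv(1)]])
  have "(\<lambda>x. v x - w x) = (\<lambda>x. (- 1 / 2) *\<^sub>R (u x - v x))" by (auto simp: w_def field_simps)
  then have "l2norm M (\<lambda>x. v x - w x) = \<bar>- 1 / 2\<bar> * l2norm M (\<lambda>x. u x - v x)"
    by (simp only: l2norm_scaleR)
  then have "l2norm M (\<lambda>x. v x - w x) \<le> d / 2" using d(1) by simp
  then have s1: "1 - d / 2 \<le> s"
    using l2norm_triangle_abs[OF lv(1) grad0_l2(1)[OF gw]] v(3) by (simp add: s_def)
  have s2: "s \<le> 1"
  proof -
    have "s \<le> l2norm M (\<lambda>x. (1 / 2) *\<^sub>R u x) + l2norm M (\<lambda>x. (1 / 2) *\<^sub>R v x)"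
      using l2norm_triangle[OF l2_scaleR[OF lu(1), of "1/2"] l2_scaleR[OF lv(1), of "1/2"]]
      by (simp add: s_def w_def)
    then show ?thesis unfolding l2norm_scaleR using u(3) v(3) by simp
  qed
  have s0: "s > 0" using s1 d(2) by linarith
  have "inf_energy \<le> (l2norm M K)\<^sup>2 / (2 * s\<^sup>2) + pint w / (p * s powr p)"
    using inf_energy_le[OF admissible_normalize(1)[OF pw(1) gw]] admissible_normalize(2)[OF pw(1) gw] s0
    by (simp add: s_def)
  \<comment> \<open>Since \<open>s \<le> 1\<close> and \<open>p \<ge> 2\<close>, the smaller factor
    \<open>s powr p\<close> may stand in both denominators, which assembles the energy of
    \<open>w\<close> again.\<close>
  also have "\<dots> \<le> (l2norm M K)\<^sup>2 / (2 * s powr p) + pint w / (p * s powr p)"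
  proof -
    have "s powr p \<le> s powr 2" using s0 s2 p by (intro powr_mono') auto
    then show ?thesis using s0 by (intro add_right_mono divide_left_mono) auto
  qed
  also have "\<dots> = energy p \<Omega> w / s powr p"
    unfolding energy_eq[OF gw] by (simp add: add_divide_distrib)
  finally have 1: "inf_energy * s powr p \<le> energy p \<Omega> w"
    using s0 by (simp add: pos_le_divide_eq)
  have 2: "inf_energy * (1 - d / 2) powr p \<le> inf_energy * s powr p"
    using s1 d(2) p inf_energy_nonneg by (intro mult_left_mono powr_mono2) auto
  \<comment> \<open>The parallelogram identity for the gradients.\<close>
  have 3: "(l2norm M K)\<^sup>2 = (l2norm M G)\<^sup>2 / 2 + (l2norm M H)\<^sup>2 / 2 - (l2norm M (\<lambda>x. G x - H x))\<^sup>2 / 4"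
  proof -
    have mH: "(\<lambda>x. (- 1) *\<^sub>R H x) \<in> l2 M" by (rule l2_scaleR[OF lv(2)])
    have "(l2norm M (\<lambda>x. G x + H x))\<^sup>2 = (l2norm M G)\<^sup>2 + 2 * (LINT x|M. G x \<bullet> H x) + (l2norm M H)\<^sup>2"
      by (rule l2norm_add_power2[OF lu(2) lv(2)])
    moreover have "(l2norm M (\<lambda>x. G x - H x))\<^sup>2 = (l2norm M G)\<^sup>2 - 2 * (LINT x|M. G x \<bullet> H x) + (l2norm M H)\<^sup>2"
      using l2norm_add_power2[OF lu(2) mH] l2norm_scaleR[of M "- 1" H] by simp
    moreover have "K = (\<lambda>x. (1 / 2) *\<^sub>R (G x + H x))" by (simp add: K_def scaleR_add_right)
    then have "(l2norm M K)\<^sup>2 = (l2norm M (\<lambda>x. G x + H x))\<^sup>2 / 4"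
      by (simp only: l2norm_scaleR) (simp add: power_mult_distrib power_divide)
    ultimately show ?thesis by linarith
  qed
  have 4: "pint w / p \<le> (pint u / p + pint v / p) / 2"
    using divide_right_mono[OF pw(2), of p] p by (simp add: add_divide_distrib mult.commute)
  \<comment> \<open>The rest is linear in the abbreviated quantities: \<open>\<tau>\<close> is
    \<open>(1 - d / 2) powr p\<close> and \<open>\<Delta>\<close> the squared gradient distance. The
    8 is 4 from the parallelogram identity times 2 from the factor 1/2 in the energy.\<close>
  have "\<Delta> \<le> 8 * (e + I * (1 - \<tau>))"
    if "I * \<tau> \<le> k / 2 + w'" "k = g / 2 + h / 2 - \<Delta> / 4" "w' \<le> (a + b) / 2" "g / 2 + a \<le> I + e" "h / 2 + b \<le> I + e"
    for \<Delta> I \<tau> k w' g h a b :: real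
  proof -
    have "I * (1 - \<tau>) = I - I * \<tau>" by (simp add: algebra_simps)
    with that show ?thesis by argo
  qed
  from this[OF order_trans[OF 2 1[unfolded energy_eq[OF gw]]] 3 4
      u(4)[unfolded energy_eq[OF u(2)]] v(4)[unfolded energy_eq[OF v(2)]]]
  show ?thesis .
qed

lemma minimizing_sequence:
  obtains u G where "\<And>n. u n \<in> Lp p \<Omega>" "\<And>n. grad0 (u n) (G n)" "\<And>n. l2norm M (u n) = 1"
    "\<And>n. energy p \<Omega> (u n) \<le> inf_energy + 1 / real (Suc n)"
    "\<And>e. e > 0 \<Longrightarrow> \<exists>N. \<forall>m\<ge>N. \<forall>n\<ge>N. l2norm M (\<lambda>x. u m x - u n x) < e"
proof -
  have "\<exists>q. fst q \<in> Lp p \<Omega> \<and> grad0 (fst q) (snd q) \<and> l2norm M (fst q) = 1 \<and>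
      energy p \<Omega> (fst q) \<le> inf_energy + 1 / real (Suc n)" for n
  proof -
    obtain u where u: "admissible u" "energy p \<Omega> u < inf_energy + 1 / real (Suc n)"
      using inf_energy_approx[of "1 / real (Suc n)"] by auto
    obtain G where "grad0 u G" "u \<in> Lp p \<Omega>" "l2norm M u = 1" by (rule admissible_grad0[OF u(1)])
    with u(2) show ?thesis by (intro exI[of _ "(u, G)"]) auto
  qed
  then have "\<forall>n. \<exists>q. fst q \<in> Lp p \<Omega> \<and> grad0 (fst q) (snd q) \<and> l2norm M (fst q) = 1 \<and>
      energy p \<Omega> (fst q) \<le> inf_energy + 1 / real (Suc n)" by blast
  from choice[OF this] obtain q where q: "\<And>n. fst (q n) \<in> Lp p \<Omega>" "\<And>n. grad0 (fst (q n)) (snd (q n))"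
    "\<And>n. l2norm M (fst (q n)) = 1" "\<And>n. energy p \<Omega> (fst (q n)) \<le> inf_energy + 1 / real (Suc n)" by blast
  \<comment> \<open>The squared gradient norm is at most \<open>2 * (inf_energy + 1)\<close>, and a
    number is at most 1 plus its square; \<open>C\<close> also dominates the unit norm of the
    functions.\<close>
  define C where "C = 1 + 2 * (inf_energy + 1)"
  have C1: "l2norm M (fst (q n)) \<le> C" for n using q(3) inf_energy_nonneg by (simp add: C_def)
  have C2: "l2norm M (snd (q n)) \<le> C" for n
  proof -
    have "1 / real (Suc n) \<le> 1" by simp
    then have "energy p \<Omega> (fst (q n)) \<le> inf_energy + 1" using q(4)[of n] by linarith
    moreover have "0 \<le> pint (fst (q n)) / p" using p by simp
    ultimately have "(l2norm M (snd (q n)))\<^sup>2 \<le> 2 * (inf_energy + 1)"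
      unfolding energy_eq[OF q(2)] by simp
    moreover have "l2norm M (snd (q n)) \<le> 1 + (l2norm M (snd (q n)))\<^sup>2"
      using sum_squares_bound[of "l2norm M (snd (q n))" 1] l2norm_nonneg[of M "snd (q n)"]
      unfolding power_one by linarith
    ultimately show ?thesis by (simp add: C_def)
  qed
  obtain k where k: "strict_mono (k::nat\<Rightarrow>nat)"
    "\<And>e. e > 0 \<Longrightarrow> \<exists>N. \<forall>m\<ge>N. \<forall>n\<ge>N. l2norm M (\<lambda>x. fst (q (k m)) x - fst (q (k n)) x) < e"
    by (rule rellich[OF q(2) C1 C2]) (rule that; assumption)
  show ?thesis
  proof (rule that[of "\<lambda>n. fst (q (k n))" "\<lambda>n. snd (q (k n))"])
    show "energy p \<Omega> (fst (q (k n))) \<le> inf_energy + 1 / real (Suc n)" for n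
    proof -
      \<comment> \<open>Since \<open>n \<le> k n\<close>, the rate of approach to the infimum
        survives the passage to the subsequence.\<close>
      have "1 / real (Suc (k n)) \<le> 1 / real (Suc n)"
        using seq_suble[OF k(1), of n] by (intro divide_left_mono) auto
      then show ?thesis using q(4)[of "k n"] by linarith
    qed
  qed (use q k in auto)
qed

text \<open>As functions and gradients both converge strongly, closedness of \<open>grad0\<close>
  identifies the limit of the gradients as a gradient of the limit. The Dirichlet part then
  converges exactly, which leaves a sharp upper bound for the L^p part.\<close>

proposition minimizer_exists:
  obtains U where "admissible U" "energy p \<Omega> U = inf_energy"
proof -
  obtain u G where u: "\<And>n. u n \<in> Lp p \<Omega>" "\<And>n. grad0 (u n) (G n)" "\<And>n. l2norm M (u n) = 1"
    "\<And>n. energy p \<Omega> (u n) \<le> inf_energy + 1 / real (Suc n)"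
    "\<And>e. e > 0 \<Longrightarrow> \<exists>N. \<forall>m\<ge>N. \<forall>n\<ge>N. l2norm M (\<lambda>x. u m x - u n x) < e"
    by (rule minimizing_sequence) (rule that; assumption)
  note l = grad0_l2[OF u(2)]
  obtain U r where U: "U \<in> l2 M" "strict_mono (r::nat\<Rightarrow>nat)" "AE x in M. (\<lambda>i. u (r i) x) \<longlonglongrightarrow> U x"
    "(\<lambda>n. l2norm M (\<lambda>x. u n x - U x)) \<longlonglongrightarrow> 0"
    by (rule l2_complete[OF finite_M l(1) u(5)]) (assumption, (rule that; assumption))
  have Gc: "\<exists>N. \<forall>m\<ge>N. \<forall>n\<ge>N. l2norm M (\<lambda>x. G m x - G n x) < e" if e: "e > 0" for e
  proof -
    \<comment> \<open>The bound of \<open>gradient_distance\<close> is split in halves: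
      \<open>d\<close> makes the defect term less than \<open>e\<^sup>2 / 2\<close>, and energies
      within \<open>e\<^sup>2 / 16\<close> of the infimum contribute the other half.\<close>
    have "((\<lambda>d. (1 - d / 2) powr p) \<longlongrightarrow> (1 - 0 / 2) powr p) (at_right 0)"
      by (intro tendsto_intros) auto
    then have "((\<lambda>d. 8 * (inf_energy * (1 - (1 - d / 2) powr p))) \<longlongrightarrow> 8 * (inf_energy * (1 - 1))) (at_right 0)"
      by (intro tendsto_intros) simp
    then have "\<forall>\<^sub>F d in at_right 0. 8 * (inf_energy * (1 - (1 - d / 2) powr p)) < e\<^sup>2 / 2"
      by (rule order_tendstoD(2)) (use e in simp)
    moreover have "\<forall>\<^sub>F d in at_right (0::real). 0 < d \<and> d < 1"
      using eventually_at_right_real[of 0 1] by simp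
    ultimately have "\<forall>\<^sub>F d in at_right (0::real).
        8 * (inf_energy * (1 - (1 - d / 2) powr p)) < e\<^sup>2 / 2 \<and> 0 < d \<and> d < 1"
      by eventually_elim auto
    then obtain d where d: "8 * (inf_energy * (1 - (1 - d / 2) powr p)) < e\<^sup>2 / 2" "0 < d" "d < 1"
      using eventually_happens'[OF trivial_limit_at_right_real] by blast
    obtain N where N: "\<And>m n. m \<ge> N \<Longrightarrow> n \<ge> N \<Longrightarrow> l2norm M (\<lambda>x. u m x - u n x) < d"
      using u(5)[OF d(2)] by blast
    obtain N' where N': "1 / real (Suc N') < e\<^sup>2 / 16"
      using reals_Archimedean[of "e\<^sup>2 / 16"] e by (auto simp: inverse_eq_divide)
    have en: "energy p \<Omega> (u n) \<le> inf_energy + e\<^sup>2 / 16" if "n \<ge> N'" for n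
    proof -
      have "1 / real (Suc n) \<le> 1 / real (Suc N')" using that by (intro divide_left_mono) auto
      then show ?thesis using u(4)[of n] N' by linarith
    qed
    have "l2norm M (\<lambda>x. G m x - G n x) < e" if mn: "m \<ge> max N N'" "n \<ge> max N N'" for m n
    proof -
      have mn': "m \<ge> N" "m \<ge> N'" "n \<ge> N" "n \<ge> N'" using mn by auto
      have "(l2norm M (\<lambda>x. G m x - G n x))\<^sup>2 \<le> 8 * (e\<^sup>2 / 16 + inf_energy * (1 - (1 - d / 2) powr p))"
        using d(3) N[OF mn'(1,3)]
        by (intro gradient_distance[OF u(1-3) en[OF mn'(2)] u(1-3) en[OF mn'(4)]]) auto
      also have "\<dots> < e\<^sup>2" using d(1) by (simp add: algebra_simps)
      finally show ?thesis using e by (intro power_less_imp_less_base[of _ 2 e]) auto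
    qed
    then show ?thesis by blast
  qed
  obtain H r' where H: "H \<in> l2 M" "strict_mono (r'::nat\<Rightarrow>nat)" "AE x in M. (\<lambda>i. G (r' i) x) \<longlonglongrightarrow> H x"
    "(\<lambda>n. l2norm M (\<lambda>x. G n x - H x)) \<longlonglongrightarrow> 0"
    by (rule l2_complete[OF finite_M l(2) Gc]) (assumption, (rule that; assumption))
  have g: "grad0 U H" by (rule grad0_closed[OF u(2) U(1) H(1) U(4) H(4)])
  have U1: "l2norm M U = 1"
    using l2_tendsto_imp_l2norm_tendsto[OF l(1) U(1) U(4)] u(3) by (simp add: LIMSEQ_const_iff)
  \<comment> \<open>What the infimum leaves for the L^p part once the limit of the Dirichlet part is
    subtracted.\<close>
  define b where "b = p * (inf_energy - (l2norm M H)\<^sup>2 / 2)"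
  have bnd: "U \<in> Lp p \<Omega> \<and> pint U \<le> b + e" if e: "e > 0" for e
  proof -
    have "(\<lambda>n. p * (inf_energy + 1 / real (Suc n) - (l2norm M (G n))\<^sup>2 / 2))
        \<longlonglongrightarrow> p * (inf_energy + 0 - (l2norm M H)\<^sup>2 / 2)"
      by (intro tendsto_intros LIMSEQ_Suc[OF lim_1_over_n] l2_tendsto_imp_l2norm_tendsto[OF l(2) H(1) H(4)]) auto
    then have "(\<lambda>n. p * (inf_energy + 1 / real (Suc n) - (l2norm M (G n))\<^sup>2 / 2)) \<longlonglongrightarrow> b"
      by (simp add: b_def)
    then have "\<forall>\<^sub>F n in sequentially. p * (inf_energy + 1 / real (Suc n) - (l2norm M (G n))\<^sup>2 / 2) < b + e"
      by (rule order_tendstoD(2)) (use e in simp)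
    then have "\<forall>\<^sub>F n in sequentially. pint (u n) \<le> b + e"
    proof eventually_elim
      case (elim n)
      have "pint (u n) / p \<le> inf_energy + 1 / real (Suc n) - (l2norm M (G n))\<^sup>2 / 2"
        using u(4)[of n] unfolding energy_eq[OF u(2)] by linarith
      then have "pint (u n) \<le> p * (inf_energy + 1 / real (Suc n) - (l2norm M (G n))\<^sup>2 / 2)"
        using p by (simp add: pos_divide_le_eq mult.commute)
      with elim show ?case by linarith
    qed
    \<comment> \<open>Pointwise convergence is available only along \<open>r\<close>, so the bound
      is restricted to it before Fatou's lemma.\<close>
    then have ev: "\<forall>\<^sub>F n in sequentially. pint (u (r n)) \<le> b + e"
      using filterlim_subseq[OF U(2)] by (rule eventually_compose_filterlim)
    have ae: "AE x in M. (\<lambda>k. \<bar>u (r k) x\<bar> powr p) \<longlonglongrightarrow> \<bar>U x\<bar> powr p"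
      using U(3)
    proof eventually_elim
      case (elim x)
      have "isCont (\<lambda>y. \<bar>y\<bar> powr p) (U x)" using DERIV_abs_powr[OF p] DERIV_isCont by blast
      then show ?case using elim isCont_tendsto_compose by blast
    qed
    have Um [measurable]: "U \<in> borel_measurable M" using U(1) by (simp add: l2_def)
    have m: "(\<lambda>x. \<bar>U x\<bar> powr p) \<in> borel_measurable M" by measurable
    have i: "integrable M (\<lambda>x. \<bar>u (r k) x\<bar> powr p)" for k using u(1) by (simp add: Lp_iff)
    show ?thesis
      using Fatou_bound[OF i _ m _ ae ev] Um by (simp add: Lp_iff)
  qed
  then have UL: "U \<in> Lp p \<Omega>" using zero_less_one by blast
  have "pint U \<le> b" using bnd field_le_epsilon by blast
  then have "pint U / p \<le> inf_energy - (l2norm M H)\<^sup>2 / 2"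
    using p by (simp add: b_def pos_divide_le_eq mult.commute)
  then have "energy p \<Omega> U \<le> inf_energy" unfolding energy_eq[OF g] by simp
  moreover have ad: "admissible U"
    unfolding admissible_def Lp_norm_2_eq_l2norm using UL U1 g H01_iff_grad0 by blast
  ultimately show ?thesis using that inf_energy_le by (metis order_antisym)
qed

end

section \<open>The Euler-Lagrange equation\<close>

context ground_state_problem
begin

text \<open>By convexity the quotients for \<open>0 < t \<le> 1\<close> lie between the chord slopes
  for steps -1 and 1. This gives a dominating function that does not depend on
  \<open>t\<close>.\<close>

lemma difference_quotient_abs_powr_le:
  fixes x y t :: real
  assumes "t \<noteq> 0" "\<bar>t\<bar> \<le> 1"
  shows "\<bar>(\<bar>x + t * y\<bar> powr p - \<bar>x\<bar> powr p) / t\<bar> \<le> \<bar>x + y\<bar> powr p + \<bar>x - y\<bar> powr p + 2 * \<bar>x\<bar> powr p"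
proof -
  note c = convex_onD[OF convex_abs_powr[OF p], simplified]
  have pos: "\<bar>(\<bar>x + t * y\<bar> powr p - \<bar>x\<bar> powr p) / t\<bar> \<le> \<bar>x + y\<bar> powr p + \<bar>x - y\<bar> powr p + 2 * \<bar>x\<bar> powr p"
    if t: "0 < t" "t \<le> 1" for t y
  proof -
    have "\<bar>(1 - t) * x + t * (x + y)\<bar> powr p \<le> (1 - t) * \<bar>x\<bar> powr p + t * \<bar>x + y\<bar> powr p"
      using c[of t x "x + y"] t by simp
    moreover have "(1 - t) * x + t * (x + y) = x + t * y" by (simp add: algebra_simps)
    ultimately have up: "\<bar>x + t * y\<bar> powr p - \<bar>x\<bar> powr p \<le> t * (\<bar>x + y\<bar> powr p - \<bar>x\<bar> powr p)"
      by (simp add: algebra_simps)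
    \<comment> \<open>For the lower bound, \<open>x\<close> is written as a convex combination of
      \<open>x + t * y\<close> and \<open>x - y\<close>; the weight of the latter is
      \<open>t / (1 + t)\<close>.\<close>
    have "\<bar>(1 - t / (1 + t)) * (x + t * y) + (t / (1 + t)) * (x - y)\<bar> powr p
        \<le> (1 - t / (1 + t)) * \<bar>x + t * y\<bar> powr p + (t / (1 + t)) * \<bar>x - y\<bar> powr p"
      using c[of "t / (1 + t)" "x + t * y" "x - y"] t by simp
    moreover have "(1 - t / (1 + t)) * (x + t * y) + (t / (1 + t)) * (x - y) = x"
    proof -
      have "1 - t / (1 + t) = 1 / (1 + t)" using t by (simp add: field_simps)
      then have "(1 - t / (1 + t)) * (x + t * y) + (t / (1 + t)) * (x - y) = (x + t * y + t * (x - y)) / (1 + t)"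
        by (simp add: add_divide_distrib)
      also have "\<dots> = x * (1 + t) / (1 + t)" by (simp add: algebra_simps)
      finally show ?thesis using t by simp
    qed
    ultimately have "\<bar>x\<bar> powr p \<le> (1 - t / (1 + t)) * \<bar>x + t * y\<bar> powr p + (t / (1 + t)) * \<bar>x - y\<bar> powr p"
      by simp
    then have "(1 + t) * \<bar>x\<bar> powr p \<le> (1 + t) * ((1 - t / (1 + t)) * \<bar>x + t * y\<bar> powr p + (t / (1 + t)) * \<bar>x - y\<bar> powr p)"
      using t by (intro mult_left_mono) auto
    also have "\<dots> = ((1 + t) * (1 - t / (1 + t))) * \<bar>x + t * y\<bar> powr p + ((1 + t) * (t / (1 + t))) * \<bar>x - y\<bar> powr p"
      by (simp only: distrib_left mult.assoc)
    also have "(1 + t) * (1 - t / (1 + t)) = 1" using t by (simp add: field_simps)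
    also have "(1 + t) * (t / (1 + t)) = t" using t by simp
    finally have lo: "t * (\<bar>x\<bar> powr p - \<bar>x - y\<bar> powr p) \<le> \<bar>x + t * y\<bar> powr p - \<bar>x\<bar> powr p"
      by (simp add: algebra_simps)
    have "(\<bar>x + t * y\<bar> powr p - \<bar>x\<bar> powr p) / t \<le> \<bar>x + y\<bar> powr p - \<bar>x\<bar> powr p"
      using up t by (simp add: pos_divide_le_eq mult.commute)
    moreover have "\<bar>x\<bar> powr p - \<bar>x - y\<bar> powr p \<le> (\<bar>x + t * y\<bar> powr p - \<bar>x\<bar> powr p) / t"
      using lo t by (simp add: pos_le_divide_eq mult.commute)
    moreover have "0 \<le> \<bar>x\<bar> powr p" "0 \<le> \<bar>x + y\<bar> powr p" "0 \<le> \<bar>x - y\<bar> powr p" by simp_all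
    ultimately show ?thesis by linarith
  qed
  show ?thesis
  proof (cases "t > 0")
    case True
    then show ?thesis using pos[of t y] assms by simp
  next
    case False
    then have t: "0 < - t" "- t \<le> 1" using assms by auto
    \<comment> \<open>Negating both \<open>t\<close> and \<open>y\<close> reduces to positive steps;
      the bound is symmetric in the sign of \<open>y\<close>, and the absolute value absorbs the
      sign of the quotient.\<close>
    have "\<bar>(\<bar>x + t * y\<bar> powr p - \<bar>x\<bar> powr p) / t\<bar> = \<bar>(\<bar>x + (- t) * (- y)\<bar> powr p - \<bar>x\<bar> powr p) / (- t)\<bar>"
      by simp
    also have "\<dots> \<le> \<bar>x + (- y)\<bar> powr p + \<bar>x - (- y)\<bar> powr p + 2 * \<bar>x\<bar> powr p"
      by (rule pos[OF t])
    finally show ?thesis by simp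
  qed
qed

text \<open>Differentiation under the integral by dominated convergence, with convexity providing
  the domination.\<close>

lemma DERIV_pint:
  assumes "u \<in> Lp p \<Omega>" "v \<in> Lp p \<Omega>"
  shows "((\<lambda>t. pint (\<lambda>x. u x + t * v x)) has_real_derivative p * (LINT x|M. \<bar>u x\<bar> powr (p - 2) * u x * v x)) (at 0)"
proof -
  have [measurable]: "u \<in> borel_measurable M" "v \<in> borel_measurable M" using assms by (auto simp: Lp_iff)
  have i: "integrable M (\<lambda>x. \<bar>u x + t * v x\<bar> powr p)" for t
    using Lp_add[OF assms(1) Lp_cmult[OF assms(2), of t]] by (simp add: Lp_iff)
  have "(\<lambda>h. (pint (\<lambda>x. u x + h * v x) - pint u) / h) \<midarrow>0\<rightarrow> (LINT x|M. p * (\<bar>u x\<bar> powr (p - 2) * u x * v x))"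
    unfolding tendsto_at_iff_sequentially
  proof (intro allI impI)
    fix X :: "nat \<Rightarrow> real" assume X0: "\<forall>i. X i \<in> UNIV - {0}" and X: "X \<longlonglongrightarrow> 0"
    \<comment> \<open>Domination is needed for every index, but
      \<open>\<bar>X n\<bar> \<le> 1\<close> holds only eventually; the early terms are replaced by
      1, which is admissible and nonzero.\<close>
    define Y where "Y n = (if \<bar>X n\<bar> \<le> 1 then X n else 1)" for n
    have Y0: "Y n \<noteq> 0" "\<bar>Y n\<bar> \<le> 1" for n using X0 by (auto simp: Y_def)
    have "\<forall>\<^sub>F n in sequentially. \<bar>X n\<bar> < 1"
      using order_tendstoD(2)[OF tendsto_rabs_zero[OF X], of 1] by simp
    then have XY: "\<forall>\<^sub>F n in sequentially. Y n = X n"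
      by eventually_elim (simp add: Y_def)
    have Y: "Y \<longlonglongrightarrow> 0"
      using X XY by (metis (mono_tags, lifting) tendsto_cong)
    have lim: "(\<lambda>n. LINT x|M. (\<bar>u x + Y n * v x\<bar> powr p - \<bar>u x\<bar> powr p) / Y n)
        \<longlonglongrightarrow> (LINT x|M. p * (\<bar>u x\<bar> powr (p - 2) * u x * v x))"
    proof (rule integral_dominated_convergence)
      show "integrable M (\<lambda>x. \<bar>u x + v x\<bar> powr p + \<bar>u x - v x\<bar> powr p + 2 * \<bar>u x\<bar> powr p)"
        using i[of 1] i[of "- 1"] i[of 0] by simp
      show "AE x in M. norm ((\<bar>u x + Y n * v x\<bar> powr p - \<bar>u x\<bar> powr p) / Y n)
          \<le> \<bar>u x + v x\<bar> powr p + \<bar>u x - v x\<bar> powr p + 2 * \<bar>u x\<bar> powr p" for n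
        unfolding real_norm_def by (intro AE_I2 difference_quotient_abs_powr_le Y0)
      show "AE x in M. (\<lambda>n. (\<bar>u x + Y n * v x\<bar> powr p - \<bar>u x\<bar> powr p) / Y n) \<longlonglongrightarrow> p * (\<bar>u x\<bar> powr (p - 2) * u x * v x)"
      proof (rule AE_I2)
        fix x
        have "((\<lambda>t. \<bar>u x + t * v x\<bar> powr p) has_real_derivative p * (\<bar>u x + 0 * v x\<bar> powr (p - 2) * (u x + 0 * v x)) * v x) (at 0)"
          by (rule DERIV_chain2[OF DERIV_abs_powr[OF p]]) (auto intro!: derivative_eq_intros)
        then have "((\<lambda>h. (\<bar>u x + h * v x\<bar> powr p - \<bar>u x\<bar> powr p) / h) \<longlongrightarrow> p * (\<bar>u x\<bar> powr (p - 2) * u x * v x)) (at 0)"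
          by (simp add: DERIV_def mult.assoc)
        moreover have "filterlim Y (at 0) sequentially"
          using Y Y0 by (simp add: filterlim_at)
        ultimately show "(\<lambda>n. (\<bar>u x + Y n * v x\<bar> powr p - \<bar>u x\<bar> powr p) / Y n) \<longlonglongrightarrow> p * (\<bar>u x\<bar> powr (p - 2) * u x * v x)"
          by (rule filterlim_compose)
      qed
    qed measurable
    have "(LINT x|M. (\<bar>u x + Y n * v x\<bar> powr p - \<bar>u x\<bar> powr p) / Y n) = (pint (\<lambda>x. u x + Y n * v x) - pint u) / Y n" for n
      using i[of "Y n"] i[of 0] by simp
    from lim[unfolded this]
    have "(\<lambda>n. (pint (\<lambda>x. u x + Y n * v x) - pint u) / Y n) \<longlonglongrightarrow> (LINT x|M. p * (\<bar>u x\<bar> powr (p - 2) * u x * v x))" .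
    then show "((\<lambda>h. (pint (\<lambda>x. u x + h * v x) - pint u) / h) \<circ> X) \<longlonglongrightarrow> (LINT x|M. p * (\<bar>u x\<bar> powr (p - 2) * u x * v x))"
      by (rule Lim_transform_eventually) (use XY in \<open>eventually_elim, simp\<close>)
  qed
  then show ?thesis by (simp add: DERIV_def)
qed

text \<open>\<open>F t\<close> is the energy of the normalized \<open>U + t v\<close>, with
  \<open>q t\<close> its squared L^2 norm before normalization, whence the exponent
  \<open>p / 2\<close>. Since \<open>q 0 = 1\<close>, the quotient rule leaves the two pairings
  minus the squared gradient norm and \<open>pint U\<close>, each times the integral of
  \<open>U v\<close>.\<close>

lemma euler_lagrange:
  assumes U: "U \<in> Lp p \<Omega>" "grad0 U G" "l2norm M U = 1" "energy p \<Omega> U = inf_energy"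
    and v: "v \<in> Lp p \<Omega>" "grad0 v H"
  shows "(LINT x|M. G x \<bullet> H x) + (LINT x|M. \<bar>U x\<bar> powr (p - 2) * U x * v x)
    = ((l2norm M G)\<^sup>2 + pint U) * (LINT x|M. U x * v x)"
proof -
  define q where "q t = 1 + 2 * t * (LINT x|M. U x * v x) + t\<^sup>2 * (l2norm M v)\<^sup>2" for t
  define a where "a t = (l2norm M G)\<^sup>2 + 2 * t * (LINT x|M. G x \<bullet> H x) + t\<^sup>2 * (l2norm M H)\<^sup>2" for t
  define b where "b t = pint (\<lambda>x. U x + t * v x)" for t
  define F where "F t = a t / (2 * q t) + b t / (p * q t powr (p / 2))" for t
  note lU = grad0_l2[OF U(2)] and lv = grad0_l2[OF v(2)]
  have q: "(l2norm M (\<lambda>x. U x + t * v x))\<^sup>2 = q t" for t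
    using l2norm_add_power2[OF lU(1) l2_scaleR[OF lv(1), of t]] l2norm_scaleR[of M t v] U(3)
    by (simp add: q_def power_mult_distrib mult.left_commute[of _ t])
  have a: "(l2norm M (\<lambda>x. G x + t *\<^sub>R H x))\<^sup>2 = a t" for t
    using l2norm_add_power2[OF lU(2) l2_scaleR[OF lv(2), of t]]
    by (simp add: a_def power_mult_distrib l2norm_scaleR)
  have dq: "(q has_real_derivative 2 * (LINT x|M. U x * v x)) (at 0)"
    unfolding q_def by (auto intro!: derivative_eq_intros)
  have da: "(a has_real_derivative 2 * (LINT x|M. G x \<bullet> H x)) (at 0)"
    unfolding a_def by (auto intro!: derivative_eq_intros)
  have db: "(b has_real_derivative p * (LINT x|M. \<bar>U x\<bar> powr (p - 2) * U x * v x)) (at 0)"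
    unfolding b_def by (rule DERIV_pint[OF U(1) v(1)])
  have q0: "q 0 = 1" and a0: "a 0 = (l2norm M G)\<^sup>2" and b0: "b 0 = pint U"
    by (simp_all add: q_def a_def b_def)
  have "(q \<longlongrightarrow> q 0) (at 0)" using DERIV_isCont[OF dq] by (simp add: isCont_def)
  \<comment> \<open>Normalization requires a positive norm, which continuity of \<open>q\<close>
    guarantees near 0; a local minimum is enough.\<close>
  then have "\<forall>\<^sub>F t in at 0. 0 < q t" by (rule order_tendstoD(1)) (simp add: q0)
  then obtain d where d: "d > 0" "\<And>t. t \<noteq> 0 \<Longrightarrow> \<bar>t\<bar> < d \<Longrightarrow> 0 < q t"
    by (auto simp: eventually_at dist_real_def)
  have F0: "F 0 = inf_energy"
    using U(4) unfolding energy_eq[OF U(2)] by (simp add: F_def q0 a0 b0)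
  have min: "F 0 \<le> F t" if t: "\<bar>t\<bar> < d" for t
  proof (cases "t = 0")
    case False
    then have qt: "0 < q t" using d(2) t by blast
    let ?w = "\<lambda>x. U x + t * v x"
    have s: "l2norm M ?w = sqrt (q t)"
      using q[of t] l2norm_nonneg[of M ?w] by (metis real_sqrt_unique)
    have g: "grad0 ?w (\<lambda>x. G x + t *\<^sub>R H x)" by (rule grad0_add[OF U(2) grad0_cmult[OF v(2)]])
    have pw: "?w \<in> Lp p \<Omega>" by (rule Lp_add[OF U(1) Lp_cmult[OF v(1)]])
    have pos: "l2norm M ?w > 0" using qt s by simp
    have "l2norm M ?w powr p = q t powr (p / 2)"
      unfolding s using qt by (simp add: powr_powr flip: powr_half_sqrt)
    then have "energy p \<Omega> (\<lambda>x. (1 / l2norm M ?w) * ?w x) = F t"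
      unfolding admissible_normalize(2)[OF pw g pos] F_def a q b_def by simp
    then show ?thesis using inf_energy_le[OF admissible_normalize(1)[OF pw g pos]] F0 by simp
  qed simp
  have dqp: "((\<lambda>t. q t powr (p / 2)) has_real_derivative p * (LINT x|M. U x * v x)) (at 0)"
  proof -
    have "((\<lambda>t. q t powr (p / 2)) has_real_derivative (p / 2 * q 0 powr (p / 2 - 1)) * (2 * (LINT x|M. U x * v x))) (at 0)"
      by (rule DERIV_chain2[OF has_real_derivative_powr dq]) (simp add: q0)
    then show ?thesis by (simp add: q0)
  qed
  have d1: "((\<lambda>t. a t / (2 * q t)) has_real_derivative
      (LINT x|M. G x \<bullet> H x) - (l2norm M G)\<^sup>2 * (LINT x|M. U x * v x)) (at 0)"
  proof -
    have dq2: "((\<lambda>t. 2 * q t) has_real_derivative 2 * (2 * (LINT x|M. U x * v x))) (at 0)"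
      by (rule DERIV_cmult[OF dq])
    show ?thesis
      by (rule DERIV_cong[OF DERIV_divide[OF da dq2]])
         (simp_all add: q0 a0 diff_divide_distrib)
  qed
  have d2: "((\<lambda>t. b t / (p * q t powr (p / 2))) has_real_derivative
      (LINT x|M. \<bar>U x\<bar> powr (p - 2) * U x * v x) - pint U * (LINT x|M. U x * v x)) (at 0)"
  proof -
    have dq3: "((\<lambda>t. p * q t powr (p / 2)) has_real_derivative p * (p * (LINT x|M. U x * v x))) (at 0)"
      by (rule DERIV_cmult[OF dqp])
    show ?thesis
      by (rule DERIV_cong[OF DERIV_divide[OF db dq3]])
         (use p in \<open>simp_all add: q0 b0 diff_divide_distrib\<close>)
  qed
  have "(F has_real_derivative ((LINT x|M. G x \<bullet> H x) - (l2norm M G)\<^sup>2 * (LINT x|M. U x * v x))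
      + ((LINT x|M. \<bar>U x\<bar> powr (p - 2) * U x * v x) - pint U * (LINT x|M. U x * v x))) (at 0)"
    unfolding F_def by (rule DERIV_add[OF d1 d2])
  from DERIV_local_min[OF this d(1)] min
  have "((LINT x|M. G x \<bullet> H x) - (l2norm M G)\<^sup>2 * (LINT x|M. U x * v x))
      + ((LINT x|M. \<bar>U x\<bar> powr (p - 2) * U x * v x) - pint U * (LINT x|M. U x * v x)) = 0"
    by simp
  then show ?thesis by (simp add: algebra_simps)
qed

text \<open>It remains to return from the pairs to the chosen representatives: they agree almost
  everywhere with \<open>G\<close> and \<open>H\<close>, so pairing and norm do not change.\<close>

lemma minimizer_solves_stationary_equation:
  assumes "admissible U" "energy p \<Omega> U = inf_energy"
  shows "solves_stationary_equation p \<Omega> U"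
  unfolding solves_stationary_equation_def
proof
  obtain G where U: "grad0 U G" "U \<in> Lp p \<Omega>" "l2norm M U = 1" by (rule admissible_grad0[OF assms(1)])
  fix v assume "v \<in> Lp p \<Omega> \<inter> H01 \<Omega>"
  then obtain H where v: "v \<in> Lp p \<Omega>" "grad0 v H" using H01_iff_grad0 by auto
  note lU = grad0_weak_gradient[OF U(1)] and lv = grad0_weak_gradient[OF v(2)]
  have "(LINT x|M. weak_gradient \<Omega> U x \<bullet> weak_gradient \<Omega> v x) = (LINT x|M. G x \<bullet> H x)"
  proof (rule integral_cong_AE)
    show "AE x in M. weak_gradient \<Omega> U x \<bullet> weak_gradient \<Omega> v x = G x \<bullet> H x"
      using lU(1) lv(1) by eventually_elim simp
  qed (use lU(2) lv(2) grad0_l2(2)[OF U(1)] grad0_l2(2)[OF v(2)] in \<open>auto simp: l2_def\<close>)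
  then have lap: "laplacian_pairing \<Omega> U v = - (LINT x|M. G x \<bullet> H x)" by (simp add: laplacian_pairing_def)
  have "Lp_norm p \<Omega> U powr p = pint U"
    using p by (simp add: Lp_norm_def powr_powr)
  moreover have "fun_pairing \<Omega> (\<lambda>x. c * U x) v = c * (LINT x|M. U x * v x)" for c
    by (simp add: fun_pairing_def mult.assoc)
  ultimately show "laplacian_pairing \<Omega> U v - fun_pairing \<Omega> (\<lambda>x. \<bar>U x\<bar> powr (p - 2) * U x) v
      + fun_pairing \<Omega> (\<lambda>x. (Lp_norm 2 \<Omega> (weak_gradient \<Omega> U))\<^sup>2 * U x) v
      + fun_pairing \<Omega> (\<lambda>x. Lp_norm p \<Omega> U powr p * U x) v = 0"
    using euler_lagrange[OF U(2,1,3) assms(2) v] lap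
    by (simp add: fun_pairing_def[of \<Omega> "\<lambda>x. \<bar>U x\<bar> powr (p - 2) * U x"]
        Lp_norm_2_eq_l2norm lU(3) distrib_right)
qed

end

theorem theorem5p5:
  fixes \<Omega> :: "'a::euclidean_space set" and p :: real
  assumes "2 \<le> p"
    and "bounded_smooth_domain \<Omega>"
  shows "\<exists>U. ground_state p \<Omega> U \<and> solves_stationary_equation p \<Omega> U"
proof -
  interpret ground_state_problem \<Omega> p
    using assms by unfold_locales (auto simp: bounded_smooth_domain_def)
  obtain U where U: "admissible U" "energy p \<Omega> U = inf_energy" by (rule minimizer_exists)
  have "ground_state p \<Omega> U"
    unfolding ground_state_def is_arg_min_def
    using U inf_energy_le unfolding admissible_def by (auto simp: not_less)
  with minimizer_solves_stationary_equation[OF U] show ?thesis by blast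
qed

end
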